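(* Let $X$, $\alpha$, $C$, $\lambda$, $n$, $r$, $X_{r:n}$, $\hat r$ and $f_p$ be as in the context. Then for any $p\in\mathbb R$, $$\mathbb P\big(X_{r:n}(t)>f_p(t)\ \text{i.o.}\big)=\begin{cases}1&\text{if }p\ge0,\\ 0&\text{if }p<0.\end{cases}$$ Furthermore, $$\limsup_{t\to\infty}\frac{X_{r:n}(t)}{\sqrt{\log t}}=\sqrt{\frac{2}{\hat r}}\quad\text{almost surely.}$$
   Context: $X=\{X(t):t\in\mathbb R_+\}$ is a stationary Gaussian process with almost surely continuous sample paths, $\mathbb E X(t)=0$, $\mathbb E X^2(t)=1$, whose correlation function $r(t)=\mathbb E X(t)X(0)$ satisfies: (i) $r(t)=1-C|t|^\alpha+o(|t|^\alpha)$ as $t\to0$, for some $0<\alpha\le2$ and $C>0$; (ii) $r^*(s):=\sup_{t\ge s}|r(t)|<1$ for each $s>0$; (iii) $r(t)=O(t^{-2\lambda})$ as $t\to\infty$, for some $\lambda>0$. For $n\ge1$, $X_1,\dots,X_n$ are mutually independent copies of $X$, and for an integer $1\le r\le n$ (not to be confused with the correlation function $r(\cdot)$), $X_{r:n}=\{X_{r:n}(t):t\ge0\}$ is the $r$th smallest order statistics process: for each $t\ge 0$, $X_{r:n}(t)$ is the $r$th smallest of $X_1(t),\dots,X_n(t)$, so that $X_{1:n}(t)=\min_j X_j(t)\le\dots\le X_{n:n}(t)=\max_j X_j(t)$. Put $\hat r=n-r+1$ and $\log_2 s=\log\log s$. For $p\in\mathbb R$, $$f_p(s)=\left(\frac{2}{\hat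 r}\left(\log s+\left(\frac{2-\hat r\alpha}{2\alpha}+1-p\right)\log_2 s\right)\right)^{1/2},$$ considered for all $s$ large enough that it is well defined and positive. "$X_{r:n}(t)>f_p(t)$ i.o." denotes the event that the set of $t$ (in the domain of $f_p$) with $X_{r:n}(t)>f_p(t)$ is unbounded. *)

theory Defs
  imports "HOL-Probability.Probability" "HOL-Library.Landau_Symbols"
begin

text \<open>
  A process indexed by the nonnegative reals is a function \<open>X :: real \<Rightarrow> 'a \<Rightarrow> real\<close> of which
  only the values \<open>X t\<close> with \<open>t \<ge> 0\<close> are used.
\<close>

definition sample_path :: "(real \<Rightarrow> 'a \<Rightarrow> real) \<Rightarrow> 'a \<Rightarrow> real \<Rightarrow> real" where
  "sample_path X \<omega> = (\<lambda>t\<in>{0..}. X t \<omega>)"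

abbreviation path_space :: "(real \<Rightarrow> real) measure" where
  "path_space \<equiv> Pi\<^sub>M {0::real..} (\<lambda>_. borel :: real measure)"

definition process_law :: "'a measure \<Rightarrow> (real \<Rightarrow> 'a \<Rightarrow> real) \<Rightarrow> (real \<Rightarrow> real) measure" where
  "process_law M X = distr M path_space (sample_path X)"

text \<open>Degenerate (constant) Gaussian variables are allowed, as the case \<open>\<sigma> = 0\<close>.\<close>

definition gaussian_rv :: "'a measure \<Rightarrow> ('a \<Rightarrow> real) \<Rightarrow> bool" where
  "gaussian_rv M Y \<longleftrightarrow> Y \<in> borel_measurable M \<and>
     (\<exists>\<mu> \<sigma>. \<sigma> \<ge> 0 \<and> distr M borel Y =
        (if \<sigma> = 0 then return borel \<mu> else density lborel (\<lambda>x. ennreal (normal_density \<mu> \<sigma> x))))"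

text \<open>
  All finite-dimensional distributions are (possibly degenerate) multivariate normal, i.e. every
  finite linear combination of the \<open>X t\<close> is Gaussian.
\<close>

definition gaussian_process :: "'a measure \<Rightarrow> (real \<Rightarrow> 'a \<Rightarrow> real) \<Rightarrow> bool" where
  "gaussian_process M X \<longleftrightarrow>
     (\<forall>T a. finite T \<longrightarrow> T \<subseteq> {0..} \<longrightarrow> gaussian_rv M (\<lambda>\<omega>. \<Sum>t\<in>T. a t * X t \<omega>))"

definition stationary_process :: "'a measure \<Rightarrow> (real \<Rightarrow> 'a \<Rightarrow> real) \<Rightarrow> bool" where
  "stationary_process M X \<longleftrightarrow> (\<forall>h\<ge>0. process_law M (\<lambda>t. X (t + h)) = process_law M X)"

definition continuous_paths :: "'a measure \<Rightarrow> (real \<Rightarrow> 'a \<Rightarrow> real) \<Rightarrow> bool" where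
  "continuous_paths M X \<longleftrightarrow> (AE \<omega> in M. continuous_on {0..} (\<lambda>t. X t \<omega>))"

definition correlation :: "'a measure \<Rightarrow> (real \<Rightarrow> 'a \<Rightarrow> real) \<Rightarrow> real \<Rightarrow> real" where
  "correlation M X t = (\<integral>\<omega>. X t \<omega> * X 0 \<omega> \<partial>M)"

definition independent_processes ::
    "'a measure \<Rightarrow> (nat \<Rightarrow> real \<Rightarrow> 'a \<Rightarrow> real) \<Rightarrow> nat set \<Rightarrow> bool" where
  "independent_processes M Xs J \<longleftrightarrow>
     prob_space.indep_vars M (\<lambda>_. path_space) (\<lambda>j. sample_path (Xs j)) J"

definition order_stat_process ::
    "nat \<Rightarrow> nat \<Rightarrow> (nat \<Rightarrow> real \<Rightarrow> 'a \<Rightarrow> real) \<Rightarrow> real \<Rightarrow> 'a \<Rightarrow> real" where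
  "order_stat_process r n Xs t \<omega> = sort (map (\<lambda>j. Xs j t \<omega>) [1..<Suc n]) ! (r - 1)"

definition r_hat :: "nat \<Rightarrow> nat \<Rightarrow> real" where
  "r_hat r n = real n - real r + 1"

text \<open>The square \<open>f\<^sub>p(s)\<^sup>2\<close>; the paper's \<open>log\<^sub>2 s\<close> is the iterated logarithm \<open>ln (ln s)\<close>.\<close>

definition threshold_sq :: "real \<Rightarrow> nat \<Rightarrow> nat \<Rightarrow> real \<Rightarrow> real \<Rightarrow> real" where
  "threshold_sq \<alpha> r n p s =
     2 / r_hat r n * (ln s + ((2 - r_hat r n * \<alpha>) / (2 * \<alpha>) + 1 - p) * ln (ln s))"

definition threshold :: "real \<Rightarrow> nat \<Rightarrow> nat \<Rightarrow> real \<Rightarrow> real \<Rightarrow> real" where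
  "threshold \<alpha> r n p s = sqrt (threshold_sq \<alpha> r n p s)"

text \<open>\<open>s > 1\<close> makes \<open>ln (ln s)\<close> meaningful; the domain contains all large \<open>s\<close>.\<close>

definition threshold_dom :: "real \<Rightarrow> nat \<Rightarrow> nat \<Rightarrow> real \<Rightarrow> real set" where
  "threshold_dom \<alpha> r n p = {s. s > 1 \<and> threshold_sq \<alpha> r n p s > 0}"

text \<open>
  Paths are only almost surely continuous, so the event \<open>exceeds_io\<close> need not be measurable in
  \<open>M\<close> itself; its probability is to be taken in \<open>completion M\<close>, with its measurability there
  stated explicitly since \<open>measure\<close> is 0 on non-measurable sets.
\<close>

definition exceeds_io ::
    "'a measure \<Rightarrow> real \<Rightarrow> nat \<Rightarrow> nat \<Rightarrow> real \<Rightarrow> (nat \<Rightarrow> real \<Rightarrow> 'a \<Rightarrow> real) \<Rightarrow> 'a set" where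
  "exceeds_io M \<alpha> r n p Xs =
     {\<omega> \<in> space M. \<not> bdd_above {t \<in> threshold_dom \<alpha> r n p.
        order_stat_process r n Xs t \<omega> > threshold \<alpha> r n p t}}"

end

theory Submission
  imports Defs "HOL-Real_Asymp.Real_Asymp"
begin

text \<open>
  Write \<open>rhat\<close> for the number \<open>n - r + 1\<close>. The \<open>r\<close>th smallest of the \<open>n\<close> values at time \<open>t\<close> exceeds \<open>u\<close>
  exactly when some \<open>rhat\<close> of the processes exceed \<open>u\<close> at \<open>t\<close>. As the processes are independent, every
  probability below is bounded by sums of \<open>rhat\<close>th powers of probabilities for one stationary Gaussian
  process, and these are estimated from its two-point laws alone. For two jointly normal
  variables with correlation \<open>\<rho>\<close>, the residual \<open>Y - \<rho> * X\<close> is independent of \<open>X\<close>, which is the one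
  fact about Gaussian vectors that is used. It is derived from Levy's uniqueness theorem on the line, applied to
  reweighted measures.

  The local condition makes \<open>u powr (- 2 / \<alpha>)\<close> the natural time scale at height \<open>u\<close>: on an interval of
  that length the path exceeds \<open>u\<close> with probability of order \<open>exp (- u\<^sup>2 / 2) / u\<close>, the order of a
  single-point exceedance (\<open>dyadic_exceedance_bound\<close>, by chaining along dyadic points with slightly
  increasing levels). A unit interval contains about \<open>u powr (2 / \<alpha>)\<close> such pieces, so the order
  statistics exceed \<open>u\<close> there with probability of order
  \<open>u powr (2 / \<alpha>) * (exp (- u\<^sup>2 / 2) / u) ^ rhat\<close>. For the threshold \<open>f\<^sub>p\<close> at time \<open>k\<close> this is of order
  \<open>1 / (k * ln k powr (1 - p))\<close>, a Bertrand series, which converges precisely for \<open>p < 0\<close>.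

  For \<open>p < 0\<close> the Borel--Cantelli lemma finishes (\<open>eventually_no_exceedance\<close>). For \<open>p \<ge> 0\<close> it is enough
  to treat \<open>p = 0\<close> and a fixed set of \<open>rhat\<close> processes, sampled on a grid of spacing about
  \<open>u powr (- 2 / \<alpha>)\<close>. A second-moment argument shows that almost surely infinitely many grid exceedances
  occur (\<open>infinitely_often_exceedance\<close>): their expected number up to time \<open>K\<close>, say \<open>S\<close>, tends to
  infinity, and the second moment is \<open>(1 + o(1)) * S\<^sup>2 + O(S)\<close>. The pairs of grid points contribute as
  follows. Within one unit block the local condition makes an exceedance bring only boundedly many others
  in the mean. Between blocks at distance at most a small power of the time, the
  bound \<open>R \<le> 1 - \<kappa>\<close> yields a factor that is a negative power of the time. At larger distances
  the polynomial decay of the correlation beats the logarithmic growth of \<open>u\<^sup>2\<close>, so that the two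
  exceedances are independent up to a factor \<open>1 + o(1)\<close> (\<open>gauss_pair_asymp_indep\<close>).

  The limit superior follows by comparing with \<open>f\<^sub>p\<close> for one negative \<open>p\<close> and with \<open>f\<^sub>0\<close>, since
  \<open>f\<^sub>p(t) / sqrt (ln t)\<close> tends to \<open>sqrt (2 / rhat)\<close> for every \<open>p\<close>.
\<close>

section \<open>Independence from a factorising characteristic function\<close>

text \<open>
  The measure with density \<open>h / c\<close> is a probability measure under which \<open>X\<close> has an unchanged
  characteristic function, hence an unchanged law. This turns uniqueness on the line into a statement
  about how \<open>X\<close> interacts with a second variable, hidden in \<open>h\<close>.
\<close>

lemma (in prob_space) integral_density_char_eq:
  fixes X h :: "'a \<Rightarrow> real"
  assumes [measurable]: "random_variable borel X" "random_variable borel h"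
    and h: "\<And>\<omega>. 0 \<le> h \<omega>" "\<And>\<omega>. h \<omega> \<le> B" and c: "c > 0"
    and cf: "\<And>a. (CLINT \<omega>|M. h \<omega> * iexp (a * X \<omega>)) = complex_of_real c * (CLINT \<omega>|M. iexp (a * X \<omega>))"
    and A [measurable]: "A \<in> sets borel"
  shows "(\<integral>\<omega>. h \<omega> * indicator A (X \<omega>) \<partial>M) = c * prob {\<omega> \<in> space M. X \<omega> \<in> A}"
proof -
  define M' where "M' = density M (\<lambda>\<omega>. ennreal (h \<omega> / c))"
  have [measurable_cong, simp]: "sets M' = sets M" "space M' = space M"
    by (simp_all add: M'_def)
  have inth: "integrable M h"
    by (rule integrable_const_bound[of _ B]) (use h in auto)
  have "complex_of_real (\<integral>\<omega>. h \<omega> \<partial>M) = (CLINT \<omega>|M. h \<omega> * iexp (0 * X \<omega>))"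
    by (simp add: integral_complex_of_real)
  also have "\<dots> = c"
    unfolding cf by (simp add: prob_space)
  finally have inth_c: "(\<integral>\<omega>. h \<omega> \<partial>M) = c"
    using of_real_eq_iff by blast
  have "emeasure M' (space M') = (\<integral>\<^sup>+\<omega>. ennreal (h \<omega> / c) \<partial>M)"
    by (simp add: M'_def emeasure_density cong: nn_integral_cong)
  also have "\<dots> = ennreal (\<integral>\<omega>. h \<omega> / c \<partial>M)"
    by (rule nn_integral_eq_integral) (use inth h c in auto)
  also have "\<dots> = 1"
    using inth_c c by simp
  finally interpret M': prob_space M'
    by (intro prob_spaceI)
  have ch: "char (distr M' borel X) t = char (distr M borel X) t" for t
  proof -
    have "char (distr M' borel X) t = (CLINT \<omega>|M'. iexp (t * X \<omega>))"
      unfolding char_def by (subst integral_distr) auto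
    also have "\<dots> = (CLINT \<omega>|M. (h \<omega> / c) *\<^sub>R iexp (t * X \<omega>))"
      unfolding M'_def by (subst integral_density) (use h c in \<open>auto simp del: Re_exp Im_exp\<close>)
    also have "\<dots> = (CLINT \<omega>|M. (h \<omega> * iexp (t * X \<omega>)) / c)"
      by (simp add: scaleR_conv_of_real)
    also have "\<dots> = (CLINT \<omega>|M. iexp (t * X \<omega>))"
      using c by (simp only: integral_divide_zero cf) simp
    also have "\<dots> = char (distr M borel X) t"
      unfolding char_def by (subst integral_distr) auto
    finally show ?thesis .
  qed
  have eq: "distr M' borel X = distr M borel X"
    by (rule Levy_uniqueness) (auto simp: ch fun_eq_iff)
  have "(\<integral>\<omega>. h \<omega> * indicator A (X \<omega>) \<partial>M) = c * (\<integral>\<omega>. (h \<omega> / c) *\<^sub>R indicat_real A (X \<omega>) \<partial>M)"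
    using c by simp
  also have "(\<integral>\<omega>. (h \<omega> / c) *\<^sub>R indicat_real A (X \<omega>) \<partial>M) = (\<integral>\<omega>. indicat_real A (X \<omega>) \<partial>M')"
    unfolding M'_def by (subst integral_density) (use h c in auto)
  also have "\<dots> = (\<integral>x. indicat_real A x \<partial>distr M' borel X)"
    by (subst integral_distr) auto
  also have "\<dots> = measure (distr M borel X) A"
    by (simp add: eq)
  also have "\<dots> = prob {\<omega> \<in> space M. X \<omega> \<in> A}"
    by (subst measure_distr) (auto intro!: arg_cong[where f = prob])
  finally show ?thesis .
qed

text \<open>
  The preceding lemma is used twice. With \<open>h = 2 + cos (b * W)\<close> and \<open>h = 2 + sin (b * W)\<close>, where the 2 only
  ensures positivity, it shows that the event \<open>X \<in> A\<close> is uncorrelated with \<open>exp (\<i> * b * W)\<close>. With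
  \<open>h\<close> the indicator of this event it then shows that conditioning on the event leaves the law of
  \<open>W\<close> unchanged.
\<close>

lemma (in prob_space) prob_Int_if_char_factorises:
  fixes X W :: "'a \<Rightarrow> real"
  assumes [measurable]: "random_variable borel X" "random_variable borel W"
    and fac: "\<And>a b. (CLINT \<omega>|M. iexp (a * X \<omega> + b * W \<omega>)) =
                 (CLINT \<omega>|M. iexp (a * X \<omega>)) * (CLINT \<omega>|M. iexp (b * W \<omega>))"
    and A [measurable]: "A \<in> sets borel" and B [measurable]: "B \<in> sets borel"
  shows "prob {\<omega> \<in> space M. X \<omega> \<in> A \<and> W \<omega> \<in> B} =
    prob {\<omega> \<in> space M. X \<omega> \<in> A} * prob {\<omega> \<in> space M. W \<omega> \<in> B}"
proof -
  define P where "P = prob {\<omega> \<in> space M. X \<omega> \<in> A}"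
  define T :: "(real \<Rightarrow> real) \<Rightarrow> bool" where "T g \<longleftrightarrow> g \<in> borel_measurable borel \<and> (\<forall>x. \<bar>g x\<bar> \<le> 1)" for g
  have int: "integrable M (\<lambda>\<omega>. iexp (a * X \<omega> + b * W \<omega>))" for a b
    by (rule integrable_const_bound[of _ 1]) auto
  have intX: "integrable M (\<lambda>\<omega>. iexp (a * X \<omega>))" for a
    using int[of a 0] by simp
  have intW: "integrable M (\<lambda>\<omega>. iexp (b * W \<omega>))" for b
    using int[of 0 b] by simp
  have intA: "integrable M (\<lambda>\<omega>. indicat_real A (X \<omega>))"
    by (rule integrable_const_bound[of _ 1]) (auto simp: indicator_def)
  have "(\<integral>\<omega>. indicat_real A (X \<omega>) \<partial>M) = (\<integral>\<omega>. indicator {\<omega> \<in> space M. X \<omega> \<in> A} \<omega> \<partial>M)"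
    by (rule Bochner_Integration.integral_cong) (auto simp: indicator_def)
  then have intA_P: "(\<integral>\<omega>. indicat_real A (X \<omega>) \<partial>M) = P"
    by (simp add: P_def)
  have key: "(\<integral>\<omega>. g (W \<omega>) * indicator A (X \<omega>) \<partial>M) = (\<integral>\<omega>. g (W \<omega>) \<partial>M) * P"
    if g: "T g" and cf: "\<And>a. (CLINT \<omega>|M. g (W \<omega>) * iexp (a * X \<omega>)) =
      complex_of_real (\<integral>\<omega>. g (W \<omega>) \<partial>M) * (CLINT \<omega>|M. iexp (a * X \<omega>))" for g
  proof -
    have [measurable]: "g \<in> borel_measurable borel" and gb: "\<bar>g x\<bar> \<le> 1" for x
      using g by (auto simp: T_def)
    have gb': "-1 \<le> g x" "g x \<le> 1" for x
      using gb[of x] by auto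
    have intg: "integrable M (\<lambda>\<omega>. g (W \<omega>))"
      by (rule integrable_const_bound[of _ 1]) (auto simp: gb)
    have intgA: "integrable M (\<lambda>\<omega>. g (W \<omega>) * indicator A (X \<omega>))"
      by (rule integrable_const_bound[of _ 1]) (auto simp: gb indicator_def)
    have intgX: "integrable M (\<lambda>\<omega>. complex_of_real (g (W \<omega>)) * iexp (a * X \<omega>))" for a
      by (rule integrable_const_bound[of _ 1]) (auto simp: gb norm_mult)
    have Eg: "\<bar>\<integral>\<omega>. g (W \<omega>) \<partial>M\<bar> \<le> 1"
    proof -
      have "\<bar>\<integral>\<omega>. g (W \<omega>) \<partial>M\<bar> \<le> (\<integral>\<omega>. \<bar>g (W \<omega>)\<bar> \<partial>M)"
        by (rule integral_abs_bound)
      also have "\<dots> \<le> (\<integral>\<omega>. 1 \<partial>M)"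
        by (rule integral_mono) (use intg gb in auto)
      finally show ?thesis by (simp add: prob_space)
    qed
    have "(\<integral>\<omega>. (2 + g (W \<omega>)) * indicator A (X \<omega>) \<partial>M) = (2 + (\<integral>\<omega>. g (W \<omega>) \<partial>M)) * P"
      unfolding P_def
    proof (rule integral_density_char_eq[where B = 3])
      show "(CLINT \<omega>|M. complex_of_real (2 + g (W \<omega>)) * iexp (a * X \<omega>)) =
        complex_of_real (2 + (\<integral>\<omega>. g (W \<omega>) \<partial>M)) * (CLINT \<omega>|M. iexp (a * X \<omega>))" for a
        using cf[of a] intX[of a] intgX[of a] by (simp add: ring_distribs)
    next
      fix \<omega>
      show "0 \<le> 2 + g (W \<omega>)" "2 + g (W \<omega>) \<le> 3"
        using gb'[of "W \<omega>"] by linarith+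
    qed (use Eg in auto)
    moreover have "(\<integral>\<omega>. (2 + g (W \<omega>)) * indicator A (X \<omega>) \<partial>M) =
        2 * P + (\<integral>\<omega>. g (W \<omega>) * indicator A (X \<omega>) \<partial>M)"
      using intA intgA by (simp add: ring_distribs intA_P)
    ultimately show ?thesis
      by (simp add: ring_distribs)
  qed
  have gW: "integrable M (\<lambda>\<omega>. g (W \<omega>))" "integrable M (\<lambda>\<omega>. g (W \<omega>) * indicat_real A (X \<omega>))" if "T g" for g
    using that by (auto simp: T_def indicator_def intro!: integrable_const_bound[of _ 1])
  have cos_eq: "complex_of_real (cos x) = (iexp x + iexp (- x)) / 2"
    and sin_eq: "complex_of_real (sin x) = (iexp x - iexp (- x)) / (2 * \<i>)"
    and iexp_eq: "iexp x = complex_of_real (cos x) + \<i> * complex_of_real (sin x)" for x :: real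
    by (auto simp: complex_eq_iff Re_exp Im_exp Re_divide Im_divide power2_eq_square)
  have Tcos: "T (\<lambda>x. cos (b * x))" and Tsin: "T (\<lambda>x. sin (b * x))" for b
    by (auto simp: T_def)
  have cf: "(CLINT \<omega>|M. iexp (b * W \<omega>) * indicat_real A (X \<omega>)) = (CLINT \<omega>|M. iexp (b * W \<omega>)) * P" for b
  proof -
    have iexp_add: "iexp (b * W \<omega>) * iexp (a * X \<omega>) = iexp (a * X \<omega> + b * W \<omega>)" for a b \<omega>
      by (simp add: mult_exp_exp algebra_simps)
    have iexp_add': "iexp (- (b * W \<omega>)) * iexp (a * X \<omega>) = iexp (a * X \<omega> + (- b) * W \<omega>)" for a b \<omega>
      by (simp add: mult_exp_exp algebra_simps)
    have fac': "(CLINT \<omega>|M. iexp (a * X \<omega> + - b * W \<omega>)) =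
        (CLINT \<omega>|M. iexp (a * X \<omega>)) * (CLINT \<omega>|M. iexp (- (b * W \<omega>)))" for a
      using fac[of a "- b"] by simp
    have intWm: "integrable M (\<lambda>\<omega>. iexp (- (b * W \<omega>)))"
      using intW[of "- b"] by simp
    have 1: "(\<integral>\<omega>. cos (b * W \<omega>) * indicator A (X \<omega>) \<partial>M) = (\<integral>\<omega>. cos (b * W \<omega>) \<partial>M) * P"
    proof (rule key[OF Tcos])
      fix a
      have E: "complex_of_real (\<integral>\<omega>. cos (b * W \<omega>) \<partial>M) =
          ((CLINT \<omega>|M. iexp (b * W \<omega>)) + (CLINT \<omega>|M. iexp (- (b * W \<omega>)))) / 2"
        by (simp only: integral_complex_of_real[symmetric] cos_eq integral_divide_zero
            Bochner_Integration.integral_add[OF intW intWm])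
      have "(CLINT \<omega>|M. cos (b * W \<omega>) * iexp (a * X \<omega>)) =
          (CLINT \<omega>|M. (iexp (a * X \<omega> + b * W \<omega>) + iexp (a * X \<omega> + (- b) * W \<omega>)) / 2)"
        by (simp only: cos_eq times_divide_eq_left ring_distribs iexp_add iexp_add')
      also have "\<dots> = ((CLINT \<omega>|M. iexp (a * X \<omega> + b * W \<omega>)) + (CLINT \<omega>|M. iexp (a * X \<omega> + (- b) * W \<omega>))) / 2"
        by (simp only: integral_divide_zero Bochner_Integration.integral_add[OF int int])
      finally show "(CLINT \<omega>|M. cos (b * W \<omega>) * iexp (a * X \<omega>)) =
          complex_of_real (\<integral>\<omega>. cos (b * W \<omega>) \<partial>M) * (CLINT \<omega>|M. iexp (a * X \<omega>))"
        unfolding fac fac' E by (simp add: algebra_simps)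
    qed
    have 2: "(\<integral>\<omega>. sin (b * W \<omega>) * indicator A (X \<omega>) \<partial>M) = (\<integral>\<omega>. sin (b * W \<omega>) \<partial>M) * P"
    proof (rule key[OF Tsin])
      fix a
      have E: "complex_of_real (\<integral>\<omega>. sin (b * W \<omega>) \<partial>M) =
          ((CLINT \<omega>|M. iexp (b * W \<omega>)) - (CLINT \<omega>|M. iexp (- (b * W \<omega>)))) / (2 * \<i>)"
        by (simp only: integral_complex_of_real[symmetric] sin_eq integral_divide_zero
            Bochner_Integration.integral_diff[OF intW intWm])
      have "(CLINT \<omega>|M. sin (b * W \<omega>) * iexp (a * X \<omega>)) =
          (CLINT \<omega>|M. (iexp (a * X \<omega> + b * W \<omega>) - iexp (a * X \<omega> + (- b) * W \<omega>)) / (2 * \<i>))"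
        by (simp only: sin_eq times_divide_eq_left left_diff_distrib iexp_add iexp_add')
      also have "\<dots> = ((CLINT \<omega>|M. iexp (a * X \<omega> + b * W \<omega>)) - (CLINT \<omega>|M. iexp (a * X \<omega> + (- b) * W \<omega>))) / (2 * \<i>)"
        by (simp only: integral_divide_zero Bochner_Integration.integral_diff[OF int int])
      finally show "(CLINT \<omega>|M. sin (b * W \<omega>) * iexp (a * X \<omega>)) =
          complex_of_real (\<integral>\<omega>. sin (b * W \<omega>) \<partial>M) * (CLINT \<omega>|M. iexp (a * X \<omega>))"
        unfolding fac fac' E by (simp add: field_simps)
    qed
    have "(CLINT \<omega>|M. iexp (b * W \<omega>) * indicat_real A (X \<omega>)) =
        (CLINT \<omega>|M. complex_of_real (cos (b * W \<omega>) * indicat_real A (X \<omega>)) +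
           \<i> * complex_of_real (sin (b * W \<omega>) * indicat_real A (X \<omega>)))"
      unfolding iexp_eq by (simp only: ring_distribs of_real_mult mult.assoc)
    also have "\<dots> = complex_of_real (\<integral>\<omega>. cos (b * W \<omega>) * indicat_real A (X \<omega>) \<partial>M) +
         \<i> * complex_of_real (\<integral>\<omega>. sin (b * W \<omega>) * indicat_real A (X \<omega>) \<partial>M)"
      using gW(2)[OF Tcos] gW(2)[OF Tsin]
      by (subst Bochner_Integration.integral_add) (auto simp del: of_real_mult)
    also have "\<dots> = (complex_of_real (\<integral>\<omega>. cos (b * W \<omega>) \<partial>M) +
         \<i> * complex_of_real (\<integral>\<omega>. sin (b * W \<omega>) \<partial>M)) * P"
      by (simp add: 1 2 ring_distribs)
    also have "complex_of_real (\<integral>\<omega>. cos (b * W \<omega>) \<partial>M) + \<i> * complex_of_real (\<integral>\<omega>. sin (b * W \<omega>) \<partial>M) =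
        (CLINT \<omega>|M. complex_of_real (cos (b * W \<omega>)) + \<i> * complex_of_real (sin (b * W \<omega>)))"
      using gW(1)[OF Tcos] gW(1)[OF Tsin]
      by (subst Bochner_Integration.integral_add) auto
    also have "\<dots> = (CLINT \<omega>|M. iexp (b * W \<omega>))"
      by (simp only: iexp_eq)
    finally show ?thesis .
  qed
  show ?thesis
  proof (cases "P = 0")
    case True
    have "prob {\<omega> \<in> space M. X \<omega> \<in> A \<and> W \<omega> \<in> B} \<le> P"
      unfolding P_def by (rule finite_measure_mono) auto
    with True show ?thesis
      by (auto simp: P_def intro!: antisym)
  next
    case False
    then have "P > 0"
      by (auto simp: P_def zero_less_measure_iff)
    have "(\<integral>\<omega>. indicat_real A (X \<omega>) * indicat_real B (W \<omega>) \<partial>M) = P * prob {\<omega> \<in> space M. W \<omega> \<in> B}"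
    proof (rule integral_density_char_eq[where B = 1])
      show "(CLINT \<omega>|M. indicat_real A (X \<omega>) * iexp (a * W \<omega>)) = P * (CLINT \<omega>|M. iexp (a * W \<omega>))" for a
        using cf[of a] by (simp add: mult.commute)
    qed (use \<open>P > 0\<close> in \<open>auto simp: indicator_def\<close>)
    also have "(\<integral>\<omega>. indicat_real A (X \<omega>) * indicat_real B (W \<omega>) \<partial>M) =
        (\<integral>\<omega>. indicat_real {\<omega> \<in> space M. X \<omega> \<in> A \<and> W \<omega> \<in> B} \<omega> \<partial>M)"
      by (rule Bochner_Integration.integral_cong) (auto simp: indicator_def)
    also have "\<dots> = prob {\<omega> \<in> space M. X \<omega> \<in> A \<and> W \<omega> \<in> B}"
      by simp
    finally show ?thesis
      by (simp add: P_def)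
  qed
qed

section \<open>The normal tail\<close>

definition normal_tail :: "real \<Rightarrow> real" where
  "normal_tail u = measure std_normal_distribution {u<..}"

interpretation std_normal: prob_space std_normal_distribution
  by (rule prob_space_normal_density) simp

lemma normal_tail_nonneg: "normal_tail u \<ge> 0"
  by (simp add: normal_tail_def)

lemma normal_tail_antimono: "u \<le> v \<Longrightarrow> normal_tail v \<le> normal_tail u"
  unfolding normal_tail_def by (rule std_normal.finite_measure_mono) auto

lemma normal_tail_eq_integral:
  "normal_tail u = (\<integral>x. std_normal_density x * indicator {u<..} x \<partial>lborel)"
proof -
  have "normal_tail u = (\<integral>x. indicator {u<..} x \<partial>std_normal_distribution)"
    by (simp add: normal_tail_def)
  also have "\<dots> = (\<integral>x. std_normal_density x *\<^sub>R indicator {u<..} x \<partial>lborel)"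
    by (rule integral_density) auto
  finally show ?thesis by simp
qed

lemma normal_tail_le_exp:
  assumes "0 \<le> u" shows "normal_tail u \<le> exp (- u\<^sup>2 / 2)"
proof -
  have eq: "exp (- u\<^sup>2 / 2) * normal_density u 1 x = exp (u * x - u\<^sup>2) * std_normal_density x" for x
    by (simp add: normal_density_def mult_exp_exp power2_eq_square field_simps)
  have "normal_tail u \<le> (\<integral>x. exp (- u\<^sup>2 / 2) * normal_density u 1 x \<partial>lborel)"
    unfolding normal_tail_eq_integral
  proof (rule integral_mono)
    show "integrable lborel (\<lambda>x. std_normal_density x * indicator {u<..} x)"
      by (rule integrable_mult_indicator[of "{u<..}" lborel std_normal_density, simplified mult.commute real_scaleR_def]) auto
    show "std_normal_density x * indicator {u<..} x \<le> exp (- u\<^sup>2 / 2) * normal_density u 1 x" for x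
    proof (cases "x > u")
      case True
      have "u * u \<le> u * x" using True assms by (intro mult_left_mono) auto
      then have "1 \<le> exp (u * x - u\<^sup>2)" by (simp add: power2_eq_square)
      then show ?thesis unfolding eq using True mult_right_mono[of 1 _ "std_normal_density x"] by simp
    qed simp
  qed simp
  also have "\<dots> = exp (- u\<^sup>2 / 2)" by simp
  finally show ?thesis .
qed

lemma normal_tail_upper:
  assumes u: "u > 0" shows "normal_tail u \<le> exp (- u\<^sup>2 / 2) / u"
proof -
  let ?F = "\<lambda>x::real. - exp (- x\<^sup>2 / 2)" and ?f = "\<lambda>x::real. x * exp (- x\<^sup>2 / 2)"
  have nn: "(\<integral>\<^sup>+x. ennreal (?f x) * indicator {u..} x \<partial>lborel) = ennreal (0 - ?F u)"
  proof (rule nn_integral_FTC_atLeast)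
    show "(?F has_real_derivative ?f x) (at x)" for x
      by (auto intro!: derivative_eq_intros)
    show "(?F \<longlongrightarrow> 0) at_top" by real_asymp
  qed (use u in auto)
  have "(\<integral>\<^sup>+x. ennreal (?f x * indicator {u..} x) \<partial>lborel) =
      (\<integral>\<^sup>+x. ennreal (?f x) * indicator {u..} x \<partial>lborel)"
    by (rule nn_integral_cong) (simp add: indicator_def)
  also note nn
  finally have "(\<integral>\<^sup>+x. ennreal (?f x * indicator {u..} x) \<partial>lborel) = ennreal (exp (- u\<^sup>2 / 2))"
    by simp
  then have hb: "has_bochner_integral lborel (\<lambda>x. ?f x * indicator {u..} x) (exp (- u\<^sup>2 / 2))"
    by (intro has_bochner_integral_nn_integral) (use u in \<open>auto simp: indicator_def\<close>)
  have "normal_tail u \<le> (\<integral>x. (?f x * indicator {u..} x) / u \<partial>lborel)"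
    unfolding normal_tail_eq_integral
  proof (rule integral_mono)
    show "integrable lborel (\<lambda>x. std_normal_density x * indicator {u<..} x)"
      by (rule integrable_mult_indicator[of "{u<..}" lborel std_normal_density, simplified mult.commute real_scaleR_def]) auto
    show "integrable lborel (\<lambda>x. (?f x * indicator {u..} x) / u)"
      using hb by (simp add: has_bochner_integral_iff)
    show "std_normal_density x * indicator {u<..} x \<le> (?f x * indicator {u..} x) / u" for x
    proof (cases "x > u")
      case True
      have "1 / sqrt (2 * pi) \<le> 1"
        using pi_gt3 by (simp add: real_le_rsqrt)
      also have "1 \<le> x / u" using True u by simp
      finally have "1 / sqrt (2 * pi) * exp (- x\<^sup>2 / 2) \<le> x / u * exp (- x\<^sup>2 / 2)"
        by (rule mult_right_mono) auto
      then show ?thesis using True by (simp add: std_normal_density_def)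
    qed (use u in \<open>auto simp: indicator_def\<close>)
  qed
  also have "\<dots> = exp (- u\<^sup>2 / 2) / u"
    using hb by (simp add: has_bochner_integral_iff)
  finally show ?thesis .
qed

text \<open>
  A lower bound for \<open>u * exp (u\<^sup>2 / 2)\<close> times the integral of the normal density over \<open>(u, u + 1 / u)\<close>, \<open>u \<ge> 1\<close>.
\<close>

definition tail_const :: real where "tail_const = exp (- 3 / 2) / sqrt (2 * pi)"

lemma tail_const_pos: "tail_const > 0"
  by (simp add: tail_const_def)

lemma normal_tail_lower:
  assumes u: "u \<ge> 1" shows "normal_tail u \<ge> tail_const * exp (- u\<^sup>2 / 2) / u"
proof -
  have "tail_const * exp (- u\<^sup>2 / 2) / u =
      (\<integral>x. (tail_const * exp (- u\<^sup>2 / 2)) * indicator {u<..<u + 1/u} x \<partial>lborel)"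
    using u by simp
  also have "\<dots> \<le> normal_tail u"
    unfolding normal_tail_eq_integral
  proof (rule integral_mono)
    show "integrable lborel (\<lambda>x. std_normal_density x * indicator {u<..} x)"
      by (rule integrable_mult_indicator[of "{u<..}" lborel std_normal_density, simplified mult.commute real_scaleR_def]) auto
    show "(tail_const * exp (- u\<^sup>2 / 2)) * indicator {u<..<u + 1/u} x \<le> std_normal_density x * indicator {u<..} x" for x
    proof (cases "x \<in> {u<..<u + 1/u}")
      case True
      have "x\<^sup>2 \<le> (u + 1/u)\<^sup>2"
        using True u by (intro power_mono) auto
      also have "\<dots> = u\<^sup>2 + 2 + (1/u)\<^sup>2"
        using u by (simp add: power2_eq_square field_simps)
      also have "(1/u)\<^sup>2 \<le> 1"
        using u by (simp add: power_le_one)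
      finally have "exp (- 3 / 2 - u\<^sup>2 / 2) \<le> exp (- x\<^sup>2 / 2)"
        by simp
      then have "exp (- 3 / 2) * exp (- u\<^sup>2 / 2) \<le> exp (- x\<^sup>2 / 2)"
        by (simp add: mult_exp_exp)
      then show ?thesis
        using True by (simp add: tail_const_def std_normal_density_def divide_right_mono)
    qed (use u in \<open>auto simp: indicator_def\<close>)
  qed (use u in \<open>auto intro!: integrable_real_indicator\<close>)
  finally show ?thesis .
qed

text \<open>
  Lowering the level by \<open>h\<close> changes the tail by a factor close to 1 as soon as \<open>v * h\<close> is small.
\<close>

lemma normal_tail_shift:
  assumes v: "v \<ge> 1" and h: "0 \<le> h" "h \<le> v"
  shows "normal_tail (v - h) \<le> normal_tail v * (1 + v * h * exp (v * h) / tail_const)"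
proof -
  have "normal_tail (v - h) - normal_tail v =
      measure std_normal_distribution ({v - h<..} - {v<..})"
    unfolding normal_tail_def by (subst std_normal.finite_measure_Diff) (use h in auto)
  also have "{v - h<..} - {v<..} = {v - h<..v}" by auto
  also have "measure std_normal_distribution {v - h<..v} = (\<integral>x. std_normal_density x *\<^sub>R indicator {v-h<..v} x \<partial>lborel)"
    by (subst integral_density[symmetric]) auto
  also have "\<dots> \<le> (\<integral>x. (exp (- v\<^sup>2 / 2) * exp (v * h)) * indicator {v-h<..v} x \<partial>lborel)"
  proof (rule integral_mono)
    show "integrable lborel (\<lambda>x. std_normal_density x *\<^sub>R indicat_real {v-h<..v} x)"
      using integrable_mult_indicator[of "{v-h<..v}" lborel std_normal_density] by (simp add: mult.commute)
    show "integrable lborel (\<lambda>x. (exp (- v\<^sup>2 / 2) * exp (v * h)) * indicat_real {v-h<..v} x)"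
      by (intro integrable_mult_right integrable_real_indicator) (use h in simp_all)
    show "std_normal_density x *\<^sub>R indicat_real {v-h<..v} x \<le> (exp (- v\<^sup>2 / 2) * exp (v * h)) * indicator {v-h<..v} x" for x
    proof (cases "x \<in> {v-h<..v}")
      case True
      have "(v - h)\<^sup>2 \<le> x\<^sup>2"
        using True h by (intro power_mono) auto
      then have "v\<^sup>2 - 2 * (v * h) \<le> x\<^sup>2"
        using zero_le_power2[of h] unfolding power2_diff by (simp only: mult.assoc)
      then have "exp (- x\<^sup>2 / 2) \<le> exp (- v\<^sup>2 / 2) * exp (v * h)"
        unfolding mult_exp_exp by simp
      moreover have "1 / sqrt (2 * pi) \<le> 1"
        using pi_gt3 by (simp add: real_le_rsqrt)
      ultimately have "1 / sqrt (2 * pi) * exp (- x\<^sup>2 / 2) \<le> 1 * (exp (- v\<^sup>2 / 2) * exp (v * h))"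
        by (intro mult_mono) auto
      then show ?thesis using True by (simp add: std_normal_density_def)
    qed (auto simp: indicator_def)
  qed
  also have "\<dots> = exp (- v\<^sup>2 / 2) * exp (v * h) * h"
    using h by simp
  also have "\<dots> \<le> (normal_tail v * v / tail_const) * exp (v * h) * h"
    using normal_tail_lower[OF v] v h tail_const_pos
    by (intro mult_right_mono) (auto simp: field_simps)
  finally show ?thesis
    by (simp add: algebra_simps)
qed

section \<open>Pairs of standard normal variables\<close>

text \<open>
  The law with standard normal marginals and correlation \<open>\<rho>\<close>, given by its characteristic function so that the
  degenerate cases \<open>\<rho> = 1\<close> and \<open>\<rho> = -1\<close>, in which the pair has no density, are included.
\<close>

definition gauss_pair :: "'a measure \<Rightarrow> ('a \<Rightarrow> real) \<Rightarrow> ('a \<Rightarrow> real) \<Rightarrow> real \<Rightarrow> bool" where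
  "gauss_pair M X Y \<rho> \<longleftrightarrow> X \<in> borel_measurable M \<and> Y \<in> borel_measurable M \<and>
     (\<forall>a b. (CLINT \<omega>|M. iexp (a * X \<omega> + b * Y \<omega>)) = exp (- (a\<^sup>2 + 2 * a * b * \<rho> + b\<^sup>2) / 2))"

lemma gauss_pairD:
  assumes "gauss_pair M X Y \<rho>"
  shows "X \<in> borel_measurable M" "Y \<in> borel_measurable M"
    "(CLINT \<omega>|M. iexp (a * X \<omega> + b * Y \<omega>)) = exp (- (a\<^sup>2 + 2 * a * b * \<rho> + b\<^sup>2) / 2)"
  using assms by (auto simp: gauss_pair_def)

lemma gauss_pair_commute:
  assumes g: "gauss_pair M X Y \<rho>" shows "gauss_pair M Y X \<rho>"
  unfolding gauss_pair_def
proof (intro conjI allI)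
  fix a b
  show "(CLINT \<omega>|M. iexp (a * Y \<omega> + b * X \<omega>)) = exp (- (a\<^sup>2 + 2 * a * b * \<rho> + b\<^sup>2) / 2)"
    unfolding add.commute[of "a * _"] gauss_pairD(3)[OF g] by (simp add: algebra_simps)
qed (use gauss_pairD[OF g] in auto)

lemma gauss_pair_uminus:
  assumes g: "gauss_pair M X Y \<rho>" shows "gauss_pair M X (\<lambda>\<omega>. - Y \<omega>) (- \<rho>)"
  unfolding gauss_pair_def
proof (intro conjI allI)
  fix a b
  show "(CLINT \<omega>|M. iexp (a * X \<omega> + b * - Y \<omega>)) = exp (- (a\<^sup>2 + 2 * a * b * - \<rho> + b\<^sup>2) / 2)"
    using gauss_pairD(3)[OF g, of a "- b"] by simp
qed (use gauss_pairD[OF g] in auto)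

context prob_space
begin

lemma gauss_pair_abs_corr_le_1:
  assumes g: "gauss_pair M X Y \<rho>" shows "\<bar>\<rho>\<bar> \<le> 1"
proof -
  have [measurable]: "X \<in> borel_measurable M" "Y \<in> borel_measurable M"
    using gauss_pairD[OF g] by auto
  have *: "exp (- (1 + 2 * b * \<rho> + b\<^sup>2) / 2) \<le> 1" for b :: real
  proof -
    have "norm (CLINT \<omega>|M. iexp (1 * X \<omega> + b * Y \<omega>)) \<le> (\<integral>\<omega>. norm (iexp (1 * X \<omega> + b * Y \<omega>)) \<partial>M)"
      by (rule integral_norm_bound)
    also have "\<dots> = 1"
      by (simp add: prob_space del: of_real_add)
    finally show ?thesis
      unfolding gauss_pairD(3)[OF g] by simp
  qed
  show ?thesis
    using *[of 1] *[of "-1"] by (simp add: abs_le_iff)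
qed

lemma prob_greater_if_char_normal:
  fixes W :: "'a \<Rightarrow> real"
  assumes [measurable]: "random_variable borel W" and s: "\<sigma> > 0"
    and cf: "\<And>b. (CLINT \<omega>|M. iexp (b * W \<omega>)) = exp (- (\<sigma>\<^sup>2 * b\<^sup>2) / 2)"
  shows "prob {\<omega> \<in> space M. W \<omega> > y} = normal_tail (y / \<sigma>)"
proof -
  have "distr M borel (\<lambda>\<omega>. W \<omega> / \<sigma>) = std_normal_distribution"
  proof (rule Levy_uniqueness)
    show "real_distribution std_normal_distribution" by (rule real_dist_normal_dist)
    have "char (distr M borel (\<lambda>\<omega>. W \<omega> / \<sigma>)) t = exp (- t\<^sup>2 / 2)" for t
      unfolding char_def using cf[of "t / \<sigma>"] s
      by (subst integral_distr) (auto simp: field_simps)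
    then show "char (distr M borel (\<lambda>\<omega>. W \<omega> / \<sigma>)) = char std_normal_distribution"
      by (simp add: char_std_normal_distribution fun_eq_iff)
  qed simp
  then have "normal_tail (y / \<sigma>) = measure (distr M borel (\<lambda>\<omega>. W \<omega> / \<sigma>)) {y / \<sigma><..}"
    by (simp add: normal_tail_def)
  also have "\<dots> = prob {\<omega> \<in> space M. W \<omega> > y}"
    by (subst measure_distr) (use s in \<open>auto simp: divide_less_cancel intro!: arg_cong[where f = prob]\<close>)
  finally show ?thesis by simp
qed

lemma prob_greater_if_char_1:
  fixes W :: "'a \<Rightarrow> real"
  assumes [measurable]: "random_variable borel W" and y: "y \<ge> 0"
    and cf: "\<And>b. (CLINT \<omega>|M. iexp (b * W \<omega>)) = 1"
  shows "prob {\<omega> \<in> space M. W \<omega> > y} = 0"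
proof -
  interpret R: prob_space "return borel (0::real)" by (rule prob_space_return) simp
  have "distr M borel W = return borel 0"
  proof (rule Levy_uniqueness)
    show "real_distribution (return borel 0)" 
      by (simp add: real_distribution_def real_distribution_axioms_def R.prob_space_axioms)
    show "char (distr M borel W) = char (return borel 0)"
      unfolding char_def using cf by (auto simp: fun_eq_iff integral_distr integral_return)
  qed simp
  then have "measure (distr M borel W) {y<..} = 0"
    using y by (simp add: measure_return)
  also have "measure (distr M borel W) {y<..} = prob {\<omega> \<in> space M. W \<omega> > y}"
    by (subst measure_distr) (auto intro!: arg_cong[where f = prob])
  finally show ?thesis .
qed

context
  fixes X Y :: "'a \<Rightarrow> real" and \<rho> :: real
  assumes g: "gauss_pair M X Y \<rho>"
begin

lemma gauss_pair_measurable [measurable]: "X \<in> borel_measurable M" "Y \<in> borel_measurable M"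
  using gauss_pairD[OF g] by auto

lemma gauss_pair_tail: "prob {\<omega> \<in> space M. X \<omega> > u} = normal_tail u"
  using prob_greater_if_char_normal[of X 1 u] gauss_pairD(3)[OF g, of _ 0] by simp

lemma gauss_pair_sq_le_1: "\<rho>\<^sup>2 \<le> 1"
  using gauss_pair_abs_corr_le_1[OF g] by (simp add: abs_square_le_1)

lemma gauss_pair_residual_char:
  "(CLINT \<omega>|M. iexp (b * (Y \<omega> - \<rho> * X \<omega>))) = exp (- ((1 - \<rho>\<^sup>2) * b\<^sup>2) / 2)"
proof -
  have "(CLINT \<omega>|M. iexp (b * (Y \<omega> - \<rho> * X \<omega>))) = (CLINT \<omega>|M. iexp ((- b * \<rho>) * X \<omega> + b * Y \<omega>))"
    by (intro Bochner_Integration.integral_cong arg_cong[of _ _ iexp]) (auto simp: algebra_simps)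
  then show ?thesis
    unfolding gauss_pairD(3)[OF g] by (simp add: power2_eq_square algebra_simps)
qed

lemma gauss_pair_residual_indep:
  assumes "A \<in> sets borel" "B \<in> sets borel"
  shows "prob {\<omega> \<in> space M. X \<omega> \<in> A \<and> Y \<omega> - \<rho> * X \<omega> \<in> B} =
    prob {\<omega> \<in> space M. X \<omega> \<in> A} * prob {\<omega> \<in> space M. Y \<omega> - \<rho> * X \<omega> \<in> B}"
proof (rule prob_Int_if_char_factorises)
  fix a b
  have "(CLINT \<omega>|M. iexp (a * X \<omega> + b * (Y \<omega> - \<rho> * X \<omega>))) =
      (CLINT \<omega>|M. iexp ((a - b * \<rho>) * X \<omega> + b * Y \<omega>))"
    by (intro Bochner_Integration.integral_cong arg_cong[of _ _ iexp]) (auto simp: algebra_simps)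
  also have "\<dots> = complex_of_real (exp (- (a\<^sup>2) / 2)) * exp (- ((1 - \<rho>\<^sup>2) * b\<^sup>2) / 2)"
    unfolding gauss_pairD(3)[OF g] of_real_mult[symmetric] mult_exp_exp by (simp add: power2_eq_square algebra_simps add_divide_distrib diff_divide_distrib)
  also have "complex_of_real (exp (- (a\<^sup>2) / 2)) = (CLINT \<omega>|M. iexp (a * X \<omega>))"
    using gauss_pairD(3)[OF g, of a 0] by simp
  finally show "(CLINT \<omega>|M. iexp (a * X \<omega> + b * (Y \<omega> - \<rho> * X \<omega>))) =
      (CLINT \<omega>|M. iexp (a * X \<omega>)) * (CLINT \<omega>|M. iexp (b * (Y \<omega> - \<rho> * X \<omega>)))"
    unfolding gauss_pair_residual_char by simp
qed (use assms in auto)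

lemma gauss_pair_residual_tail:
  assumes "y \<ge> 0"
  shows "prob {\<omega> \<in> space M. Y \<omega> - \<rho> * X \<omega> > y} =
    (if \<rho>\<^sup>2 = 1 then 0 else normal_tail (y / sqrt (1 - \<rho>\<^sup>2)))"
proof (cases "\<rho>\<^sup>2 = 1")
  case True
  then show ?thesis
    using prob_greater_if_char_1[of "\<lambda>\<omega>. Y \<omega> - \<rho> * X \<omega>" y] gauss_pair_residual_char assms by simp
next
  case False
  with gauss_pair_sq_le_1 have "1 - \<rho>\<^sup>2 > 0" by simp
  then show ?thesis
    using prob_greater_if_char_normal[of "\<lambda>\<omega>. Y \<omega> - \<rho> * X \<omega>" "sqrt (1 - \<rho>\<^sup>2)" y] 
      gauss_pair_residual_char by simp
qed

lemma gauss_pair_residual_tail_le: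
  assumes y: "y \<ge> 0"
  shows "prob {\<omega> \<in> space M. Y \<omega> - \<rho> * X \<omega> > y} \<le> normal_tail y"
proof (cases "\<rho>\<^sup>2 = 1")
  case False
  with gauss_pair_sq_le_1 have "0 < sqrt (1 - \<rho>\<^sup>2)" "sqrt (1 - \<rho>\<^sup>2) \<le> 1" by simp_all
  then have "y \<le> y / sqrt (1 - \<rho>\<^sup>2)"
    using y by (simp add: field_simps mult_left_le)
  then show ?thesis
    using gauss_pair_residual_tail[OF y] False by (simp add: normal_tail_antimono)
qed (simp add: gauss_pair_residual_tail[OF y] normal_tail_nonneg)

text \<open>
  The variance enters only through an upper bound \<open>v\<close>, because later the correlation is only estimated.
\<close>

lemma gauss_pair_residual_tail_exp:
  assumes y: "y \<ge> 0" and v: "v > 0" "1 - \<rho>\<^sup>2 \<le> v"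
  shows "prob {\<omega> \<in> space M. Y \<omega> - \<rho> * X \<omega> > y} \<le> exp (- y\<^sup>2 / (2 * v))"
proof (cases "\<rho>\<^sup>2 = 1")
  case False
  with gauss_pair_sq_le_1 have p: "0 < 1 - \<rho>\<^sup>2" by simp
  have "normal_tail (y / sqrt (1 - \<rho>\<^sup>2)) \<le> exp (- (y / sqrt (1 - \<rho>\<^sup>2))\<^sup>2 / 2)"
    by (rule normal_tail_le_exp) (use p y in simp)
  also have "(y / sqrt (1 - \<rho>\<^sup>2))\<^sup>2 = y\<^sup>2 / (1 - \<rho>\<^sup>2)"
    using p by (simp add: power_divide)
  also have "exp (- (y\<^sup>2 / (1 - \<rho>\<^sup>2)) / 2) \<le> exp (- (y\<^sup>2 / v) / 2)"
    using p v by (simp add: frac_le)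
  finally show ?thesis
    using gauss_pair_residual_tail[OF y] False by (simp add: mult.commute)
qed (simp add: gauss_pair_residual_tail[OF y])

lemma gauss_pair_greater_residual:
  assumes "y \<ge> 0" "v > 0" "1 - \<rho>\<^sup>2 \<le> v"
    and E: "E \<subseteq> {\<omega> \<in> space M. X \<omega> > u \<and> Y \<omega> - \<rho> * X \<omega> > y}"
  shows "prob E \<le> normal_tail u * exp (- y\<^sup>2 / (2 * v))"
proof -
  have "prob E \<le> prob {\<omega> \<in> space M. X \<omega> \<in> {u<..} \<and> Y \<omega> - \<rho> * X \<omega> \<in> {y<..}}"
    using E by (intro finite_measure_mono) auto
  also have "\<dots> = prob {\<omega> \<in> space M. X \<omega> \<in> {u<..}} * prob {\<omega> \<in> space M. Y \<omega> - \<rho> * X \<omega> \<in> {y<..}}"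
    by (rule gauss_pair_residual_indep) auto
  also have "\<dots> \<le> normal_tail u * exp (- y\<^sup>2 / (2 * v))"
    using gauss_pair_tail[of u] gauss_pair_residual_tail_exp[OF assms(1-3)] normal_tail_nonneg[of u]
    by (simp add: mult_left_mono)
  finally show ?thesis .
qed

end

text \<open>
  The elementary step of the chaining: \<open>Y\<close> stays below \<open>\<rho> * X\<close> by a fixed amount, and this deficit is
  independent of \<open>X\<close>. So the full tail of \<open>X\<close> survives as a factor, including its \<open>1 / u\<close>.
\<close>

lemma gauss_pair_step:
  assumes g: "gauss_pair M X Y \<rho>"
    and v: "v > 0" "1 - \<rho>\<^sup>2 \<le> v" and u: "u0 \<le> \<rho> * u1" "\<rho> > 0"
  shows "prob {\<omega> \<in> space M. X \<omega> > u1 \<and> Y \<omega> \<le> u0} \<le> normal_tail u1 * exp (- (\<rho> * u1 - u0)\<^sup>2 / (2 * v))"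
proof (rule gauss_pair_greater_residual[OF gauss_pair_uminus[OF g] _ v(1)])
  show "{\<omega> \<in> space M. X \<omega> > u1 \<and> Y \<omega> \<le> u0} \<subseteq>
      {\<omega> \<in> space M. u1 < X \<omega> \<and> \<rho> * u1 - u0 < - Y \<omega> - - \<rho> * X \<omega>}"
    using u(2) by (auto simp: algebra_simps intro!: add_le_less_mono)
qed (use v u in auto)

lemma gauss_pair_joint_half:
  assumes g: "gauss_pair M X Y \<rho>" and u: "u \<ge> 0" and r: "\<rho> < 1"
  shows "prob {\<omega> \<in> space M. X \<omega> > u \<and> Y \<omega> \<ge> X \<omega>} \<le> normal_tail u * exp (- (u\<^sup>2 * (1 - \<rho>)) / 4)"
proof -
  have "prob {\<omega> \<in> space M. X \<omega> > u \<and> Y \<omega> \<ge> X \<omega>} \<le>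
      normal_tail u * exp (- ((1 - \<rho>) * u)\<^sup>2 / (2 * (2 * (1 - \<rho>))))"
  proof (rule gauss_pair_greater_residual[OF g])
    have "(1 - \<rho>)\<^sup>2 \<ge> 0" by simp
    then show "1 - \<rho>\<^sup>2 \<le> 2 * (1 - \<rho>)" by (simp add: power2_eq_square algebra_simps)
    show "{\<omega> \<in> space M. u < X \<omega> \<and> X \<omega> \<le> Y \<omega>} \<subseteq>
        {\<omega> \<in> space M. u < X \<omega> \<and> (1 - \<rho>) * u < Y \<omega> - \<rho> * X \<omega>}"
    proof safe
      fix \<omega> assume "u < X \<omega>" "X \<omega> \<le> Y \<omega>"
      then have "(1 - \<rho>) * u < (1 - \<rho>) * X \<omega>" using r by simp
      with \<open>X \<omega> \<le> Y \<omega>\<close> show "(1 - \<rho>) * u < Y \<omega> - \<rho> * X \<omega>" by (simp add: algebra_simps)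
    qed
  qed (use u r in auto)
  also have "((1 - \<rho>) * u)\<^sup>2 / (2 * (2 * (1 - \<rho>))) = (u\<^sup>2 * (1 - \<rho>)) / 4"
    using r by (simp add: power2_eq_square field_simps)
  then have "- ((1 - \<rho>) * u)\<^sup>2 / (2 * (2 * (1 - \<rho>))) = - (u\<^sup>2 * (1 - \<rho>)) / 4"
    by simp
  finally show ?thesis .
qed

text \<open>
  By symmetry one may assume \<open>Y \<ge> X\<close>; then the residual \<open>Y - \<rho> * X\<close> is at least \<open>(1 - \<rho>) * u\<close>.
  The factor next to the single tail is small whenever \<open>u\<^sup>2 * (1 - \<rho>)\<close> is large, which covers neighbouring points
  (\<open>1 - \<rho>\<close> of order \<open>u\<close> to the power \<open>-2\<close> and more) as well as points with \<open>\<rho>\<close> bounded away from 1.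
\<close>

lemma gauss_pair_joint:
  assumes g: "gauss_pair M X Y \<rho>" and u: "u \<ge> 0"
  shows "prob {\<omega> \<in> space M. X \<omega> > u \<and> Y \<omega> > u} \<le> 2 * normal_tail u * exp (- (u\<^sup>2 * (1 - \<rho>)) / 4)"
proof (cases "\<rho> < 1")
  case True
  note [measurable] = gauss_pairD(1,2)[OF g]
  have "prob {\<omega> \<in> space M. X \<omega> > u \<and> Y \<omega> > u} \<le>
      prob ({\<omega> \<in> space M. X \<omega> > u \<and> Y \<omega> \<ge> X \<omega>} \<union> {\<omega> \<in> space M. Y \<omega> > u \<and> X \<omega> \<ge> Y \<omega>})"
    by (rule finite_measure_mono) auto
  also have "\<dots> \<le> prob {\<omega> \<in> space M. X \<omega> > u \<and> Y \<omega> \<ge> X \<omega>} + prob {\<omega> \<in> space M. Y \<omega> > u \<and> X \<omega> \<ge> Y \<omega>}"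
    by (rule measure_Un_le) auto
  finally show ?thesis
    using gauss_pair_joint_half[OF g u True] gauss_pair_joint_half[OF gauss_pair_commute[OF g] u True]
    by linarith
next
  case False
  note [measurable] = gauss_pairD(1,2)[OF g]
  have "\<rho> = 1" using False gauss_pair_abs_corr_le_1[OF g] by simp
  have "prob {\<omega> \<in> space M. X \<omega> > u \<and> Y \<omega> > u} \<le> prob {\<omega> \<in> space M. X \<omega> > u}"
    by (rule finite_measure_mono) auto
  then show ?thesis
    using gauss_pair_tail[OF g, of u] normal_tail_nonneg[of u] \<open>\<rho> = 1\<close> by simp
qed

text \<open>
  The event \<open>X > 2 * v\<close> is negligible against the product of the two tails. On its complement \<open>\<rho> * X\<close> is at most
  \<open>2 * \<bar>\<rho>\<bar> * v\<close>, so that the level for the independent residual is lowered only by this amount.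
\<close>

lemma gauss_pair_far:
  assumes g: "gauss_pair M X Y \<rho>" and u: "u \<ge> 0" and v: "v \<ge> 0" "\<bar>\<rho>\<bar> \<le> 1 / 2"
  shows "prob {\<omega> \<in> space M. X \<omega> > u \<and> Y \<omega> > v} \<le>
    normal_tail u * normal_tail (v - 2 * \<bar>\<rho>\<bar> * v) + normal_tail (2 * v)"
proof -
  note [measurable] = gauss_pairD(1,2)[OF g]
  let ?y = "v - 2 * \<bar>\<rho>\<bar> * v"
  have y: "?y \<ge> 0"
    using v mult_right_mono[of "2 * \<bar>\<rho>\<bar>" 1 v] by simp
  have "prob {\<omega> \<in> space M. X \<omega> > u \<and> Y \<omega> > v} \<le>
      prob ({\<omega> \<in> space M. X \<omega> \<in> {u<..} \<and> Y \<omega> - \<rho> * X \<omega> \<in> {?y<..}} \<union> {\<omega> \<in> space M. X \<omega> > 2 * v})"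
  proof (intro finite_measure_mono subsetI)
    fix \<omega> assume \<omega>: "\<omega> \<in> {\<omega> \<in> space M. X \<omega> > u \<and> Y \<omega> > v}"
    have "\<rho> * X \<omega> \<le> 2 * \<bar>\<rho>\<bar> * v" if "X \<omega> \<le> 2 * v"
    proof -
      have "\<rho> * X \<omega> \<le> \<bar>\<rho>\<bar> * X \<omega>" using \<omega> u by (intro mult_right_mono) auto
      also have "\<dots> \<le> \<bar>\<rho>\<bar> * (2 * v)" using that by (intro mult_left_mono) auto
      finally show ?thesis by simp
    qed
    then show "\<omega> \<in> {\<omega> \<in> space M. X \<omega> \<in> {u<..} \<and> Y \<omega> - \<rho> * X \<omega> \<in> {?y<..}} \<union> {\<omega> \<in> space M. X \<omega> > 2 * v}"
      using \<omega> by (cases "X \<omega> \<le> 2 * v") auto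
  qed auto
  also have "\<dots> \<le> prob {\<omega> \<in> space M. X \<omega> \<in> {u<..} \<and> Y \<omega> - \<rho> * X \<omega> \<in> {?y<..}} + prob {\<omega> \<in> space M. X \<omega> > 2 * v}"
    by (rule measure_Un_le) auto
  also have "prob {\<omega> \<in> space M. X \<omega> \<in> {u<..} \<and> Y \<omega> - \<rho> * X \<omega> \<in> {?y<..}} =
      normal_tail u * prob {\<omega> \<in> space M. Y \<omega> - \<rho> * X \<omega> > ?y}"
    using gauss_pair_residual_indep[OF g, of "{u<..}" "{?y<..}"] gauss_pair_tail[OF g, of u] by simp
  also have "\<dots> \<le> normal_tail u * normal_tail ?y"
    using gauss_pair_residual_tail_le[OF g y] by (intro mult_left_mono normal_tail_nonneg)
  finally show ?thesis
    by (simp add: gauss_pair_tail[OF g])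
qed

end

text \<open>
  Correlation small compared with \<open>1 / v\<^sup>2\<close> is asymptotically invisible at level \<open>v\<close>.
\<close>

lemma (in prob_space) gauss_pair_asymp_indep:
  assumes "\<eta> > 0"
  obtains \<epsilon> V where "\<epsilon> > 0" "V \<ge> 1"
    "\<And>X Y \<rho> u v. gauss_pair M X Y \<rho> \<Longrightarrow> 1 \<le> u \<Longrightarrow> u \<le> v \<Longrightarrow> V \<le> v \<Longrightarrow> \<bar>\<rho>\<bar> * v\<^sup>2 \<le> \<epsilon> \<Longrightarrow>
      prob {\<omega> \<in> space M. X \<omega> > u \<and> Y \<omega> > v} \<le> (1 + \<eta>) * (normal_tail u * normal_tail v)"
proof -
  have "((\<lambda>h. 2 * h * exp (2 * h) / tail_const) \<longlongrightarrow> 2 * 0 * exp (2 * 0) / tail_const) (at_right 0)"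
    using tail_const_pos by (intro tendsto_intros) auto
  then have "\<forall>\<^sub>F h in at_right 0. 2 * h * exp (2 * h) / tail_const < \<eta> / 2"
    using assms by (intro order_tendstoD(2)) auto
  then obtain b where b: "b > 0" "\<And>h. 0 < h \<Longrightarrow> h < b \<Longrightarrow> 2 * h * exp (2 * h) / tail_const < \<eta> / 2"
    unfolding eventually_at_right_field by blast
  have "((\<lambda>v::real. v\<^sup>2 * exp (- v\<^sup>2) / tail_const\<^sup>2) \<longlongrightarrow> 0) at_top"
    using tail_const_pos by real_asymp
  then have "\<forall>\<^sub>F v in at_top. v\<^sup>2 * exp (- v\<^sup>2) / tail_const\<^sup>2 < \<eta> / 2"
    using assms by (intro order_tendstoD(2)) auto
  then obtain V where V: "\<And>v. v \<ge> V \<Longrightarrow> v\<^sup>2 * exp (- v\<^sup>2) / tail_const\<^sup>2 < \<eta> / 2"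
    unfolding eventually_at_top_linorder by blast
  define \<epsilon> where "\<epsilon> = min (b / 2) (1 / 2)"
  show thesis
  proof (rule that[of \<epsilon> "max V 1"])
    fix X Y :: "'a \<Rightarrow> real" and \<rho> u v :: real
    assume g: "gauss_pair M X Y \<rho>" and u: "1 \<le> u" and uv: "u \<le> v" and v: "max V 1 \<le> v"
      and \<rho>: "\<bar>\<rho>\<bar> * v\<^sup>2 \<le> \<epsilon>"
    have v1: "v \<ge> 1" using v by simp
    then have "\<bar>\<rho>\<bar> * 1 \<le> \<bar>\<rho>\<bar> * v\<^sup>2" by (intro mult_left_mono) auto
    with \<rho> have \<rho>2: "\<bar>\<rho>\<bar> \<le> 1 / 2" by (simp add: \<epsilon>_def)
    define h where "h = 2 * \<bar>\<rho>\<bar> * v"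
    have h: "0 \<le> h" "h \<le> v"
      using v1 \<rho>2 mult_right_mono[of "2 * \<bar>\<rho>\<bar>" 1 v] by (auto simp: h_def)
    have vh: "v * h = 2 * (\<bar>\<rho>\<bar> * v\<^sup>2)" by (simp add: h_def power2_eq_square)
    have small: "v * h * exp (v * h) / tail_const \<le> \<eta> / 2"
    proof (cases "\<bar>\<rho>\<bar> * v\<^sup>2 = 0")
      case True
      then have vh0: "v * h = 0" using vh by simp
      show ?thesis unfolding vh0 using assms by simp
    next
      case False
      then have "0 < \<bar>\<rho>\<bar> * v\<^sup>2" using v1 by auto
      moreover have "\<bar>\<rho>\<bar> * v\<^sup>2 < b" using \<rho> b(1) by (auto simp: \<epsilon>_def)
      ultimately show ?thesis unfolding vh using b(2)[of "\<bar>\<rho>\<bar> * v\<^sup>2"] by simp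
    qed
    have "normal_tail (2 * v) \<le> exp (- (2 * v)\<^sup>2 / 2)"
      by (rule normal_tail_le_exp) (use v1 in simp)
    also have "\<dots> = (v\<^sup>2 * exp (- v\<^sup>2) / tail_const\<^sup>2) * (tail_const * exp (- v\<^sup>2 / 2) / v)\<^sup>2"
    proof -
      have "exp (- (2 * v)\<^sup>2 / 2) = exp (- v\<^sup>2) * (exp (- v\<^sup>2 / 2))\<^sup>2"
        by (simp add: exp_double[symmetric] mult_exp_exp power2_eq_square)
      then show ?thesis
        using v1 tail_const_pos by (simp add: power_mult_distrib power_divide)
    qed
    also have "\<dots> \<le> \<eta> / 2 * (normal_tail v)\<^sup>2"
      using V[of v] v normal_tail_lower[OF v1] v1 assms tail_const_pos
      by (intro mult_mono power_mono) auto
    also have "\<dots> \<le> \<eta> / 2 * (normal_tail u * normal_tail v)"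
      using assms normal_tail_antimono[OF uv] unfolding power2_eq_square
      by (intro mult_left_mono mult_right_mono normal_tail_nonneg) auto
    finally have A: "normal_tail (2 * v) \<le> \<eta> / 2 * (normal_tail u * normal_tail v)" .
    have "normal_tail (v - h) \<le> normal_tail v * (1 + v * h * exp (v * h) / tail_const)"
      by (rule normal_tail_shift[OF v1 h])
    also have "\<dots> \<le> normal_tail v * (1 + \<eta> / 2)"
      using small by (intro mult_left_mono normal_tail_nonneg) auto
    finally have B: "normal_tail u * normal_tail (v - h) \<le> normal_tail u * (normal_tail v * (1 + \<eta> / 2))"
      by (intro mult_left_mono normal_tail_nonneg)
    have "prob {\<omega> \<in> space M. X \<omega> > u \<and> Y \<omega> > v} \<le>
        normal_tail u * normal_tail (v - h) + normal_tail (2 * v)"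
      using gauss_pair_far[OF g, of u v] u v1 \<rho>2 by (simp add: h_def)
    also have "\<dots> \<le> normal_tail u * (normal_tail v * (1 + \<eta> / 2)) + \<eta> / 2 * (normal_tail u * normal_tail v)"
      using A B by (rule add_mono[rotated])
    also have "\<dots> = (1 + \<eta>) * (normal_tail u * normal_tail v)"
      by (simp add: algebra_simps)
    finally show "prob {\<omega> \<in> space M. X \<omega> > u \<and> Y \<omega> > v} \<le> (1 + \<eta>) * (normal_tail u * normal_tail v)" .
  qed (use b in \<open>auto simp: \<epsilon>_def\<close>)
qed

section \<open>Order statistics, and the passage from processes to pairs\<close>

lemma sorted_nth_greater_iff:
  fixes ys :: "real list"
  assumes s: "sorted ys" and k: "k < length ys"
  shows "ys ! k > u \<longleftrightarrow> length ys - k \<le> length (filter (\<lambda>x. x > u) ys)"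
proof
  assume "ys ! k > u"
  have "x > u" if "x \<in> set (drop k ys)" for x
  proof -
    obtain i where i: "i < length ys - k" "x = ys ! (k + i)"
      using \<open>x \<in> set (drop k ys)\<close> by (auto simp: in_set_conv_nth)
    have "ys ! k \<le> ys ! (k + i)"
      by (rule sorted_nth_mono) (use s i in auto)
    with \<open>ys ! k > u\<close> i show ?thesis by simp
  qed
  then have "filter (\<lambda>x. x > u) (drop k ys) = drop k ys"
    by (simp add: filter_id_conv)
  moreover have "length (filter (\<lambda>x. x > u) ys) =
      length (filter (\<lambda>x. x > u) (take k ys)) + length (filter (\<lambda>x. x > u) (drop k ys))"
    by (subst append_take_drop_id[of k ys, symmetric], subst filter_append) simp
  ultimately show "length ys - k \<le> length (filter (\<lambda>x. x > u) ys)"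
    by simp
next
  assume len: "length ys - k \<le> length (filter (\<lambda>x. x > u) ys)"
  show "ys ! k > u"
  proof (rule ccontr)
    assume "\<not> ys ! k > u"
    have "\<not> x > u" if "x \<in> set (take (Suc k) ys)" for x
      proof -
      obtain i where "i < length (take (Suc k) ys)" "take (Suc k) ys ! i = x"
        using \<open>x \<in> set (take (Suc k) ys)\<close> unfolding in_set_conv_nth by blast
      then have i: "i < Suc k" "x = ys ! i"
        by auto
      have "ys ! i \<le> ys ! k"
        by (rule sorted_nth_mono) (use s k i in auto)
      with \<open>\<not> ys ! k > u\<close> i show ?thesis by simp
    qed
    then have "filter (\<lambda>x. x > u) (take (Suc k) ys) = []"
      by (simp add: filter_empty_conv)
    moreover have "length (filter (\<lambda>x. x > u) ys) =
        length (filter (\<lambda>x. x > u) (take (Suc k) ys)) + length (filter (\<lambda>x. x > u) (drop (Suc k) ys))"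
      by (subst append_take_drop_id[of "Suc k" ys, symmetric], subst filter_append) simp
    moreover have "length (filter (\<lambda>x. x > u) (drop (Suc k) ys)) \<le> length ys - Suc k"
      using length_filter_le[of "\<lambda>x. x > u" "drop (Suc k) ys"] by simp
    ultimately show False using len k by simp
  qed
qed

lemma order_stat_greater_iff:
  assumes "1 \<le> r" "r \<le> n"
  shows "order_stat_process r n Xs t \<omega> > u \<longleftrightarrow>
    (\<exists>J. J \<subseteq> {1..n} \<and> card J = n - r + 1 \<and> (\<forall>j\<in>J. Xs j t \<omega> > u))"
proof -
  let ?xs = "map (\<lambda>j. Xs j t \<omega>) [1..<Suc n]" and ?G = "{j \<in> {1..n}. Xs j t \<omega> > u}"
  have "length (filter (\<lambda>x. x > u) (sort ?xs)) = length (filter (\<lambda>x. x > u) ?xs)"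
    by (metis mset_filter mset_sort size_mset)
  also have "\<dots> = length (filter (\<lambda>j. Xs j t \<omega> > u) [1..<Suc n])"
    by (simp add: filter_map o_def del: upt_Suc)
  also have "\<dots> = card (set (filter (\<lambda>j. Xs j t \<omega> > u) [1..<Suc n]))"
    by (rule distinct_card[symmetric]) simp
  also have "set (filter (\<lambda>j. Xs j t \<omega> > u) [1..<Suc n]) = ?G"
    by auto
  finally have len: "length (filter (\<lambda>x. x > u) (sort ?xs)) = card ?G" .
  have "order_stat_process r n Xs t \<omega> > u \<longleftrightarrow> n - (r - 1) \<le> card ?G"
    unfolding order_stat_process_def using assms sorted_nth_greater_iff[of "sort ?xs" "r - 1" u, unfolded len]
    by (simp del: upt_Suc)
  also have "n - (r - 1) = n - r + 1"
    using assms by simp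
  also have "n - r + 1 \<le> card ?G \<longleftrightarrow> (\<exists>J. J \<subseteq> ?G \<and> card J = n - r + 1)"
  proof
    assume "n - r + 1 \<le> card ?G"
    then show "\<exists>J. J \<subseteq> ?G \<and> card J = n - r + 1"
      by (rule obtain_subset_with_card_n) blast
  next
    assume "\<exists>J. J \<subseteq> ?G \<and> card J = n - r + 1"
    then obtain J where "J \<subseteq> ?G" "card J = n - r + 1"
      by blast
    moreover have "finite ?G"
      by simp
    ultimately show "n - r + 1 \<le> card ?G"
      using card_mono[of ?G J] by simp
  qed
  also have "\<dots> \<longleftrightarrow> (\<exists>J. J \<subseteq> {1..n} \<and> card J = n - r + 1 \<and> (\<forall>j\<in>J. Xs j t \<omega> > u))"
    by blast
  finally show ?thesis .
qed

lemma (in prob_space) gaussian_rv_char: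
  assumes G: "gaussian_rv M Y" and mean: "expectation Y = 0" and var: "(\<integral>\<omega>. (Y \<omega>)\<^sup>2 \<partial>M) = v"
  shows "(CLINT \<omega>|M. iexp (Y \<omega>)) = exp (- v / 2)"
proof -
  obtain \<mu> \<sigma> where [measurable]: "random_variable borel Y" and \<sigma>: "\<sigma> \<ge> 0"
    and D: "distr M borel Y = (if \<sigma> = 0 then return borel \<mu>
        else density lborel (\<lambda>x. ennreal (normal_density \<mu> \<sigma> x)))"
    using G unfolding gaussian_rv_def by blast
  have int: "(\<integral>\<omega>. h (Y \<omega>) \<partial>M) = (\<integral>x. h x \<partial>distr M borel Y)" if [measurable]: "h \<in> borel_measurable borel"
    for h :: "real \<Rightarrow> 'b::{banach,second_countable_topology}"
    by (subst integral_distr) auto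
  show ?thesis
  proof (cases "\<sigma> = 0")
    case True
    have "\<mu> = 0"
      using mean int[of "\<lambda>x. x"] True D by (simp add: integral_return)
    moreover have "v = \<mu>\<^sup>2"
      using var int[of "\<lambda>x. x\<^sup>2"] True D by (simp add: integral_return)
    ultimately show ?thesis
      using int[of "\<lambda>x. iexp x"] True D by (simp add: integral_return)
  next
    case False
    then have s: "\<sigma> > 0" using \<sigma> by simp
    have "distr M lborel Y = distr M borel Y"
      by (rule distr_cong) auto
    then have dist: "distributed M lborel Y (normal_density \<mu> \<sigma>)"
      using D False by (auto simp: distributed_def)
    have \<mu>: "\<mu> = 0"
      using normal_distributed_expectation[OF s dist] mean by simp
    have v: "v = \<sigma>\<^sup>2"
      using normal_distributed_variance[OF s dist] mean var by simp
    have "distributed M lborel (\<lambda>x. (Y x - \<mu>) / \<sigma>) std_normal_density"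
      using dist normal_standard_normal_convert[of \<sigma> Y \<mu>] s by simp
    then have "distr M lborel (\<lambda>x. Y x / \<sigma>) = std_normal_distribution"
      by (simp add: distributed_def \<mu>)
    moreover have "distr M lborel (\<lambda>x. Y x / \<sigma>) = distr M borel (\<lambda>x. Y x / \<sigma>)"
      by (rule distr_cong) auto
    ultimately have *: "distr M borel (\<lambda>x. Y x / \<sigma>) = std_normal_distribution"
      by simp
    have "(CLINT \<omega>|M. iexp (Y \<omega>)) = char (distr M borel (\<lambda>x. Y x / \<sigma>)) \<sigma>"
      unfolding char_def using s by (subst integral_distr) auto
    also have "\<dots> = exp (- v / 2)"
      by (simp add: * char_std_normal_distribution v)
    finally show ?thesis .
  qed
qed

lemma process_law_integral:
  fixes h :: "(real \<Rightarrow> real) \<Rightarrow> 'b::{banach,second_countable_topology}"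
  assumes "sample_path X \<in> M \<rightarrow>\<^sub>M path_space" "h \<in> borel_measurable path_space"
  shows "(\<integral>f. h f \<partial>process_law M X) = (\<integral>\<omega>. h (sample_path X \<omega>) \<partial>M)"
  unfolding process_law_def using assms by (simp add: integral_distr)

lemma sample_path_apply: "t \<ge> 0 \<Longrightarrow> sample_path X \<omega> t = X t \<omega>"
  by (simp add: sample_path_def)

lemma measurable_sample_path:
  assumes "\<And>t. t \<ge> 0 \<Longrightarrow> X t \<in> borel_measurable M"
  shows "sample_path X \<in> M \<rightarrow>\<^sub>M path_space"
  unfolding sample_path_def[abs_def] by (rule measurable_restrict) (use assms in auto)

lemma measurable_coord_sample_path:
  assumes "sample_path X \<in> M \<rightarrow>\<^sub>M path_space" "t \<ge> 0"
  shows "X t \<in> borel_measurable M"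
proof -
  have "(\<lambda>\<omega>. sample_path X \<omega> t) \<in> borel_measurable M"
    by (rule measurable_compose[OF assms(1) measurable_component_singleton]) (use assms in simp)
  then show ?thesis using assms by (simp add: sample_path_apply)
qed

lemma gauss_pair_process_law:
  assumes sp: "sample_path X \<in> M \<rightarrow>\<^sub>M path_space" and t: "s \<ge> 0" "t \<ge> 0"
  shows "gauss_pair M (X s) (X t) \<rho> \<longleftrightarrow> gauss_pair (process_law M X) (\<lambda>f. f s) (\<lambda>f. f t) \<rho>"
proof -
  have [measurable]: "(\<lambda>f. f x) \<in> borel_measurable path_space" if "x \<ge> 0" for x :: real
    using that by (intro measurable_component_singleton) simp
  have "(CLINT f|process_law M X. iexp (a * f s + b * f t)) = (CLINT \<omega>|M. iexp (a * X s \<omega> + b * X t \<omega>))" for a b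
    using t by (subst process_law_integral[OF sp]) (auto simp: sample_path_apply)
  then show ?thesis
    using t by (auto simp: gauss_pair_def measurable_coord_sample_path[OF sp] process_law_def)
qed

lemma gaussian_process_measurable:
  assumes "gaussian_process M X" "t \<ge> 0" shows "X t \<in> borel_measurable M"
proof -
  have "gaussian_rv M (\<lambda>\<omega>. \<Sum>t\<in>{t}. 1 * X t \<omega>)"
    using assms(1)[unfolded gaussian_process_def, rule_format, of "{t}" "\<lambda>_. 1"] assms(2) by simp
  then show ?thesis by (simp add: gaussian_rv_def)
qed

text \<open>
  All linear combinations are normal by assumption, so their means and variances determine the joint
  characteristic function; stationarity reduces the covariance to the correlation function.
\<close>

lemma gauss_pair_process:
  assumes "prob_space N" and gp: "gaussian_process N X" and st: "stationary_process N X"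
    and mean: "\<And>t. t \<ge> 0 \<Longrightarrow> (\<integral>\<omega>. X t \<omega> \<partial>N) = 0"
    and var: "\<And>t. t \<ge> 0 \<Longrightarrow> (\<integral>\<omega>. (X t \<omega>)\<^sup>2 \<partial>N) = 1"
    and t: "s \<ge> 0" "t \<ge> 0"
  shows "gauss_pair N (X s) (X t) (correlation N X \<bar>t - s\<bar>)"
proof -
  interpret prob_space N by fact
  note mX = gaussian_process_measurable[OF gp]
  have intsq: "integrable N (\<lambda>\<omega>. (X t \<omega>)\<^sup>2)" if "t \<ge> 0" for t
    using var[OF that] not_integrable_integral_eq by fastforce
  have intprod: "integrable N (\<lambda>\<omega>. X s \<omega> * X t \<omega>)" if "s \<ge> 0" "t \<ge> 0" for s t
  proof (rule Bochner_Integration.integrable_bound[of _ "\<lambda>\<omega>. (X s \<omega>)\<^sup>2 + (X t \<omega>)\<^sup>2"])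
    have "\<bar>x * y\<bar> \<le> \<bar>x\<^sup>2 + y\<^sup>2\<bar>" for x y :: real
    proof -
      have "0 \<le> (\<bar>x\<bar> - \<bar>y\<bar>)\<^sup>2" by simp
      then have "2 * \<bar>x * y\<bar> \<le> x\<^sup>2 + y\<^sup>2" by (simp add: power2_diff abs_mult)
      then show ?thesis using abs_ge_zero[of "x * y"] by simp
    qed
    then show "AE \<omega> in N. norm (X s \<omega> * X t \<omega>) \<le> norm ((X s \<omega>)\<^sup>2 + (X t \<omega>)\<^sup>2)"
      by (intro AE_I2) (simp only: real_norm_def)
  qed (use that intsq mX in auto)
  have int1: "integrable N (X t)" if "t \<ge> 0" for t
  proof (rule Bochner_Integration.integrable_bound[of _ "\<lambda>\<omega>. 1 + (X t \<omega>)\<^sup>2"])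
    have "\<bar>x\<bar> \<le> 1 + x\<^sup>2" for x :: real
    proof -
      have "0 \<le> (\<bar>x\<bar> - 1)\<^sup>2" by simp
      then show ?thesis using abs_ge_zero[of x] unfolding power2_diff power2_abs by simp
    qed
    then show "AE \<omega> in N. norm (X t \<omega>) \<le> norm (1 + (X t \<omega>)\<^sup>2)"
      by auto
  qed (use that intsq mX in auto)
  have corr: "(\<integral>\<omega>. X t \<omega> * X s \<omega> \<partial>N) = correlation N X (t - s)" if "0 \<le> s" "s \<le> t" for s t
  proof -
    have sp: "sample_path (\<lambda>t. X (t + s)) \<in> N \<rightarrow>\<^sub>M path_space" "sample_path X \<in> N \<rightarrow>\<^sub>M path_space"
      by (rule measurable_sample_path; use that mX in simp)+
    have [measurable]: "(\<lambda>f. f (t - s) * f 0) \<in> borel_measurable path_space"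
      using that by (intro borel_measurable_times measurable_component_singleton) auto
    have "(\<integral>\<omega>. X t \<omega> * X s \<omega> \<partial>N) = (\<integral>f. f (t - s) * f 0 \<partial>process_law N (\<lambda>t. X (t + s)))"
      using that by (subst process_law_integral[OF sp(1)]) (auto simp: sample_path_apply)
    also have "process_law N (\<lambda>t. X (t + s)) = process_law N X"
      using st that by (simp add: stationary_process_def)
    also have "(\<integral>f. f (t - s) * f 0 \<partial>process_law N X) = correlation N X (t - s)"
      using that by (subst process_law_integral[OF sp(2)]) (auto simp: sample_path_apply correlation_def)
    finally show ?thesis .
  qed
  have corr': "(\<integral>\<omega>. X s \<omega> * X t \<omega> \<partial>N) = correlation N X \<bar>t - s\<bar>"
    using corr[of s t] corr[of t s] t by (cases "s \<le> t") (auto simp: mult.commute)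
  have G: "gaussian_rv N (\<lambda>\<omega>. a * X s \<omega> + b * X t \<omega>)" for a b
  proof (cases "s = t")
    case True
    have "gaussian_rv N (\<lambda>\<omega>. \<Sum>u\<in>{t}. (a + b) * X u \<omega>)"
      using gp[unfolded gaussian_process_def, rule_format, of "{t}" "\<lambda>_. a + b"] t by simp
    then show ?thesis by (simp add: True ring_distribs)
  next
    case False
    have "gaussian_rv N (\<lambda>\<omega>. \<Sum>u\<in>{s, t}. (if u = s then a else b) * X u \<omega>)"
      using gp[unfolded gaussian_process_def, rule_format, of "{s, t}" "\<lambda>u. if u = s then a else b"] t by simp
    then show ?thesis using False by (auto simp: False[symmetric])
  qed
  have "(CLINT \<omega>|N. iexp (a * X s \<omega> + b * X t \<omega>)) =
      exp (- (a\<^sup>2 + 2 * a * b * correlation N X \<bar>t - s\<bar> + b\<^sup>2) / 2)" for a b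
  proof (rule gaussian_rv_char[OF G])
    show "expectation (\<lambda>\<omega>. a * X s \<omega> + b * X t \<omega>) = 0"
      using t int1 mean by simp
    have "(\<integral>\<omega>. (a * X s \<omega> + b * X t \<omega>)\<^sup>2 \<partial>N) =
        (\<integral>\<omega>. a\<^sup>2 * (X s \<omega>)\<^sup>2 + 2 * a * b * (X s \<omega> * X t \<omega>) + b\<^sup>2 * (X t \<omega>)\<^sup>2 \<partial>N)"
      by (rule Bochner_Integration.integral_cong) (auto simp: power2_eq_square algebra_simps)
    also have "\<dots> = a\<^sup>2 + 2 * a * b * correlation N X \<bar>t - s\<bar> + b\<^sup>2"
      using t intsq intprod var corr' by simp
    finally show "(\<integral>\<omega>. (a * X s \<omega> + b * X t \<omega>)\<^sup>2 \<partial>N) = a\<^sup>2 + 2 * a * b * correlation N X \<bar>t - s\<bar> + b\<^sup>2" .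
  qed
  then show ?thesis
    unfolding gauss_pair_def using mX[OF t(1)] mX[OF t(2)] by blast
qed

section \<open>Exceedances in a short interval\<close>

lemma power_div_fact_le_exp:
  fixes x :: real assumes "x \<ge> 0" shows "x ^ N / fact N \<le> exp x"
proof -
  have "(\<Sum>n\<in>{N}. x ^ n /\<^sub>R fact n) \<le> (\<Sum>n. x ^ n /\<^sub>R fact n)"
    using exp_converges[of x] assms by (intro sum_le_suminf) (auto simp: sums_iff)
  then show ?thesis
    using exp_converges[of x] by (simp add: sums_iff field_simps)
qed

text \<open>
  At level \<open>m\<close> of the chaining there are about \<open>2 ^ m\<close> points, and each step has probability doubly
  exponentially small in \<open>m\<close>.
\<close>

lemma summable_power_times_exp_power:
  fixes a b k :: real
  assumes a: "a > 0" and b: "b > 1" and k: "k > 0"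
  shows "summable (\<lambda>m. a ^ m * exp (- (k * b ^ m)))"
proof -
  obtain N where N: "b ^ N > a" 
    using b real_arch_pow by blast
  have "a ^ m * exp (- (k * b ^ m)) \<le> (fact N / k ^ N) * (a / b ^ N) ^ m" for m
  proof -
    have "(k * b ^ m) ^ N / fact N \<le> exp (k * b ^ m)"
      by (rule power_div_fact_le_exp) (use b k in auto)
    then have "exp (- (k * b ^ m)) \<le> fact N / (k * b ^ m) ^ N"
      using b k by (simp add: exp_minus field_simps)
    also have "\<dots> = (fact N / k ^ N) / (b ^ N) ^ m"
      by (simp add: power_mult_distrib power_mult[symmetric] mult.commute)
    finally have "a ^ m * exp (- (k * b ^ m)) \<le> a ^ m * ((fact N / k ^ N) / (b ^ N) ^ m)"
      using a by (intro mult_left_mono) auto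
    then show ?thesis by (simp add: power_divide mult.commute)
  qed
  moreover have "summable (\<lambda>m. (fact N / k ^ N) * (a / b ^ N) ^ m)"
    using N a b by (intro summable_mult summable_geometric) (auto simp: field_simps)
  moreover have "norm (a ^ m * exp (- (k * b ^ m))) = a ^ m * exp (- (k * b ^ m))" for m
    using a by simp
  ultimately show ?thesis
    by (metis (no_types, lifting) summable_comparison_test')
qed

text \<open>
  For a continuous path this is exceedance of \<open>u\<close> somewhere on the interval from \<open>s\<close> to \<open>s + h\<close>; using only dyadic points
  makes it an event, whether or not the path is continuous.
\<close>

definition dyadic_exceedance :: "'a measure \<Rightarrow> (real \<Rightarrow> 'a \<Rightarrow> real) \<Rightarrow> real \<Rightarrow> real \<Rightarrow> real \<Rightarrow> 'a set" where
  "dyadic_exceedance M Y s h u = (\<Union>m. \<Union>i\<le>2 ^ m. {\<omega> \<in> space M. Y (s + real i * h / 2 ^ m) \<omega> > u})"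

text \<open>
  Chaining with levels \<open>u - (c / u) * w ^ m\<close> that increase to \<open>u\<close>, where \<open>w = 2 powr (- \<alpha> / 4)\<close>. If the path
  exceeds \<open>u\<close> at some dyadic point, then either it exceeds the lowest level at an endpoint, or for some \<open>m\<close> it
  passes the level of generation \<open>m + 1\<close> at a new point while staying below the level of generation \<open>m\<close>
  at a neighbour. The levels grow by an amount of order \<open>w ^ m / u\<close>, whereas the residual between neighbours has
  standard deviation of order \<open>(w ^ m)\<^sup>2 / u\<close>; so every step costs a factor that is summable against the
  number of points, on top of the tail at the lowest level. That tail is comparable to the one at \<open>u\<close>
  because the levels differ by \<open>c / u\<close> only.
\<close>

lemma (in prob_space) dyadic_exceedance_bound:
  fixes Y :: "real \<Rightarrow> 'a \<Rightarrow> real"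
  assumes gp: "\<And>s t. s \<ge> 0 \<Longrightarrow> t \<ge> 0 \<Longrightarrow> gauss_pair M (Y s) (Y t) (R \<bar>t - s\<bar>)"
    and \<alpha>: "\<alpha> > 0" and K: "K > 0"
    and up: "\<And>\<tau>. 0 < \<tau> \<Longrightarrow> \<tau> \<le> \<delta> \<Longrightarrow> 1 - R \<tau> \<le> K * \<tau> powr \<alpha>"
  obtains B U where "B > 0" "U \<ge> 1" 
    "\<And>u s h. u \<ge> U \<Longrightarrow> s \<ge> 0 \<Longrightarrow> 0 < h \<Longrightarrow> h \<le> \<delta> \<Longrightarrow> h powr \<alpha> \<le> 1 / u\<^sup>2 \<Longrightarrow>
       prob (dyadic_exceedance M Y s h u) \<le> B * (exp (- u\<^sup>2 / 2) / u)"
proof -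
  have [measurable]: "Y t \<in> borel_measurable M" if "t \<ge> 0" for t
    using gauss_pairD(1)[OF gp[OF that that]] .
  define w where "w = 2 powr (- \<alpha> / 4)"
  have w: "0 < w" "w < 1"
    using \<alpha> powr_less_mono[of "- \<alpha> / 4" 0 2] by (auto simp: w_def)
  have w4: "2 powr (- \<alpha>) = w ^ 4"
    by (simp add: w_def powr_realpow[symmetric] powr_powr flip: powr_numeral)
  define c where "c = (K + 1) / (1 - w)"
  have c: "c > 0" using K w by (simp add: c_def)
  define S where "S = (\<Sum>m. 4 * (2 ^ m * exp (- (1 / (4 * K) * (1 / w\<^sup>2) ^ m))))"
  have sumS: "summable (\<lambda>m. 4 * (2 ^ m * exp (- (1 / (4 * K) * (1 / w\<^sup>2) ^ m))))"
    using w K by (intro summable_mult summable_power_times_exp_power) (auto simp: power_less_one_iff)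
  have S0: "S \<ge> 0" unfolding S_def by (rule suminf_nonneg[OF sumS]) simp
  define B where "B = (2 + S) * (2 * exp c)"
  define U where "U = sqrt (2 * c + 2 * K + 1)"
  have B: "B > 0" using S0 by (simp add: B_def add_pos_nonneg)
  have U: "U \<ge> 1" using c K by (simp add: U_def)
  show thesis
  proof (rule that[OF B U])
    fix u s h :: real
    assume u: "u \<ge> U" and s: "s \<ge> 0" and h: "0 < h" "h \<le> \<delta>" and hu: "h powr \<alpha> \<le> 1 / u\<^sup>2"
    have u1: "u \<ge> 1" using u U by simp
    have "U\<^sup>2 \<le> u\<^sup>2" using u U by (intro power_mono) auto
    then have u2: "2 * c + 2 * K + 1 \<le> u\<^sup>2" using c K by (simp add: U_def)
    define t where "t m i = s + real i * h / 2 ^ m" for m i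
    define lev where "lev m = u - c * w ^ m / u" for m
    define F where "F m = (\<Union>i\<le>(2::nat) ^ m. {\<omega> \<in> space M. Y (t m i) \<omega> > lev m})" for m
    have t0: "t m i \<ge> 0" for m i using s h by (simp add: t_def)
    have [measurable]: "F m \<in> sets M" for m
      unfolding F_def using t0 by (intro sets.finite_UN) auto
    have lev_le: "lev m \<le> u" for m using c w u1 by (simp add: lev_def)
    have lev0: "lev 0 \<le> lev m" for m
      using c w u1 by (simp add: lev_def divide_right_mono power_le_one)
    have l0: "lev 0 \<ge> u / 2"
    proof -
      have "c / u \<le> u / 2" using u1 u2 K c by (simp add: field_simps power2_eq_square)
      then show ?thesis by (simp add: lev_def)
    qed
    have step: "prob {\<omega> \<in> space M. Y (t (Suc m) i) \<omega> > lev (Suc m) \<and> Y (t m (i div 2)) \<omega> \<le> lev m}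
        \<le> normal_tail (lev 0) * exp (- (1 / (4 * K) * (1 / w\<^sup>2) ^ m))" for m i
    proof (cases "even i")
      case True
      then have "t (Suc m) i = t m (i div 2)"
        by (auto simp: t_def elim!: evenE)
      moreover have "lev m \<le> lev (Suc m)"
        using c w u1 by (simp add: lev_def divide_right_mono mult_left_le)
      ultimately have "{\<omega> \<in> space M. Y (t (Suc m) i) \<omega> > lev (Suc m) \<and> Y (t m (i div 2)) \<omega> \<le> lev m} = {}"
        by auto
      then show ?thesis by (simp only: measure_empty) (simp add: normal_tail_nonneg)
    next
      case False
      define \<tau> where "\<tau> = h / 2 ^ Suc m"
      have "h / 2 ^ Suc m \<le> h / 1"
        using h by (intro divide_left_mono one_le_power) auto
      then have \<tau>: "\<tau> > 0" "\<tau> \<le> \<delta>"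
        using h by (auto simp: \<tau>_def)
      have dist: "\<bar>t m (i div 2) - t (Suc m) i\<bar> = \<tau>"
        using False h by (auto simp: t_def \<tau>_def field_simps elim!: oddE)
      define \<rho> where "\<rho> = R \<tau>"
      have g: "gauss_pair M (Y (t (Suc m) i)) (Y (t m (i div 2))) \<rho>"
        using gp[OF t0 t0, of "Suc m" i m "i div 2"] dist by (simp add: \<rho>_def)
      have "\<tau> powr \<alpha> = h powr \<alpha> / (2 powr real (Suc m)) powr \<alpha>"
        using h by (simp add: \<tau>_def powr_divide powr_realpow del: power_Suc of_nat_Suc)
      also have "\<dots> = h powr \<alpha> * 2 powr (- \<alpha> * real (Suc m))"
        by (simp add: powr_powr powr_minus divide_inverse mult.commute del: of_nat_Suc)
      also have "2 powr (- \<alpha> * real (Suc m)) = (2 powr (- \<alpha>)) ^ Suc m"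
        by (simp add: powr_powr powr_realpow[symmetric] del: power_Suc of_nat_Suc)
      also have "(2 powr (- \<alpha>)) ^ Suc m = w ^ (4 * Suc m)"
        unfolding w4 by (simp only: power_mult)
      also have "h powr \<alpha> * w ^ (4 * Suc m) \<le> 1 / u\<^sup>2 * w ^ (4 * m)"
        using hu w by (intro mult_mono power_decreasing) auto
      finally have "K * \<tau> powr \<alpha> \<le> K * (1 / u\<^sup>2 * w ^ (4 * m))"
        using K by (intro mult_left_mono) auto
      then have \<rho>1: "1 - \<rho> \<le> K * w ^ (4 * m) / u\<^sup>2"
        using up[OF \<tau>] by (simp add: \<rho>_def)
      also have "\<dots> \<le> K * 1 / u\<^sup>2"
        using K w by (intro divide_right_mono mult_left_mono power_le_one) auto
      also have "\<dots> < 1"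
        using u2 c K u1 by simp
      finally have \<rho>0: "\<rho> > 0" by simp
      have \<rho>le: "\<rho> \<le> 1" using gauss_pair_abs_corr_le_1[OF g] by simp
      define v where "v = 2 * K * w ^ (4 * m) / u\<^sup>2"
      have v: "v > 0" using K w u1 by (simp add: v_def)
      have "1 - \<rho>\<^sup>2 \<le> 2 * (1 - \<rho>)"
        using zero_le_power2[of "1 - \<rho>"] by (simp add: power2_eq_square algebra_simps)
      then have var: "1 - \<rho>\<^sup>2 \<le> v"
        using \<rho>1 by (simp add: v_def)
      have "(1 - \<rho>) * lev (Suc m) \<le> (1 - \<rho>) * u"
        using \<rho>le lev_le by (intro mult_left_mono) auto
      also have "\<dots> \<le> K * w ^ (4 * m) / u\<^sup>2 * u"
        using \<rho>1 u1 by (intro mult_right_mono) auto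
      also have "\<dots> = K * w ^ (4 * m) / u"
        using u1 by (simp add: power2_eq_square)
      also have "\<dots> \<le> K * w ^ m / u"
        using K w u1 by (intro divide_right_mono mult_left_mono power_decreasing) auto
      finally have A: "(1 - \<rho>) * lev (Suc m) \<le> K * w ^ m / u" .
      have "c * (1 - w) = K + 1" using w by (simp add: c_def)
      have "lev (Suc m) - lev m = (c * (1 - w)) * w ^ m / u"
        by (simp add: lev_def diff_divide_distrib[symmetric] algebra_simps)
      also note \<open>c * (1 - w) = K + 1\<close>
      finally have "lev (Suc m) - lev m = (K + 1) * w ^ m / u" .
      with A have gap: "\<rho> * lev (Suc m) - lev m \<ge> w ^ m / u"
        by (simp add: algebra_simps add_divide_distrib)
      then have gap0: "lev m \<le> \<rho> * lev (Suc m)"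
        using w u1 by (smt (verit) divide_nonneg_pos zero_le_power)
      have "prob {\<omega> \<in> space M. Y (t (Suc m) i) \<omega> > lev (Suc m) \<and> Y (t m (i div 2)) \<omega> \<le> lev m}
          \<le> normal_tail (lev (Suc m)) * exp (- (\<rho> * lev (Suc m) - lev m)\<^sup>2 / (2 * v))"
        by (rule gauss_pair_step[OF g v var gap0 \<rho>0])
      also have "\<dots> \<le> normal_tail (lev 0) * exp (- (w ^ m / u)\<^sup>2 / (2 * v))"
        using gap w u1 v lev0
        by (intro mult_mono normal_tail_antimono normal_tail_nonneg)
           (auto intro!: divide_right_mono power_mono)
      also have "(w ^ m / u)\<^sup>2 / (2 * v) = 1 / (4 * K) * (1 / w\<^sup>2) ^ m"
      proof -
        have "w ^ (4 * m) = (w ^ m) ^ 4" "(1 / w\<^sup>2) ^ m = 1 / (w ^ m)\<^sup>2"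
          by (simp_all add: power_divide power_mult[symmetric] mult.commute)
        then show ?thesis
          using w u1 K by (simp add: v_def field_simps eval_nat_numeral)
      qed
      then have "- (w ^ m / u)\<^sup>2 / (2 * v) = - (1 / (4 * K) * (1 / w\<^sup>2) ^ m)"
        by simp
      finally show ?thesis .
    qed
    have inc: "prob (F (Suc m) - F m) \<le> normal_tail (lev 0) * (4 * (2 ^ m * exp (- (1 / (4 * K) * (1 / w\<^sup>2) ^ m))))" for m
    proof -
      let ?e = "exp (- (1 / (4 * K) * (1 / w\<^sup>2) ^ m))"
      have "prob (F (Suc m) - F m) \<le> prob (\<Union>i\<le>2 ^ Suc m. {\<omega> \<in> space M. Y (t (Suc m) i) \<omega> > lev (Suc m) \<and> Y (t m (i div 2)) \<omega> \<le> lev m})"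
      proof (rule finite_measure_mono)
        show "F (Suc m) - F m \<subseteq> (\<Union>i\<le>2 ^ Suc m. {\<omega> \<in> space M. Y (t (Suc m) i) \<omega> > lev (Suc m) \<and> Y (t m (i div 2)) \<omega> \<le> lev m})"
        proof
          fix \<omega> assume "\<omega> \<in> F (Suc m) - F m"
          then obtain i where i: "i \<le> 2 ^ Suc m" "\<omega> \<in> space M" "Y (t (Suc m) i) \<omega> > lev (Suc m)" and n: "\<omega> \<notin> F m"
            unfolding F_def by blast
          have "i div 2 \<le> 2 ^ m" using i(1) by simp
          with n i(2) have "Y (t m (i div 2)) \<omega> \<le> lev m"
            unfolding F_def by (auto simp: not_less)
          with i show "\<omega> \<in> (\<Union>i\<le>2 ^ Suc m. {\<omega> \<in> space M. Y (t (Suc m) i) \<omega> > lev (Suc m) \<and> Y (t m (i div 2)) \<omega> \<le> lev m})"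
            by blast
        qed
      qed (use t0 in \<open>intro sets.finite_UN; auto\<close>)
      also have "\<dots> \<le> (\<Sum>i\<le>2 ^ Suc m. prob {\<omega> \<in> space M. Y (t (Suc m) i) \<omega> > lev (Suc m) \<and> Y (t m (i div 2)) \<omega> \<le> lev m})"
        by (rule finite_measure_subadditive_finite) (use t0 in auto)
      also have "\<dots> \<le> (\<Sum>i\<le>(2::nat) ^ Suc m. normal_tail (lev 0) * ?e)"
        by (intro sum_mono step)
      also have "\<dots> = real (2 ^ Suc m + 1) * (normal_tail (lev 0) * ?e)"
        by simp
      also have "\<dots> \<le> (4 * 2 ^ m) * (normal_tail (lev 0) * ?e)"
      proof (rule mult_right_mono)
        have "(1 :: real) \<le> 2 ^ m" by simp
        then have "(1 :: real) \<le> 2 * 2 ^ m" by linarith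
        then show "real (2 ^ Suc m + 1) \<le> 4 * 2 ^ m" by simp
      qed (simp add: normal_tail_nonneg)
      finally show ?thesis by (simp add: algebra_simps)
    qed
    have sum_inc: "summable (\<lambda>m. prob (F (Suc m) - F m))"
      by (rule summable_comparison_test'[where N = 0, OF summable_mult[OF sumS, of "normal_tail (lev 0)"]])
         (use inc in auto)
    have sub: "dyadic_exceedance M Y s h u \<subseteq> F 0 \<union> (\<Union>m. F (Suc m) - F m)"
    proof
      fix \<omega> assume "\<omega> \<in> dyadic_exceedance M Y s h u"
      then obtain m i where i: "i \<le> (2::nat) ^ m" "\<omega> \<in> space M" "Y (t m i) \<omega> > u"
        unfolding dyadic_exceedance_def t_def by blast
      have "Y (t m i) \<omega> > lev m" using i(3) lev_le[of m] by linarith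
      then have "\<omega> \<in> F m" using i unfolding F_def by blast
      then show "\<omega> \<in> F 0 \<union> (\<Union>m. F (Suc m) - F m)"
        by (induction m) auto
    qed
    have "prob (F 0) \<le> (\<Sum>i\<le>(2::nat) ^ 0. prob {\<omega> \<in> space M. Y (t 0 i) \<omega> > lev 0})"
      unfolding F_def by (rule finite_measure_subadditive_finite) (use t0 in auto)
    also have "\<dots> = (\<Sum>i\<le>(2::nat) ^ 0. normal_tail (lev 0))"
      by (intro sum.cong refl gauss_pair_tail[OF gp[OF t0 t0]])
    finally have F0: "prob (F 0) \<le> 2 * normal_tail (lev 0)"
      by simp
    have "prob (dyadic_exceedance M Y s h u) \<le> prob (F 0 \<union> (\<Union>m. F (Suc m) - F m))"
      by (rule finite_measure_mono[OF sub]) auto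
    also have "\<dots> \<le> prob (F 0) + prob (\<Union>m. F (Suc m) - F m)"
      by (rule measure_Un_le) auto
    also have "prob (\<Union>m. F (Suc m) - F m) \<le> (\<Sum>m. prob (F (Suc m) - F m))"
      by (rule finite_measure_subadditive_countably) (use sum_inc in auto)
    also have "\<dots> \<le> (\<Sum>m. normal_tail (lev 0) * (4 * (2 ^ m * exp (- (1 / (4 * K) * (1 / w\<^sup>2) ^ m)))))"
      by (intro suminf_le inc sum_inc summable_mult[OF sumS])
    also have "\<dots> = normal_tail (lev 0) * S"
      unfolding S_def by (rule suminf_mult[OF sumS])
    finally have main: "prob (dyadic_exceedance M Y s h u) \<le> (2 + S) * normal_tail (lev 0)"
      using F0 by (simp add: algebra_simps)
    have "normal_tail (lev 0) \<le> exp (- (lev 0)\<^sup>2 / 2) / lev 0"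
      by (rule normal_tail_upper) (use l0 u1 in simp)
    also have "\<dots> \<le> exp (c - u\<^sup>2 / 2) / (u / 2)"
    proof (rule frac_le)
      have "(lev 0)\<^sup>2 = u\<^sup>2 - 2 * c + (c / u)\<^sup>2"
        using u1 by (simp add: lev_def power2_diff)
      then show "exp (- (lev 0)\<^sup>2 / 2) \<le> exp (c - u\<^sup>2 / 2)"
        by simp
    qed (use l0 u1 in auto)
    also have "\<dots> = 2 * exp c * (exp (- u\<^sup>2 / 2) / u)"
    proof -
      have "exp (c - u\<^sup>2 / 2) = exp c * exp (- u\<^sup>2 / 2)"
        by (simp add: mult_exp_exp)
      then show ?thesis by simp
    qed
    finally have "(2 + S) * normal_tail (lev 0) \<le> (2 + S) * (2 * exp c * (exp (- u\<^sup>2 / 2) / u))"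
      using S0 by (intro mult_left_mono) auto
    with main show "prob (dyadic_exceedance M Y s h u) \<le> B * (exp (- u\<^sup>2 / 2) / u)"
      by (simp add: B_def mult.assoc)
  qed
qed

lemma dyadic_point_if_greater:
  fixes g :: "real \<Rightarrow> real"
  assumes cont: "continuous_on {0..} g" and s: "s \<ge> 0" and h: "h > 0" and t: "s \<le> t" "t \<le> s + h" and u: "g t > u"
  obtains m i where "i \<le> (2::nat) ^ m" "g (s + real i * h / 2 ^ m) > u"
proof -
  define x where "x = (t - s) / h"
  have x: "0 \<le> x" "x \<le> 1" using t h by (auto simp: x_def)
  define i where "i m = nat \<lfloor>x * 2 ^ m\<rfloor>" for m :: nat
  have i_le: "real (i m) \<le> x * 2 ^ m" "x * 2 ^ m - 1 \<le> real (i m)" for m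
    using x by (auto simp: i_def)
  have "(\<lambda>m. real (i m) / 2 ^ m) \<longlonglongrightarrow> x"
  proof (rule tendsto_sandwich)
    show "\<forall>\<^sub>F m in sequentially. x - 1 / 2 ^ m \<le> real (i m) / 2 ^ m"
    proof (intro always_eventually allI)
      fix m
      have "(x * 2 ^ m - 1) / 2 ^ m \<le> real (i m) / 2 ^ m"
        by (intro divide_right_mono i_le(2)) simp
      then show "x - 1 / 2 ^ m \<le> real (i m) / 2 ^ m"
        by (simp add: diff_divide_distrib)
    qed
    show "\<forall>\<^sub>F m in sequentially. real (i m) / 2 ^ m \<le> x"
      using i_le(1) by (simp add: field_simps)
    show "(\<lambda>m. x - 1 / 2 ^ m) \<longlonglongrightarrow> x"
      by real_asymp
  qed simp
  then have "(\<lambda>m. s + real (i m) / 2 ^ m * h) \<longlonglongrightarrow> s + x * h"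
    by (intro tendsto_intros)
  also have "s + x * h = t" using h by (simp add: x_def)
  finally have "(\<lambda>m. s + real (i m) * h / 2 ^ m) \<longlonglongrightarrow> t" by simp
  then have "(\<lambda>m. g (s + real (i m) * h / 2 ^ m)) \<longlonglongrightarrow> g t"
    by (rule continuous_on_tendsto_compose[OF cont]) (use s t h in auto)
  then have "\<forall>\<^sub>F m in sequentially. g (s + real (i m) * h / 2 ^ m) > u"
    using u by (rule order_tendstoD(1))
  then obtain m where m: "g (s + real (i m) * h / 2 ^ m) > u"
    unfolding eventually_sequentially by blast
  have "x * 2 ^ m \<le> 1 * 2 ^ m"
    using x by (intro mult_right_mono) auto
  then have "real (i m) \<le> 2 ^ m"
    using i_le(1)[of m] by linarith
  then have "i m \<le> 2 ^ m" using of_nat_le_iff[where 'a = real, of "i m" "2 ^ m"] by simp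
  then show thesis using m by (rule that)
qed

section \<open>Convergent series of exceedance probabilities\<close>

text \<open>
  The processes enter through their two-point laws, their independence and their continuity only; \<open>R\<close> is the correlation
  function. Conditions on \<open>R\<close> are stated where they are used, since the two halves of the
  theorem need different ones.
\<close>

locale gaussian_copies = prob_space M for M :: "'a measure" +
  fixes Xs :: "nat \<Rightarrow> real \<Rightarrow> 'a \<Rightarrow> real" and R :: "real \<Rightarrow> real" and r n :: nat
  assumes pair: "\<And>j s t. j \<in> {1..n} \<Longrightarrow> s \<ge> 0 \<Longrightarrow> t \<ge> 0 \<Longrightarrow> gauss_pair M (Xs j s) (Xs j t) (R \<bar>t - s\<bar>)"
    and indep: "independent_processes M Xs {1..n}"
    and cont: "\<And>j. j \<in> {1..n} \<Longrightarrow> continuous_paths M (Xs j)"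
    and r: "1 \<le> r" "r \<le> n"
begin

definition rhat :: nat where "rhat = n - r + 1"

lemma rhat: "rhat \<ge> 1" "rhat \<le> n" "r_hat r n = real rhat"
  using r by (auto simp: rhat_def r_hat_def of_nat_diff)

lemma measurable_Xs [measurable]: "j \<in> {1..n} \<Longrightarrow> t \<ge> 0 \<Longrightarrow> Xs j t \<in> borel_measurable M"
  using gauss_pairD(1)[OF pair[of j t t]] by simp

lemma prob_all_eq_prod:
  assumes J: "J \<subseteq> {1..n}" "J \<noteq> {}" and P: "Measurable.pred path_space P"
  shows "prob {\<omega> \<in> space M. \<forall>j\<in>J. P (sample_path (Xs j) \<omega>)} =
    (\<Prod>j\<in>J. prob {\<omega> \<in> space M. P (sample_path (Xs j) \<omega>)})"
proof -
  have fin: "finite J" using J finite_subset by blast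
  have iv: "indep_vars (\<lambda>_. path_space) (\<lambda>j. sample_path (Xs j)) {1..n}"
    using indep by (simp add: independent_processes_def)
  define A where "A = {f \<in> space path_space. P f}"
  have A: "A \<in> sets path_space" unfolding A_def using P by measurable
  have sp: "sample_path X \<omega> \<in> space path_space" for X :: "real \<Rightarrow> 'a \<Rightarrow> real" and \<omega>
    by (simp add: sample_path_def space_PiM)
  have eq: "sample_path (Xs j) -` A \<inter> space M = {\<omega> \<in> space M. P (sample_path (Xs j) \<omega>)}" for j
    using sp by (auto simp: A_def)
  have "{\<omega> \<in> space M. \<forall>j\<in>J. P (sample_path (Xs j) \<omega>)} = (\<Inter>j\<in>J. sample_path (Xs j) -` A \<inter> space M)"
    using J(2) unfolding eq by blast
  also have "prob \<dots> = (\<Prod>j\<in>J. prob (sample_path (Xs j) -` A \<inter> space M))"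
    by (rule indep_varsD[OF iv J(2) fin J(1)]) (use A in simp)
  finally show ?thesis unfolding eq .
qed

lemma measurable_dyadic_exceedance [measurable]:
  "j \<in> {1..n} \<Longrightarrow> s \<ge> 0 \<Longrightarrow> h \<ge> 0 \<Longrightarrow> dyadic_exceedance M (Xs j) s h u \<in> events"
  unfolding dyadic_exceedance_def by (intro sets.countable_UN' sets.finite_UN) auto

text \<open>
  Block \<open>k\<close> is cut into about \<open>u k powr (2 / \<alpha>)\<close> pieces. If the order statistics process exceeds \<open>u k\<close> at some \<open>t\<close>, then \<open>rhat\<close>
  processes do so at that \<open>t\<close>, and in particular all of them somewhere in the piece containing \<open>t\<close>. Replacing the common time
  by separate times in the same piece costs only a constant and makes the events independent.
\<close>

lemma eventually_no_exceedance:
  assumes \<alpha>: "\<alpha> > 0" and K: "K > 0" and \<delta>: "\<delta> > 0"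
    and up: "\<And>\<tau>. 0 < \<tau> \<Longrightarrow> \<tau> \<le> \<delta> \<Longrightarrow> 1 - R \<tau> \<le> K * \<tau> powr \<alpha>"
    and lim: "filterlim u at_top sequentially"
    and sum: "summable (\<lambda>k. u k powr (2 / \<alpha>) * (exp (- (u k)\<^sup>2 / 2) / u k) ^ rhat)"
  shows "AE \<omega> in M. \<forall>\<^sub>F k in sequentially. \<forall>t\<in>{real k..real k + 1}. order_stat_process r n Xs t \<omega> \<le> u k"
proof -
  define \<J> where "\<J> = {J. J \<subseteq> {1..n} \<and> card J = rhat}"
  have fin\<J>: "finite \<J>" unfolding \<J>_def by simp
  define N where "N k = nat \<lceil>u k powr (2 / \<alpha>)\<rceil>" for k
  define E where "E k J i = {\<omega> \<in> space M. \<forall>j\<in>J. \<omega> \<in> dyadic_exceedance M (Xs j) (real k + real i / real (N k)) (1 / real (N k)) (u k)}" for k J i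
  define Bad where "Bad k = (\<Union>J\<in>\<J>. \<Union>i<N k. E k J i)" for k
  have "\<exists>B U. B > 0 \<and> U \<ge> 1 \<and> (\<forall>u s h. u \<ge> U \<longrightarrow> s \<ge> 0 \<longrightarrow> 0 < h \<longrightarrow> h \<le> \<delta> \<longrightarrow> h powr \<alpha> \<le> 1 / u\<^sup>2 \<longrightarrow>
       prob (dyadic_exceedance M (Xs j) s h u) \<le> B * (exp (- u\<^sup>2 / 2) / u))" if "j \<in> {1..n}" for j
    by (rule dyadic_exceedance_bound[OF pair[OF that] \<alpha> K up]) blast+
  then obtain Bj Uj where BU: "\<And>j. j \<in> {1..n} \<Longrightarrow> Bj j > 0" "\<And>j. j \<in> {1..n} \<Longrightarrow> Uj j \<ge> (1::real)"
    "\<And>j u s h. j \<in> {1..n} \<Longrightarrow> u \<ge> Uj j \<Longrightarrow> s \<ge> 0 \<Longrightarrow> 0 < h \<Longrightarrow> h \<le> \<delta> \<Longrightarrow> h powr \<alpha> \<le> 1 / u\<^sup>2 \<Longrightarrow>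
       prob (dyadic_exceedance M (Xs j) s h u) \<le> Bj j * (exp (- u\<^sup>2 / 2) / u)"
    by metis
  define B where "B = (\<Sum>j\<in>{1..n}. Bj j)"
  define U where "U = (\<Sum>j\<in>{1..n}. Uj j)"
  have B_ge: "Bj j \<le> B" if "j \<in> {1..n}" for j
    unfolding B_def using that BU(1) by (intro member_le_sum) (auto intro: less_imp_le)
  have U_ge: "Uj j \<le> U" if "j \<in> {1..n}" for j
    unfolding U_def using that BU(2) by (intro member_le_sum) (auto intro: order_trans[OF zero_le_one])
  have one: "1 \<in> {1..n}" using r by simp
  have B0: "B > 0" using B_ge[OF one] BU(1)[OF one] by linarith
  have U1: "U \<ge> 1" using U_ge[OF one] BU(2)[OF one] by linarith
  have "\<forall>\<^sub>F k in sequentially. u k \<ge> max U (max 1 (1 / \<delta>) powr (\<alpha> / 2))"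
    using lim unfolding filterlim_at_top by blast
  then obtain k0 where k0: "\<And>k. k \<ge> k0 \<Longrightarrow> u k \<ge> max U (max 1 (1 / \<delta>) powr (\<alpha> / 2))"
    unfolding eventually_sequentially by blast
  have N: "real (N k) \<ge> u k powr (2 / \<alpha>)" "N k \<ge> 1" "real (N k) \<le> 2 * u k powr (2 / \<alpha>)"
    "1 / real (N k) \<le> \<delta>" "(1 / real (N k)) powr \<alpha> \<le> 1 / (u k)\<^sup>2" "u k \<ge> U" if "k \<ge> k0" for k
  proof -
    define x where "x = u k powr (2 / \<alpha>)"
    have uk: "u k \<ge> U" "u k \<ge> max 1 (1 / \<delta>) powr (\<alpha> / 2)" using k0[OF that] by auto
    have "max 1 (1 / \<delta>) = (max 1 (1 / \<delta>) powr (\<alpha> / 2)) powr (2 / \<alpha>)"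
      using \<alpha> by (simp add: powr_powr)
    also have "\<dots> \<le> x"
      unfolding x_def using uk(2) \<alpha> by (intro powr_mono2) auto
    finally have x: "x \<ge> 1" "x \<ge> 1 / \<delta>" by auto
    have xN: "x \<le> real (N k)" "real (N k) \<le> x + 1"
      using x(1) by (auto simp: N_def x_def[symmetric])
    have "1 / real (N k) \<le> 1 / x" using xN x(1) by (intro divide_left_mono) auto
    also have "\<dots> \<le> 1 / (1 / \<delta>)" using x \<delta> by (intro divide_left_mono) auto
    finally show "1 / real (N k) \<le> \<delta>" by simp
    have "(1 / real (N k)) powr \<alpha> \<le> (1 / x) powr \<alpha>"
      using xN x(1) \<alpha> by (intro powr_mono2 divide_left_mono) auto
    also have "\<dots> = 1 / (u k)\<^sup>2"
    proof -
      have "x powr \<alpha> = (u k)\<^sup>2"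
        using \<alpha> uk(1) U1 by (simp add: x_def powr_powr)
      then show ?thesis using x(1) by (simp add: powr_divide)
    qed
    finally show "(1 / real (N k)) powr \<alpha> \<le> 1 / (u k)\<^sup>2" .
    show "real (N k) \<ge> u k powr (2 / \<alpha>)" "N k \<ge> 1" "real (N k) \<le> 2 * u k powr (2 / \<alpha>)" "u k \<ge> U"
      using xN x(1) uk(1) by (auto simp: x_def[symmetric] Suc_le_eq intro!: Nat.gr0I)
  qed
  have mE: "E k J i \<in> events" if "J \<in> \<J>" for k J i
  proof -
    have J: "finite J" "J \<subseteq> {1..n}" using that finite_subset by (auto simp: \<J>_def)
    have "{\<omega> \<in> space M. \<omega> \<in> dyadic_exceedance M (Xs j) (real k + real i / real (N k)) (1 / real (N k)) (u k)} \<in> events"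
      if "j \<in> J" for j
    proof -
      let ?D = "dyadic_exceedance M (Xs j) (real k + real i / real (N k)) (1 / real (N k)) (u k)"
      have "{\<omega> \<in> space M. \<omega> \<in> ?D} = ?D \<inter> space M" by auto
      then show ?thesis
        using measurable_dyadic_exceedance[of j "real k + real i / real (N k)" "1 / real (N k)" "u k"] that J
        by (simp add: subset_iff)
    qed
    then show ?thesis unfolding E_def by (rule sets.sets_Collect_finite_All[OF _ J(1)])
  qed
  have pE: "prob (E k J i) \<le> B ^ rhat * (exp (- (u k)\<^sup>2 / 2) / u k) ^ rhat" if "J \<in> \<J>" "k \<ge> k0" for k J i
  proof -
    let ?s = "real k + real i / real (N k)" and ?h = "1 / real (N k)"
    define P where "P f \<longleftrightarrow> (\<exists>l. \<exists>i\<in>{..(2::nat) ^ l}. f (?s + real i * ?h / 2 ^ l) > u k)" for f :: "real \<Rightarrow> real"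
    have J: "J \<subseteq> {1..n}" "J \<noteq> {}" "card J = rhat" using that rhat(1) by (auto simp: \<J>_def)
    have h: "?h > 0" "?h \<ge> 0" "?s \<ge> 0" using N(2)[OF that(2)] by auto
    have mP: "Measurable.pred path_space P"
      unfolding P_def using h
      by (intro pred_intros_countable pred_intros_finite borel_measurable_pred_less
          measurable_const measurable_component_singleton) auto
    have eqP: "{\<omega> \<in> space M. P (sample_path (Xs j) \<omega>)} = dyadic_exceedance M (Xs j) ?s ?h (u k)" for j
      using h by (auto simp: P_def dyadic_exceedance_def sample_path_apply)
    have "E k J i = {\<omega> \<in> space M. \<forall>j\<in>J. P (sample_path (Xs j) \<omega>)}"
      unfolding E_def eqP[symmetric] by auto
    then have "prob (E k J i) = (\<Prod>j\<in>J. prob (dyadic_exceedance M (Xs j) ?s ?h (u k)))"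
      using prob_all_eq_prod[OF J(1,2) mP] by (simp only: eqP)
    also have "\<dots> \<le> (\<Prod>j\<in>J. B * (exp (- (u k)\<^sup>2 / 2) / u k))"
    proof (rule prod_mono, safe)
      fix j assume "j \<in> J"
      then have j: "j \<in> {1..n}" using J by blast
      have "prob (dyadic_exceedance M (Xs j) ?s ?h (u k)) \<le> Bj j * (exp (- (u k)\<^sup>2 / 2) / u k)"
        by (rule BU(3)[OF j _ h(3,1) N(4,5)[OF that(2)]]) (use U_ge[OF j] N(6)[OF that(2)] in linarith)
      also have "\<dots> \<le> B * (exp (- (u k)\<^sup>2 / 2) / u k)"
        using B_ge[OF j] N(6)[OF that(2)] U1 by (intro mult_right_mono) auto
      finally show "prob (dyadic_exceedance M (Xs j) ?s ?h (u k)) \<le> B * (exp (- (u k)\<^sup>2 / 2) / u k)" .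
    qed simp
    also have "\<dots> = B ^ rhat * (exp (- (u k)\<^sup>2 / 2) / u k) ^ rhat"
      by (simp only: prod_constant J(3) power_mult_distrib)
    finally show ?thesis .
  qed
  have mBad: "Bad k \<in> events" for k
    unfolding Bad_def using mE fin\<J> by (intro sets.finite_UN) auto
  have pBad: "prob (Bad k) \<le> (real (card \<J>) * 2 * B ^ rhat) * (u k powr (2 / \<alpha>) * (exp (- (u k)\<^sup>2 / 2) / u k) ^ rhat)"
    if k: "k \<ge> k0" for k
  proof -
    have "prob (Bad k) \<le> (\<Sum>J\<in>\<J>. prob (\<Union>i<N k. E k J i))"
      unfolding Bad_def using mE fin\<J> by (intro finite_measure_subadditive_finite) auto
    also have "\<dots> \<le> (\<Sum>J\<in>\<J>. \<Sum>i<N k. prob (E k J i))"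
      using mE by (intro sum_mono finite_measure_subadditive_finite) auto
    also have "\<dots> \<le> (\<Sum>J\<in>\<J>. \<Sum>i<N k. B ^ rhat * (exp (- (u k)\<^sup>2 / 2) / u k) ^ rhat)"
      using pE k by (intro sum_mono) auto
    also have "\<dots> = real (card \<J>) * real (N k) * (B ^ rhat * (exp (- (u k)\<^sup>2 / 2) / u k) ^ rhat)"
      by simp
    also have "\<dots> \<le> real (card \<J>) * (2 * u k powr (2 / \<alpha>)) * (B ^ rhat * (exp (- (u k)\<^sup>2 / 2) / u k) ^ rhat)"
      using N(3,6)[OF k] B0 U1 by (intro mult_right_mono mult_left_mono mult_nonneg_nonneg zero_le_power divide_nonneg_nonneg) auto
    finally show ?thesis by (simp add: mult_ac)
  qed
  have "summable (\<lambda>k. prob (Bad k))"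
    by (rule summable_comparison_test'[where N = k0,
          OF summable_mult[OF sum, of "real (card \<J>) * 2 * B ^ rhat"]]) (use pBad in auto)
  then have "AE \<omega> in M. \<forall>\<^sub>F k in sequentially. \<omega> \<in> space M - Bad k"
    using mBad by (intro borel_cantelli_AE1) (auto simp: emeasure_eq_measure)
  moreover have "AE \<omega> in M. \<forall>j\<in>{1..n}. continuous_on {0..} (\<lambda>t. Xs j t \<omega>)"
    using cont unfolding continuous_paths_def by (intro AE_finite_allI) auto
  ultimately show ?thesis
  proof eventually_elim
    case (elim \<omega>)
    have "\<forall>\<^sub>F k in sequentially. k \<ge> k0" by (rule eventually_ge_at_top)
    with elim(1) show ?case
    proof eventually_elim
      case (elim k)
      show ?case
      proof (rule ccontr)
        assume "\<not> ?thesis"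
        then obtain t where t: "real k \<le> t" "t \<le> real k + 1" "order_stat_process r n Xs t \<omega> > u k"
          by (auto simp: not_le)
        obtain J where J: "J \<subseteq> {1..n}" "card J = rhat" "\<And>j. j \<in> J \<Longrightarrow> Xs j t \<omega> > u k"
          using t(3) unfolding order_stat_greater_iff[OF r] rhat_def by blast
        \<comment> \<open>The minimum matters only at the right end point \<open>t = k + 1\<close>, which is put into the last piece.\<close>
        define i where "i = min (N k - 1) (nat \<lfloor>(t - real k) * real (N k)\<rfloor>)"
        have i: "i < N k" "real k + real i / real (N k) \<le> t" "t \<le> real k + real i / real (N k) + 1 / real (N k)"
        proof -
          have N0: "real (N k) > 0" "N k \<ge> 1" using N(2)[OF elim(2)] by auto
          define x where "x = (t - real k) * real (N k)"
          have x: "0 \<le> x" "x \<le> real (N k)" "t = real k + x / real (N k)"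
            using t N0 mult_right_mono[of "t - real k" 1 "real (N k)"] by (auto simp: x_def)
          have "real i \<le> x" "x \<le> real i + 1"
            using x N0 by (auto simp: i_def x_def[symmetric] min_def of_nat_diff) linarith+
          then show "real k + real i / real (N k) \<le> t" "t \<le> real k + real i / real (N k) + 1 / real (N k)"
            using N0 unfolding x(3) by (auto simp: add_divide_distrib[symmetric] divide_right_mono)
          show "i < N k" using N0 by (auto simp: i_def)
        qed
        have "\<omega> \<in> E k J i" 
        proof -
          have "\<omega> \<in> dyadic_exceedance M (Xs j) (real k + real i / real (N k)) (1 / real (N k)) (u k)" if "j \<in> J" for j
          proof -
            have cj: "continuous_on {0..} (\<lambda>t. Xs j t \<omega>)" using \<open>\<forall>j\<in>{1..n}. _ j\<close> that J by blast
            show ?thesis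
              by (rule dyadic_point_if_greater[OF cj _ _ i(2,3) J(3)[OF that]])
                 (use N(2)[OF elim(2)] elim(1) in \<open>auto simp: dyadic_exceedance_def\<close>)
          qed
          then show ?thesis using elim by (auto simp: E_def)
        qed
        then have "\<omega> \<in> Bad k" using J i(1) by (auto simp: Bad_def \<J>_def)
        then show False using elim by simp
      qed
    qed
  qed
qed

end

section \<open>Divergent series of exceedance probabilities\<close>

text \<open>
  Chebyshev's inequality for the number of events that occur: its mean is \<open>S\<close> and its variance at most
  \<open>\<eta> * S\<^sup>2 + D * S\<close>.
\<close>

lemma (in prob_space) prob_none_le_second_moment:
  assumes I: "finite I" and A: "\<And>i. i \<in> I \<Longrightarrow> A i \<in> events"
    and S: "S = (\<Sum>i\<in>I. prob (A i))" "S > 0"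
    and pairs: "(\<Sum>i\<in>I. \<Sum>j\<in>I. prob (A i \<inter> A j)) \<le> (1 + \<eta>) * S\<^sup>2 + D * S"
  shows "prob (space M - (\<Union>i\<in>I. A i)) \<le> \<eta> + D / S"
proof -
  define f where "f \<omega> = (\<Sum>i\<in>I. indicat_real (A i) \<omega>)" for \<omega>
  have [measurable]: "f \<in> borel_measurable M"
    unfolding f_def using A by (intro borel_measurable_sum borel_measurable_indicator)
  have intA: "integrable M (indicat_real (A i))" "integrable M (indicat_real (A i \<inter> A j))" if "i \<in> I" "j \<in> I" for i j
    using A[OF that(1)] A[OF that(2)] by (auto intro!: integrable_real_indicator simp: emeasure_eq_measure)
  have f2: "(f \<omega>)\<^sup>2 = (\<Sum>i\<in>I. \<Sum>j\<in>I. indicat_real (A i \<inter> A j) \<omega>)" for \<omega>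
    by (simp add: f_def power2_eq_square sum_product indicator_inter_arith)
  have Ef: "expectation f = S"
    unfolding f_def S(1) using intA A by (subst Bochner_Integration.integral_sum) (auto intro!: sum.cong)
  have intf: "integrable M f"
    unfolding f_def using intA by (intro Bochner_Integration.integrable_sum) auto
  have intf2: "integrable M (\<lambda>\<omega>. (f \<omega>)\<^sup>2)"
    unfolding f2 using intA by (intro Bochner_Integration.integrable_sum) auto
  have Ef2: "(\<integral>\<omega>. (f \<omega>)\<^sup>2 \<partial>M) = (\<Sum>i\<in>I. \<Sum>j\<in>I. prob (A i \<inter> A j))"
    unfolding f2 using intA A
    by (subst Bochner_Integration.integral_sum, force)
       (intro sum.cong refl, subst Bochner_Integration.integral_sum, auto intro!: sum.cong)
  have "variance f = (\<integral>\<omega>. (f \<omega>)\<^sup>2 \<partial>M) - S\<^sup>2"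
    using variance_eq[OF intf intf2] Ef by simp
  also have "\<dots> \<le> \<eta> * S\<^sup>2 + D * S"
    using pairs unfolding Ef2 distrib_right by simp
  finally have var: "variance f \<le> \<eta> * S\<^sup>2 + D * S" .
  have "prob (space M - (\<Union>i\<in>I. A i)) \<le> prob {\<omega> \<in> space M. \<bar>f \<omega> - expectation f\<bar> \<ge> S}"
  proof (rule finite_measure_mono)
    show "space M - (\<Union>i\<in>I. A i) \<subseteq> {\<omega> \<in> space M. \<bar>f \<omega> - expectation f\<bar> \<ge> S}"
    proof
      fix \<omega> assume \<omega>: "\<omega> \<in> space M - (\<Union>i\<in>I. A i)"
      then have "f \<omega> = 0" unfolding f_def by (intro sum.neutral) auto
      with \<omega> show "\<omega> \<in> {\<omega> \<in> space M. \<bar>f \<omega> - expectation f\<bar> \<ge> S}"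
        using S(2) by (simp add: Ef)
    qed
  qed measurable
  also have "\<dots> \<le> variance f / S\<^sup>2"
    by (rule Chebyshev_inequality) (use intf2 S(2) in auto)
  also have "\<dots> \<le> (\<eta> * S\<^sup>2 + D * S) / S\<^sup>2"
    using var by (intro divide_right_mono) auto
  also have "\<dots> = \<eta> + D / S"
    using S(2) by (simp add: field_simps power2_eq_square)
  finally show ?thesis .
qed

lemma summable_exp_powr:
  fixes c \<alpha> :: real
  assumes "c > 0" "\<alpha> > 0"
  shows "summable (\<lambda>d. exp (- (c * real d powr \<alpha>)))"
proof (rule summable_comparison_test_bigo)
  show "summable (\<lambda>d. norm (real d powr (-2)))"
    by (simp add: summable_real_powr_iff)
  show "(\<lambda>d. exp (- (c * real d powr \<alpha>))) \<in> O(\<lambda>d. real d powr (-2))"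
    using assms by real_asymp
qed

text \<open>
  Controls the expected number of companions of one grid exceedance within its block, uniformly in the
  point and in the size of the grid.
\<close>

lemma sum_abs_diff_le_suminf:
  fixes e :: "nat \<Rightarrow> real"
  assumes e: "summable e" "\<And>d. e d \<ge> 0"
  shows "(\<Sum>j<N. e (nat \<bar>int i - int j\<bar>)) \<le> 2 * suminf e"
proof -
  have "(\<Sum>j<N. e (nat \<bar>int i - int j\<bar>)) \<le>
      (\<Sum>j\<in>{..i} \<union> {i<..<N}. e (nat \<bar>int i - int j\<bar>))"
    by (rule sum_mono2) (use e in auto)
  also have "\<dots> = (\<Sum>j\<in>{..i}. e (nat \<bar>int i - int j\<bar>)) + (\<Sum>j\<in>{i<..<N}. e (nat \<bar>int i - int j\<bar>))"
    by (rule sum.union_disjoint) auto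
  also have "(\<Sum>j\<in>{..i}. e (nat \<bar>int i - int j\<bar>)) = (\<Sum>j\<in>{..i}. e (i - j))"
    by (intro sum.cong arg_cong[of _ _ e]) auto
  also have "\<dots> = sum e ((\<lambda>j. i - j) ` {..i})"
    by (subst sum.reindex) (auto simp: inj_on_def)
  also have "\<dots> \<le> suminf e"
    by (rule sum_le_suminf) (use e in auto)
  also have "(\<Sum>j\<in>{i<..<N}. e (nat \<bar>int i - int j\<bar>)) = (\<Sum>j\<in>{i<..<N}. e (j - i))"
    by (intro sum.cong arg_cong[of _ _ e]) auto
  also have "\<dots> = sum e ((\<lambda>j. j - i) ` {i<..<N})"
    by (subst sum.reindex) (auto simp: inj_on_def)
  also have "\<dots> \<le> suminf e"
    by (rule sum_le_suminf) (use e in auto)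
  finally show ?thesis by simp
qed

context gaussian_copies
begin

lemma prob_all_greater:
  assumes J: "J \<subseteq> {1..n}" "J \<noteq> {}" and t: "t \<ge> 0"
  shows "prob {\<omega> \<in> space M. \<forall>j\<in>J. Xs j t \<omega> > u} = normal_tail u ^ card J"
proof -
  have P: "Measurable.pred path_space (\<lambda>f. f t > u)"
    using t by (intro borel_measurable_pred_less measurable_const measurable_component_singleton) auto
  have "prob {\<omega> \<in> space M. \<forall>j\<in>J. Xs j t \<omega> > u} = (\<Prod>j\<in>J. prob {\<omega> \<in> space M. Xs j t \<omega> > u})"
    using prob_all_eq_prod[OF J P] t by (simp add: sample_path_apply)
  also have "\<dots> = (\<Prod>j\<in>J. normal_tail u)"
    using J t by (intro prod.cong refl gauss_pair_tail[OF pair[of _ t t]]) auto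
  finally show ?thesis by simp
qed

lemma prob_all_greater_pair_le:
  assumes J: "J \<subseteq> {1..n}" "J \<noteq> {}" and t: "s \<ge> 0" "t \<ge> 0"
    and Q: "\<And>X Y. gauss_pair M X Y (R \<bar>t - s\<bar>) \<Longrightarrow> prob {\<omega> \<in> space M. X \<omega> > u \<and> Y \<omega> > v} \<le> Q"
  shows "prob ({\<omega> \<in> space M. \<forall>j\<in>J. Xs j s \<omega> > u} \<inter> {\<omega> \<in> space M. \<forall>j\<in>J. Xs j t \<omega> > v}) \<le> Q ^ card J"
proof -
  have P: "Measurable.pred path_space (\<lambda>f. f s > u \<and> f t > v)"
    using t by (intro pred_intros_logic borel_measurable_pred_less measurable_const measurable_component_singleton) auto
  have "{\<omega> \<in> space M. \<forall>j\<in>J. Xs j s \<omega> > u} \<inter> {\<omega> \<in> space M. \<forall>j\<in>J. Xs j t \<omega> > v} =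
      {\<omega> \<in> space M. \<forall>j\<in>J. Xs j s \<omega> > u \<and> Xs j t \<omega> > v}"
    by auto
  also have "prob \<dots> = (\<Prod>j\<in>J. prob {\<omega> \<in> space M. Xs j s \<omega> > u \<and> Xs j t \<omega> > v})"
    using prob_all_eq_prod[OF J P] t by (simp add: sample_path_apply)
  also have "\<dots> \<le> (\<Prod>j\<in>J. Q)"
    using J t by (intro prod_mono conjI Q pair) auto
  finally show ?thesis by simp
qed

text \<open>
  Exceedances are sought only for the first \<open>rhat\<close> processes and only at grid points in the first halves of the
  unit intervals. Different blocks then keep a distance of at least \<open>1 / 2\<close>, so that the correlation across blocks is bounded away
  from 1, and each half block still has the full order of expected exceedances.
\<close>

lemma infinitely_often_exceedance:
  assumes \<alpha>: "\<alpha> > 0" and c: "c > 0"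
    and low: "\<And>\<tau>. 0 < \<tau> \<Longrightarrow> \<tau> \<le> 1 / 2 \<Longrightarrow> c * \<tau> powr \<alpha> \<le> 1 - R \<tau>"
    and \<kappa>: "\<kappa> > 0" and sup: "\<And>\<tau>. 1 / 2 \<le> \<tau> \<Longrightarrow> R \<tau> \<le> 1 - \<kappa>"
    and lam: "lam > 0" and D: "D > 0" and decay: "\<And>\<tau>. T0 \<le> \<tau> \<Longrightarrow> \<bar>R \<tau>\<bar> \<le> D * \<tau> powr (- 2 * lam)"
    and lim: "filterlim u at_top sequentially"
    and mono: "\<And>k l. k1 \<le> k \<Longrightarrow> k \<le> l \<Longrightarrow> u k \<le> u l"
    and a: "a > 0" "\<And>k. k1 \<le> k \<Longrightarrow> a * ln (real k) \<le> (u k)\<^sup>2"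
    and b: "b > 0" "\<And>k. k1 \<le> k \<Longrightarrow> (u k)\<^sup>2 \<le> b * ln (real k)"
    and div: "\<not> summable (\<lambda>k. u k powr (2 / \<alpha>) * normal_tail (u k) ^ rhat)"
  shows "AE \<omega> in M. \<exists>\<^sub>F k in sequentially. \<exists>t\<in>{real k..real k + 1 / 2}. order_stat_process r n Xs t \<omega> > u k"
proof -
  define N where "N k = nat \<lceil>u k powr (2 / \<alpha>)\<rceil>" for k
  define t where "t k i = real k + real i / (2 * real (N k))" for k i
  define J :: "nat set" where "J = {1..rhat}"
  have J: "J \<subseteq> {1..n}" "J \<noteq> {}" "card J = rhat" "finite J"
    using rhat by (auto simp: J_def)
  define A where "A k i = {\<omega> \<in> space M. \<forall>j\<in>J. Xs j (t k i) \<omega> > u k}" for k i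
  define p where "p k = normal_tail (u k) ^ rhat" for k
  define s where "s k = real (N k) * p k" for k
  define q where "q k l = (\<Sum>i<N k. \<Sum>i'<N l. prob (A k i \<inter> A l i'))" for k l
  \<comment> \<open>Chosen so that in nearby blocks the correlation bound gains \<open>k powr (- 2 * \<beta>)\<close> per pair, while only \<open>k powr \<beta>\<close> blocks count as nearby.\<close>
  define \<beta> where "\<beta> = min (\<kappa> * a / 8) 1"
  have \<beta>: "\<beta> > 0" "\<beta> \<le> 1" "2 * \<beta> \<le> \<kappa> * a / 4" using \<kappa> a by (auto simp: \<beta>_def)
  have t0: "t k i \<ge> 0" for k i by (simp add: t_def)
  have p0: "p k \<ge> 0" for k by (simp add: p_def normal_tail_nonneg)
  have s0: "s k \<ge> 0" for k by (simp add: s_def p0)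
  have mA [measurable]: "A k i \<in> events" for k i
  proof -
    have "{\<omega> \<in> space M. Xs j (t k i) \<omega> > u k} \<in> events" if "j \<in> J" for j
      using measurable_Xs[of j "t k i"] t0[of k i] J(1) that by auto
    then show ?thesis unfolding A_def by (rule sets.sets_Collect_finite_All[OF _ J(4)])
  qed
  have pA: "prob (A k i) = p k" for k i
    unfolding A_def p_def using prob_all_greater[OF J(1,2) t0] J(3) by simp
  have "\<forall>\<^sub>F k in sequentially. u k \<ge> 1"
    using lim unfolding filterlim_at_top by blast
  then obtain k2 where k2: "\<And>k. k \<ge> k2 \<Longrightarrow> u k \<ge> 1"
    unfolding eventually_sequentially by blast
  have N: "real (N k) \<ge> u k powr (2 / \<alpha>)" "N k \<ge> 1" "real (N k) \<le> 2 * u k powr (2 / \<alpha>)" if "k \<ge> k2" for k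
  proof -
    have x: "u k powr (2 / \<alpha>) \<ge> 1"
      using k2[OF that] \<alpha> by (intro ge_one_powr_ge_zero) auto
    have "u k powr (2 / \<alpha>) \<le> real (N k)" "real (N k) \<le> u k powr (2 / \<alpha>) + 1"
      using x by (auto simp: N_def)
    with x show "real (N k) \<ge> u k powr (2 / \<alpha>)" "N k \<ge> 1" "real (N k) \<le> 2 * u k powr (2 / \<alpha>)"
      by (auto simp: Suc_le_eq intro!: Nat.gr0I)
  qed
  have t_bounds: "real k \<le> t k i" "t k i \<le> real k + 1 / 2" if "i < N k" for k i
    using that by (auto simp: t_def field_simps)
  have joint: "prob (A k i \<inter> A l i') \<le> Q ^ rhat"
    if "\<And>X Y. gauss_pair M X Y (R \<bar>t l i' - t k i\<bar>) \<Longrightarrow> prob {\<omega> \<in> space M. X \<omega> > u k \<and> Y \<omega> > u l} \<le> Q"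
    for k l i i' Q
    unfolding A_def using prob_all_greater_pair_le[OF J(1,2) t0 t0 that] J(3) by simp
  have pow_le: "(2 * normal_tail (u k) * x) ^ rhat \<le> p k * (2 ^ rhat * x)" if "0 \<le> x" "x \<le> 1" for k x
  proof -
    have "x ^ rhat \<le> x ^ 1" using that rhat(1) by (intro power_decreasing) auto
    then show ?thesis
      unfolding p_def power_mult_distrib using normal_tail_nonneg[of "u k"]
      by (simp add: mult_left_mono)
  qed

  define c' where "c' = c / (4 * 4 powr \<alpha>)"
  have c': "c' > 0" using c by (simp add: c'_def)
  define e where "e d = exp (- (c' * real d powr \<alpha>))" for d
  have e: "summable e" "\<And>d. e d \<ge> 0" unfolding e_def using summable_exp_powr[OF c' \<alpha>] by auto
  define C1 where "C1 = 2 ^ rhat * (2 * suminf e)"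
  have C1: "C1 \<ge> 0" unfolding C1_def using suminf_nonneg[OF e] by simp
  have same: "q k k \<le> C1 * s k" if k: "k \<ge> k2" for k
  proof -
    \<comment> \<open>Points of one block at index distance \<open>d\<close>: their time distance is \<open>d / (2 * N k)\<close>, so \<open>u\<^sup>2 * (1 - R)\<close> is at least of order \<open>d powr \<alpha>\<close>.\<close>
    have pair_le: "prob (A k i \<inter> A k i') \<le> p k * (2 ^ rhat * e (nat \<bar>int i - int i'\<bar>))" if i: "i < N k" "i' < N k" for i i'
    proof (cases "i = i'")
      case True
      have "p k * 1 \<le> p k * 2 ^ rhat" by (intro mult_left_mono p0) simp
      then show ?thesis using True pA[of k i] by (simp add: e_def)
    next
      case False
      define d where "d = nat \<bar>int i - int i'\<bar>"
      define \<tau> where "\<tau> = \<bar>t k i' - t k i\<bar>"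
      have Nk: "real (N k) > 0" using N(2)[OF k] by simp
      have d: "real d \<ge> 1" using False by (simp add: d_def)
      have \<tau>_eq: "\<tau> = real d / (2 * real (N k))"
        using Nk by (auto simp: \<tau>_def t_def d_def diff_divide_distrib[symmetric] abs_minus_commute)
      have \<tau>: "0 < \<tau>" "\<tau> \<le> 1 / 2"
      proof -
        show "0 < \<tau>" using d Nk by (simp add: \<tau>_eq)
        show "\<tau> \<le> 1 / 2" using t_bounds[OF i(1)] t_bounds[OF i(2)] unfolding \<tau>_def by linarith
      qed
      have uk: "u k \<ge> 1" using k2[OF k] .
      have "(2 * real (N k)) powr \<alpha> \<le> (4 * u k powr (2 / \<alpha>)) powr \<alpha>"
        using N(3)[OF k] \<alpha> by (intro powr_mono2) auto
      also have "\<dots> = 4 powr \<alpha> * (u k)\<^sup>2"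
        using \<alpha> uk by (simp add: powr_mult powr_powr)
      finally have *: "(2 * real (N k)) powr \<alpha> \<le> 4 powr \<alpha> * (u k)\<^sup>2" .
      have "real d powr \<alpha> / 4 powr \<alpha> = (u k)\<^sup>2 * (real d powr \<alpha> / (4 powr \<alpha> * (u k)\<^sup>2))"
        using uk by simp
      also have "\<dots> \<le> (u k)\<^sup>2 * (real d powr \<alpha> / (2 * real (N k)) powr \<alpha>)"
        using * Nk uk by (intro mult_left_mono divide_left_mono) auto
      also have "\<dots> = (u k)\<^sup>2 * \<tau> powr \<alpha>"
        using Nk d by (simp add: \<tau>_eq powr_divide)
      finally have "c * (real d powr \<alpha> / 4 powr \<alpha>) \<le> c * ((u k)\<^sup>2 * \<tau> powr \<alpha>)"
        using c by (intro mult_left_mono) auto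
      also have "\<dots> \<le> (u k)\<^sup>2 * (1 - R \<tau>)"
        using mult_left_mono[OF low[OF \<tau>], of "(u k)\<^sup>2"] by (simp add: mult_ac)
      finally have ex: "c' * real d powr \<alpha> \<le> (u k)\<^sup>2 * (1 - R \<tau>) / 4"
        by (simp add: c'_def)
      have "prob (A k i \<inter> A k i') \<le> (2 * normal_tail (u k) * e d) ^ rhat"
      proof (rule joint)
        fix X Y assume g: "gauss_pair M X Y (R \<bar>t k i' - t k i\<bar>)"
        have "prob {\<omega> \<in> space M. X \<omega> > u k \<and> Y \<omega> > u k} \<le> 2 * normal_tail (u k) * exp (- ((u k)\<^sup>2 * (1 - R \<tau>)) / 4)"
          using gauss_pair_joint[OF g, of "u k"] uk by (simp add: \<tau>_def)
        also have "\<dots> \<le> 2 * normal_tail (u k) * e d"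
          unfolding e_def using ex by (intro mult_left_mono) (auto simp: normal_tail_nonneg)
        finally show "prob {\<omega> \<in> space M. X \<omega> > u k \<and> Y \<omega> > u k} \<le> 2 * normal_tail (u k) * e d" .
      qed
      also have "\<dots> \<le> p k * (2 ^ rhat * e d)"
        by (rule pow_le) (use c' in \<open>auto simp: e_def\<close>)
      finally show ?thesis by (simp add: d_def)
    qed
    have "q k k \<le> (\<Sum>i<N k. \<Sum>i'<N k. p k * (2 ^ rhat * e (nat \<bar>int i - int i'\<bar>)))"
      unfolding q_def by (intro sum_mono pair_le) auto
    also have "\<dots> = (\<Sum>i<N k. p k * (2 ^ rhat * (\<Sum>i'<N k. e (nat \<bar>int i - int i'\<bar>))))"
      by (simp only: sum_distrib_left)
    also have "\<dots> \<le> (\<Sum>i<N k. p k * (2 ^ rhat * (2 * suminf e)))"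
      by (intro sum_mono mult_left_mono sum_abs_diff_le_suminf e p0) auto
    also have "\<dots> = C1 * s k" by (simp add: C1_def s_def)
    finally show ?thesis .
  qed

  have cross: "prob (A k i \<inter> A l i') \<le> p k * (2 ^ rhat * real k powr (- 2 * \<beta>))"
    if k: "k \<ge> max k2 (max k1 1)" "k < l" and i: "i < N k" "i' < N l" for k l i i'
  proof -
    have kl: "real k + 1 \<le> real l" using k(2) by linarith
    have \<tau>: "1 / 2 \<le> \<bar>t l i' - t k i\<bar>"
      using t_bounds[OF i(1)] t_bounds[OF i(2)] kl by simp
    have uk: "u k \<ge> 1" using k2 k(1) by simp
    have "prob (A k i \<inter> A l i') \<le> (2 * normal_tail (u k) * real k powr (- 2 * \<beta>)) ^ rhat"
    proof (rule joint)
      fix X Y assume g: "gauss_pair M X Y (R \<bar>t l i' - t k i\<bar>)"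
      note [measurable] = gauss_pairD(1,2)[OF g]
      have "prob {\<omega> \<in> space M. X \<omega> > u k \<and> Y \<omega> > u l} \<le> prob {\<omega> \<in> space M. X \<omega> > u k \<and> Y \<omega> > u k}"
        by (rule finite_measure_mono) (use mono[of k l] k in auto)
      also have "\<dots> \<le> 2 * normal_tail (u k) * exp (- ((u k)\<^sup>2 * (1 - R \<bar>t l i' - t k i\<bar>)) / 4)"
        by (rule gauss_pair_joint[OF g]) (use uk in simp)
      also have "\<dots> \<le> 2 * normal_tail (u k) * real k powr (- 2 * \<beta>)"
      proof (rule mult_left_mono)
        have "2 * \<beta> * ln (real k) \<le> (\<kappa> * a / 4) * ln (real k)"
          using \<beta>(3) k by (intro mult_right_mono) auto
        also have "\<dots> = (a * ln (real k)) * \<kappa> / 4" by simp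
        also have "\<dots> \<le> (u k)\<^sup>2 * \<kappa> / 4"
          using a(2)[of k] k \<kappa> by (intro divide_right_mono mult_right_mono) auto
        also have "\<dots> \<le> (u k)\<^sup>2 * (1 - R \<bar>t l i' - t k i\<bar>) / 4"
          using sup[OF \<tau>] by (intro divide_right_mono mult_left_mono) auto
        finally have "- ((u k)\<^sup>2 * (1 - R \<bar>t l i' - t k i\<bar>)) / 4 \<le> - 2 * \<beta> * ln (real k)"
          by simp
        moreover have "real k powr (- 2 * \<beta>) = exp (- 2 * \<beta> * ln (real k))"
          using k by (simp add: powr_def)
        ultimately show "exp (- ((u k)\<^sup>2 * (1 - R \<bar>t l i' - t k i\<bar>)) / 4) \<le> real k powr (- 2 * \<beta>)"
          by simp
      qed (simp add: normal_tail_nonneg)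
      finally show "prob {\<omega> \<in> space M. X \<omega> > u k \<and> Y \<omega> > u l} \<le> 2 * normal_tail (u k) * real k powr (- 2 * \<beta>)" .
    qed
    also have "\<dots> \<le> p k * (2 ^ rhat * real k powr (- 2 * \<beta>))"
    proof (rule pow_le)
      have "real k powr (- 2 * \<beta>) \<le> real k powr 0"
        using k \<beta> by (intro powr_mono) auto
      then show "real k powr (- 2 * \<beta>) \<le> 1" using k by simp
    qed simp
    finally show ?thesis .
  qed

  define near where "near k l \<longleftrightarrow> k < l \<and> real l \<le> real k + real k powr \<beta>" for k l :: nat
  obtain k4 where k4: "\<And>k F. k \<ge> k4 \<Longrightarrow> finite F \<Longrightarrow>
      (\<Sum>l\<in>{l \<in> F. near k l}. real (N l) * (2 ^ rhat * real k powr (- 2 * \<beta>))) \<le> 1"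
  proof -
    define w where "w = (2 :: real) ^ rhat"
    have w: "w > 0" by (simp add: w_def)
    have "((\<lambda>x. x powr \<beta> * (2 * (b * ln (2 * x)) powr (1 / \<alpha>) * (w * x powr (- 2 * \<beta>)))) \<longlongrightarrow> 0) at_top"
      using w \<beta>(1) b(1) \<alpha> by real_asymp
    then have "\<forall>\<^sub>F x in at_top. x powr \<beta> * (2 * (b * ln (2 * x)) powr (1 / \<alpha>) * (w * x powr (- 2 * \<beta>))) < 1"
      by (rule order_tendstoD(2)) simp
    then obtain x0 where x0: "\<And>x. x \<ge> x0 \<Longrightarrow> x powr \<beta> * (2 * (b * ln (2 * x)) powr (1 / \<alpha>) * (w * x powr (- 2 * \<beta>))) < 1"
      unfolding eventually_at_top_linorder by blast
    show thesis
    proof (rule that)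
      fix k :: nat and F :: "nat set" assume k: "k \<ge> max (nat \<lceil>x0\<rceil>) (max k2 (max k1 1))" and F: "finite F"
      let ?x = "real k"
      have kx: "?x \<ge> x0" "?x \<ge> 1" using k by (auto simp: nat_ceiling_le_eq)
      have pb: "?x powr \<beta> \<le> ?x" using kx \<beta> powr_mono[of \<beta> 1 ?x] by simp
      have Nl: "real (N l) \<le> 2 * (b * ln (2 * ?x)) powr (1 / \<alpha>)" if "near k l" for l
      proof -
        have l: "k \<le> l" "real l \<le> 2 * ?x" using that pb by (auto simp: near_def)
        have "u l powr (2 / \<alpha>) = ((u l)\<^sup>2) powr (1 / \<alpha>)"
          using k2[of l] l k by (simp add: powr_powr powr_realpow[symmetric] flip: powr_numeral)
        also have "\<dots> \<le> (b * ln (2 * ?x)) powr (1 / \<alpha>)"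
        proof (rule powr_mono2)
          have "(u l)\<^sup>2 \<le> b * ln (real l)" using b(2)[of l] l k by simp
          also have "\<dots> \<le> b * ln (2 * ?x)" using l kx b(1) by (intro mult_left_mono) auto
          finally show "(u l)\<^sup>2 \<le> b * ln (2 * ?x)" .
        qed (use \<alpha> in auto)
        finally show ?thesis using N(3)[of l] l k by simp
      qed
      have card: "real (card {l \<in> F. near k l}) \<le> ?x powr \<beta>"
      proof -
        have "{l \<in> F. near k l} \<subseteq> {k<..k + nat \<lfloor>?x powr \<beta>\<rfloor>}"
        proof
          fix l assume "l \<in> {l \<in> F. near k l}"
          then have l: "k < l" "real (l - k) \<le> ?x powr \<beta>" by (auto simp: near_def of_nat_diff)
          then have "l - k \<le> nat \<lfloor>?x powr \<beta>\<rfloor>" by (simp add: le_nat_floor)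
          then show "l \<in> {k<..k + nat \<lfloor>?x powr \<beta>\<rfloor>}" using l by auto
        qed
        then have "card {l \<in> F. near k l} \<le> card {k<..k + nat \<lfloor>?x powr \<beta>\<rfloor>}"
          by (intro card_mono) auto
        also have "\<dots> = nat \<lfloor>?x powr \<beta>\<rfloor>" by simp
        finally have "real (card {l \<in> F. near k l}) \<le> real (nat \<lfloor>?x powr \<beta>\<rfloor>)" by (simp only: of_nat_le_iff)
        also have "\<dots> \<le> ?x powr \<beta>" by simp
        finally show ?thesis .
      qed
      have "(\<Sum>l\<in>{l \<in> F. near k l}. real (N l) * (2 ^ rhat * real k powr (- 2 * \<beta>))) \<le>
          (\<Sum>l\<in>{l \<in> F. near k l}. 2 * (b * ln (2 * ?x)) powr (1 / \<alpha>) * (w * ?x powr (- 2 * \<beta>)))"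
        unfolding w_def using Nl by (intro sum_mono mult_right_mono) auto
      also have "\<dots> = real (card {l \<in> F. near k l}) * (2 * (b * ln (2 * ?x)) powr (1 / \<alpha>) * (w * ?x powr (- 2 * \<beta>)))"
        by simp
      also have "\<dots> \<le> ?x powr \<beta> * (2 * (b * ln (2 * ?x)) powr (1 / \<alpha>) * (w * ?x powr (- 2 * \<beta>)))"
        using card w by (intro mult_right_mono) auto
      also have "\<dots> \<le> 1" using x0[OF kx(1)] by simp
      finally show "(\<Sum>l\<in>{l \<in> F. near k l}. real (N l) * (2 ^ rhat * real k powr (- 2 * \<beta>))) \<le> 1" .
    qed
  qed

  have far: "\<exists>k3. \<forall>k\<ge>k3. \<forall>l i i'. k < l \<longrightarrow> \<not> near k l \<longrightarrow> i < N k \<longrightarrow> i' < N l \<longrightarrow>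
      prob (A k i \<inter> A l i') \<le> (1 + \<eta>) * (p k * p l)" if \<eta>: "\<eta> > 0" for \<eta>
  proof -
    have "((\<lambda>x::real. (1 + x) ^ rhat) \<longlongrightarrow> (1 + 0) ^ rhat) (at_right 0)"
      by (intro tendsto_intros)
    then have "\<forall>\<^sub>F x in at_right 0. (1 + x) ^ rhat < 1 + \<eta>"
      using \<eta> by (intro order_tendstoD(2)) auto
    then obtain x1 :: real where "x1 > 0" "\<And>x. 0 < x \<Longrightarrow> x < x1 \<Longrightarrow> (1 + x) ^ rhat < 1 + \<eta>"
      unfolding eventually_at_right_field by blast
    then obtain \<eta>' :: real where \<eta>': "\<eta>' > 0" "(1 + \<eta>') ^ rhat < 1 + \<eta>"
      using dense by metis
    obtain \<epsilon> V where \<epsilon>: "\<epsilon> > 0" "V \<ge> 1"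
      "\<And>X Y \<rho> u v. gauss_pair M X Y \<rho> \<Longrightarrow> 1 \<le> u \<Longrightarrow> u \<le> v \<Longrightarrow> V \<le> v \<Longrightarrow> \<bar>\<rho>\<bar> * v\<^sup>2 \<le> \<epsilon> \<Longrightarrow>
        prob {\<omega> \<in> space M. X \<omega> > u \<and> Y \<omega> > v} \<le> (1 + \<eta>') * (normal_tail u * normal_tail v)"
      using gauss_pair_asymp_indep[OF \<eta>'(1)] by blast
    have "((\<lambda>d. D * (d / 2) powr (- 2 * lam) * (b * ln (2 * d powr (1 / \<beta>)))) \<longlongrightarrow> 0) at_top"
      using D lam b(1) \<beta>(1) by real_asymp
    then have "\<forall>\<^sub>F d in at_top. D * (d / 2) powr (- 2 * lam) * (b * ln (2 * d powr (1 / \<beta>))) < \<epsilon>"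
      by (rule order_tendstoD(2)) (use \<epsilon> in simp)
    then obtain d0 where d0: "\<And>d. d \<ge> d0 \<Longrightarrow> D * (d / 2) powr (- 2 * lam) * (b * ln (2 * d powr (1 / \<beta>))) < \<epsilon>"
      unfolding eventually_at_top_linorder by blast
    have "filterlim (\<lambda>k. real k powr \<beta>) at_top sequentially"
      using \<beta>(1) by real_asymp
    then have "\<forall>\<^sub>F k in sequentially. real k powr \<beta> \<ge> max d0 (max 1 (2 * T0)) \<and> u k \<ge> V"
      using lim unfolding filterlim_at_top by (intro eventually_conj) blast+
    then obtain k5 where k5: "\<And>k. k \<ge> k5 \<Longrightarrow> real k powr \<beta> \<ge> max d0 (max 1 (2 * T0)) \<and> u k \<ge> V"
      unfolding eventually_sequentially by blast
    show ?thesis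
    proof (intro exI[of _ "max k5 (max k2 (max k1 1))"] allI impI)
      fix k l i i' assume k: "max k5 (max k2 (max k1 1)) \<le> k" and l: "k < l" "\<not> near k l" and i: "i < N k" "i' < N l"
      \<comment> \<open>For blocks that are not near, \<open>l\<close> is at most polynomial in the distance \<open>d\<close>. So \<open>ln l\<close>, and with it \<open>(u l)\<^sup>2\<close>, is of order \<open>ln d\<close>, which the decay of \<open>R\<close> outweighs.\<close>
      define d where "d = real l - real k"
      have dk: "d > real k powr \<beta>" using l by (auto simp: near_def d_def)
      then have d: "d \<ge> d0" "d \<ge> 1" "d \<ge> 2 * T0" using k5[of k] k by auto
      have k_le: "real k \<le> d powr (1 / \<beta>)"
      proof -
        have "real k = (real k powr \<beta>) powr (1 / \<beta>)" using \<beta> k by (simp add: powr_powr)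
        also have "\<dots> \<le> d powr (1 / \<beta>)" using dk \<beta> by (intro powr_mono2) auto
        finally show ?thesis .
      qed
      have "d \<le> d powr (1 / \<beta>)"
        using d(2) \<beta> powr_mono[of 1 "1 / \<beta>" d] by simp
      then have l_le: "real l \<le> 2 * d powr (1 / \<beta>)" using k_le by (simp add: d_def)
      define \<tau> where "\<tau> = \<bar>t l i' - t k i\<bar>"
      have \<tau>: "\<tau> \<ge> d / 2"
      proof -
        have "real l - real k \<ge> 1" using d(2) by (simp add: d_def)
        then have "t l i' - t k i \<ge> (real l - real k) / 2"
          using t_bounds(2)[OF i(1)] t_bounds(1)[OF i(2)] by (simp add: field_simps)
        then show ?thesis unfolding \<tau>_def d_def by linarith
      qed
      have "\<bar>R \<tau>\<bar> * (u l)\<^sup>2 \<le> (D * \<tau> powr (- 2 * lam)) * (b * ln (real l))"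
        using decay[of \<tau>] \<tau> d(3) b(2)[of l] k l D by (intro mult_mono) auto
      also have "\<dots> \<le> (D * (d / 2) powr (- 2 * lam)) * (b * ln (2 * d powr (1 / \<beta>)))"
        using D \<tau> d lam b(1) l l_le
        by (intro mult_mono mult_left_mono powr_mono2') auto
      also have "\<dots> < \<epsilon>" using d0[OF d(1)] .
      finally have small: "\<bar>R \<tau>\<bar> * (u l)\<^sup>2 \<le> \<epsilon>" by simp
      have ukl: "u k \<le> u l" "u k \<ge> 1" "u l \<ge> V" using mono[of k l] k l k2[of k] k5[of l] by auto
      have "prob (A k i \<inter> A l i') \<le> ((1 + \<eta>') * (normal_tail (u k) * normal_tail (u l))) ^ rhat"
        by (rule joint, rule \<epsilon>(3)) (use ukl small in \<open>auto simp: \<tau>_def\<close>)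
      also have "\<dots> = (1 + \<eta>') ^ rhat * (p k * p l)"
        by (simp add: p_def power_mult_distrib)
      also have "\<dots> \<le> (1 + \<eta>) * (p k * p l)"
        using \<eta>' p0 by (intro mult_right_mono) auto
      finally show "prob (A k i \<inter> A l i') \<le> (1 + \<eta>) * (p k * p l)" .
    qed
  qed

  have q_sym: "q k l = q l k" for k l
    unfolding q_def by (subst sum.swap) (simp add: Int_commute)
  \<comment> \<open>The surplus of a nearby pair of blocks over the product of their means; it vanishes unless \<open>k < l\<close>.\<close>
  define g where "g k l = (if near k l then s k * (real (N l) * (2 ^ rhat * real k powr (- 2 * \<beta>))) else 0)" for k l
  have g0: "g k l \<ge> 0" for k l by (simp add: g_def s0)

  have none: "\<exists>k0. \<forall>k'\<ge>k0. prob (space M - (\<Union>k\<in>{k'..}. \<Union>i<N k. A k i)) \<le> \<eta>" if \<eta>: "\<eta> > 0" for \<eta>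
  proof -
    have "\<eta> / 2 > 0" using \<eta> by simp
    from far[OF this] obtain k3 where k3: "\<And>k l i i'. k \<ge> k3 \<Longrightarrow> k < l \<Longrightarrow> \<not> near k l \<Longrightarrow> i < N k \<Longrightarrow> i' < N l \<Longrightarrow>
        prob (A k i \<inter> A l i') \<le> (1 + \<eta> / 2) * (p k * p l)"
      by blast
    define k0 where "k0 = Max {k1, k2, k3, k4, 1}"
    have k0: "k1 \<le> k0" "k2 \<le> k0" "k3 \<le> k0" "k4 \<le> k0" "1 \<le> k0" by (auto simp: k0_def)
    have q_less: "q k l \<le> (1 + \<eta> / 2) * (s k * s l) + g k l" if k: "k \<ge> k0" "k < l" for k l
    proof (cases "near k l")
      case True
      have "q k l \<le> (\<Sum>i<N k. \<Sum>i'<N l. p k * (2 ^ rhat * real k powr (- 2 * \<beta>)))"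
        unfolding q_def using k k0 by (intro sum_mono cross) auto
      also have "\<dots> = g k l" using True by (simp add: g_def s_def)
      also have "\<dots> \<le> (1 + \<eta> / 2) * (s k * s l) + g k l"
        using \<eta> s0 by simp
      finally show ?thesis .
    next
      case False
      have "q k l \<le> (\<Sum>i<N k. \<Sum>i'<N l. (1 + \<eta> / 2) * (p k * p l))"
        unfolding q_def using k k0 False by (intro sum_mono k3) auto
      also have "\<dots> = (1 + \<eta> / 2) * (s k * s l)" by (simp add: s_def)
      also have "\<dots> \<le> (1 + \<eta> / 2) * (s k * s l) + g k l" using g0 by simp
      finally show ?thesis .
    qed
    have q_le: "q k l \<le> (1 + \<eta> / 2) * (s k * s l) + (g k l + (g l k + (if k = l then C1 * s k else 0)))"
      if "k \<ge> k0" "l \<ge> k0" for k l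
    proof (cases k l rule: linorder_cases)
      case less
      then show ?thesis using q_less[of k l] that g0[of l k] by simp
    next
      case equal
      have "0 \<le> (1 + \<eta> / 2) * (s k * s l)" using \<eta> s0 by simp
      then show ?thesis using equal same[of k] that k0 g0[of k l] g0[of l k] by simp
    next
      case greater
      then show ?thesis using q_less[of l k] q_sym[of k l] that g0[of k l] by (simp add: mult_ac)
    qed
    have "prob (space M - (\<Union>k\<in>{k'..}. \<Union>i<N k. A k i)) \<le> \<eta>" if k': "k' \<ge> k0" for k'
    proof -
      have "\<not> summable s"
      proof
        assume "summable s"
        then have "summable (\<lambda>k. u k powr (2 / \<alpha>) * normal_tail (u k) ^ rhat)"
        proof (rule summable_comparison_test'[where N = k2])
          fix k assume "k \<ge> k2"
          then show "norm (u k powr (2 / \<alpha>) * normal_tail (u k) ^ rhat) \<le> s k"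
            using N(1)[of k] by (auto simp: s_def p_def normal_tail_nonneg intro!: mult_right_mono)
        qed
        with div show False by contradiction
      qed
      then have "\<not> summable (\<lambda>k. s (k + k'))" using summable_iff_shift[of s k'] by simp
      have unb: "\<exists>K. (\<Sum>k<K. s (k + k')) > B" for B
      proof (rule ccontr)
        assume "\<nexists>K. (\<Sum>k<K. s (k + k')) > B"
        then have "(\<Sum>k\<le>K. s (k + k')) \<le> B" for K
          unfolding lessThan_Suc_atMost[symmetric] by (simp add: not_less del: lessThan_Suc sum.lessThan_Suc)
        then have "summable (\<lambda>k. s (k + k'))"
          using s0 by (intro bounded_imp_summable) auto
        with \<open>\<not> summable (\<lambda>k. s (k + k'))\<close> show False by contradiction
      qed
      obtain K where K: "(\<Sum>k<K. s (k + k')) > 2 * (2 + C1) / \<eta>" using unb by blast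
      define F where "F = {k'..<k' + K}"
      define I where "I = (SIGMA k:F. {..<N k})"
      define S where "S = (\<Sum>k\<in>F. s k)"
      have "S = (\<Sum>k<K. s (k + k'))"
        unfolding S_def F_def by (rule sum.reindex_bij_witness[of _ "\<lambda>k. k + k'" "\<lambda>k. k - k'"]) auto
      with K have S: "S > 2 * (2 + C1) / \<eta>" by simp
      moreover have "2 * (2 + C1) / \<eta> > 0" using \<eta> C1 by simp
      ultimately have S0: "S > 0" by linarith
      have sumI: "(\<Sum>x\<in>I. G (fst x) (snd x)) = (\<Sum>k\<in>F. \<Sum>i<N k. G k i)" for G :: "nat \<Rightarrow> nat \<Rightarrow> real"
        unfolding I_def by (subst sum.Sigma) (auto simp: F_def case_prod_beta)
      have "prob (space M - (\<Union>x\<in>I. A (fst x) (snd x))) \<le> \<eta> / 2 + (2 + C1) / S"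
      proof (rule prob_none_le_second_moment)
        show "finite I" by (simp add: I_def F_def)
        show "A (fst x) (snd x) \<in> events" for x by simp
        show "S = (\<Sum>x\<in>I. prob (A (fst x) (snd x)))"
          by (simp only: sumI[of "\<lambda>k i. prob (A k i)"]) (simp add: S_def pA s_def)
        have "(\<Sum>x\<in>I. \<Sum>y\<in>I. prob (A (fst x) (snd x) \<inter> A (fst y) (snd y))) =
            (\<Sum>k\<in>F. \<Sum>i<N k. \<Sum>l\<in>F. \<Sum>i'<N l. prob (A k i \<inter> A l i'))"
          by (simp only: sumI[of "\<lambda>l i'. prob (A k i \<inter> A l i')" for k i]
              sumI[of "\<lambda>k i. \<Sum>l\<in>F. \<Sum>i'<N l. prob (A k i \<inter> A l i')"])
        also have "\<dots> = (\<Sum>k\<in>F. \<Sum>l\<in>F. q k l)"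
          unfolding q_def by (intro sum.cong refl sum.swap)
        also have "\<dots> \<le> (\<Sum>k\<in>F. \<Sum>l\<in>F. (1 + \<eta> / 2) * (s k * s l) + (g k l + (g l k + (if k = l then C1 * s k else 0))))"
          using k' by (intro sum_mono q_le) (auto simp: F_def)
        also have "\<dots> = (1 + \<eta> / 2) * S\<^sup>2 + ((\<Sum>k\<in>F. \<Sum>l\<in>F. g k l) + ((\<Sum>k\<in>F. \<Sum>l\<in>F. g l k) + C1 * S))"
          by (simp add: sum.distrib sum_distrib_left[symmetric] S_def power2_eq_square sum_product F_def)
        also have "(\<Sum>k\<in>F. \<Sum>l\<in>F. g l k) = (\<Sum>k\<in>F. \<Sum>l\<in>F. g k l)"
          by (rule sum.swap)
        also have "(1 + \<eta> / 2) * S\<^sup>2 + ((\<Sum>k\<in>F. \<Sum>l\<in>F. g k l) + ((\<Sum>k\<in>F. \<Sum>l\<in>F. g k l) + C1 * S)) \<le> (1 + \<eta> / 2) * S\<^sup>2 + (2 + C1) * S"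
        proof -
          have "(\<Sum>k\<in>F. \<Sum>l\<in>F. g k l) \<le> (\<Sum>k\<in>F. s k * 1)"
          proof (rule sum_mono)
            fix k assume "k \<in> F"
            then have k: "k \<ge> k4" using k' k0 by (simp add: F_def)
            have "(\<Sum>l\<in>F. g k l) = (\<Sum>l\<in>{l \<in> F. near k l}. s k * (real (N l) * (2 ^ rhat * real k powr (- 2 * \<beta>))))"
              unfolding g_def by (rule sum.inter_filter[symmetric]) (simp add: F_def)
            also have "\<dots> = s k * (\<Sum>l\<in>{l \<in> F. near k l}. real (N l) * (2 ^ rhat * real k powr (- 2 * \<beta>)))"
              by (simp only: sum_distrib_left)
            also have "\<dots> \<le> s k * 1"
              by (intro mult_left_mono k4 k s0) (simp add: F_def)
            finally show "(\<Sum>l\<in>F. g k l) \<le> s k * 1" .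
          qed
          then show ?thesis by (simp add: S_def algebra_simps)
        qed
        finally show "(\<Sum>x\<in>I. \<Sum>y\<in>I. prob (A (fst x) (snd x) \<inter> A (fst y) (snd y)))
            \<le> (1 + \<eta> / 2) * S\<^sup>2 + (2 + C1) * S" .
      qed (rule S0)
      also have "\<dots> \<le> \<eta> / 2 + \<eta> / 2"
        using S S0 \<eta> by (simp add: field_simps)
      finally have *: "prob (space M - (\<Union>x\<in>I. A (fst x) (snd x))) \<le> \<eta>" by simp
      have "prob (space M - (\<Union>k\<in>{k'..}. \<Union>i<N k. A k i)) \<le> prob (space M - (\<Union>x\<in>I. A (fst x) (snd x)))"
      proof (rule finite_measure_mono)
        show "space M - (\<Union>k\<in>{k'..}. \<Union>i<N k. A k i) \<subseteq> space M - (\<Union>x\<in>I. A (fst x) (snd x))"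
          by (auto simp: I_def F_def)
        show "space M - (\<Union>x\<in>I. A (fst x) (snd x)) \<in> events"
          by (intro sets.Diff sets.finite_UN sets.top) (auto simp: I_def F_def)
      qed
      with * show ?thesis by linarith
    qed
    then show ?thesis by blast
  qed

  have mU: "space M - (\<Union>k\<in>{k'..}. \<Union>i<N k. A k i) \<in> events" for k'
    by (intro sets.Diff sets.top sets.countable_UN' sets.finite_UN) auto
  have none0: "prob (space M - (\<Union>k\<in>{k'..}. \<Union>i<N k. A k i)) = 0" for k'
  proof (rule antisym[OF field_le_epsilon])
    fix \<eta> :: real assume "\<eta> > 0"
    from none[OF this] obtain k0 where
      k0: "\<And>k'. k' \<ge> k0 \<Longrightarrow> prob (space M - (\<Union>k\<in>{k'..}. \<Union>i<N k. A k i)) \<le> \<eta>" by blast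
    have "prob (space M - (\<Union>k\<in>{k'..}. \<Union>i<N k. A k i)) \<le> prob (space M - (\<Union>k\<in>{max k' k0..}. \<Union>i<N k. A k i))"
      by (rule finite_measure_mono) (auto intro!: mU)
    also have "\<dots> \<le> \<eta>" by (rule k0) simp
    finally show "prob (space M - (\<Union>k\<in>{k'..}. \<Union>i<N k. A k i)) \<le> 0 + \<eta>" by simp
  qed simp
  have "AE \<omega> in M. \<forall>k'. \<omega> \<notin> space M - (\<Union>k\<in>{k'..}. \<Union>i<N k. A k i)"
    unfolding AE_all_countable
  proof
    fix k'
    have "space M - (\<Union>k\<in>{k'..}. \<Union>i<N k. A k i) \<in> null_sets M"
      using none0[of k'] by (intro null_setsI mU) (simp add: emeasure_eq_measure)
    then show "AE \<omega> in M. \<omega> \<notin> space M - (\<Union>k\<in>{k'..}. \<Union>i<N k. A k i)"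
      by (rule AE_not_in)
  qed
  then show ?thesis
    using AE_space
  proof eventually_elim
    case (elim \<omega>)
    show ?case unfolding frequently_sequentially
    proof
      fix k'
      show "\<exists>k\<ge>k'. \<exists>t\<in>{real k..real k + 1 / 2}. order_stat_process r n Xs t \<omega> > u k"
      proof -
        obtain k i where k: "k \<ge> k'" "i < N k" "\<omega> \<in> A k i" using elim by fastforce
        have "order_stat_process r n Xs (t k i) \<omega> > u k"
          unfolding order_stat_greater_iff[OF r] rhat_def[symmetric] using J k(3) by (auto simp: A_def)
        then show ?thesis using k t_bounds by (intro exI[of _ k] conjI bexI[of _ "t k i"]) auto
      qed
    qed
  qed
qed

end

section \<open>The thresholds and the Bertrand series\<close>

text \<open>
  Cauchy condensation turns the series into a multiple of the sum of \<open>n powr (- a)\<close>. The sequence is frozen below 2, since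
  the value 0 at \<open>k = 1\<close> would spoil monotonicity.
\<close>

lemma summable_bertrand_iff:
  fixes a :: real
  assumes a: "a > 0"
  shows "summable (\<lambda>k. 1 / real k * ln (real k) powr (- a)) \<longleftrightarrow> a > 1"
proof -
  define f where "f k = 1 / max 2 (real k) * ln (max 2 (real k)) powr (- a)" for k :: nat
  have "summable (\<lambda>k. 1 / real k * ln (real k) powr (- a)) \<longleftrightarrow> summable f"
    by (rule summable_cong) (use eventually_ge_at_top[of 2] in eventually_elim, simp add: f_def max_def)
  also have "\<dots> \<longleftrightarrow> summable (\<lambda>n. 2 ^ n * f (2 ^ n))"
  proof (rule condensation_test)
    show "f (Suc k) \<le> f k" for k
      unfolding f_def using a
      by (intro mult_mono divide_left_mono powr_mono2' ln_mono) auto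
  qed (simp add: f_def)
  also have "\<dots> \<longleftrightarrow> summable (\<lambda>n. ln 2 powr (- a) * real n powr (- a))"
  proof (rule summable_cong, use eventually_ge_at_top[of 1] in eventually_elim)
    case (elim k)
    then have "(2 :: real) ^ 1 \<le> 2 ^ k" by (intro power_increasing) auto
    then have "max 2 (real (2 ^ k)) = 2 ^ k" by simp
    then show ?case by (simp add: f_def ln_realpow powr_mult mult.commute)
  qed
  also have "\<dots> \<longleftrightarrow> summable (\<lambda>n. real n powr (- a))"
    by (subst summable_cmult_iff) simp
  also have "\<dots> \<longleftrightarrow> a > 1"
    by (simp add: summable_real_powr_iff)
  finally show ?thesis .
qed

context
  fixes \<alpha> :: real and r n m :: nat
  assumes \<alpha>: "\<alpha> > 0" and m: "m \<ge> 1" "r_hat r n = real m"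
begin

lemma threshold_sq_ratio: "((\<lambda>s. threshold_sq \<alpha> r n p s / ln s) \<longlongrightarrow> 2 / real m) at_top"
proof -
  define c where "c = (2 - real m * \<alpha>) / (2 * \<alpha>) + 1 - p"
  have "((\<lambda>s. 2 / real m * (1 + c * (ln (ln s) / ln s))) \<longlongrightarrow> 2 / real m * (1 + c * 0)) at_top"
    by (intro tendsto_intros) real_asymp
  moreover have "\<forall>\<^sub>F s in at_top. 2 / real m * (1 + c * (ln (ln s) / ln s)) = threshold_sq \<alpha> r n p s / ln s"
    using eventually_gt_at_top[of "1 :: real"]
    by eventually_elim (simp add: threshold_sq_def m(2) c_def field_simps)
  ultimately show ?thesis
    by (simp add: tendsto_cong)
qed

lemma filterlim_threshold_sq: "filterlim (threshold_sq \<alpha> r n p) at_top at_top"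
proof -
  have "filterlim (\<lambda>s. (threshold_sq \<alpha> r n p s / ln s) * ln s) at_top at_top"
    by (rule filterlim_tendsto_pos_mult_at_top[OF threshold_sq_ratio]) (use m ln_at_top in auto)
  moreover have "\<forall>\<^sub>F s in at_top. (threshold_sq \<alpha> r n p s / ln s) * ln s = threshold_sq \<alpha> r n p s"
    using eventually_gt_at_top[of "1 :: real"] by eventually_elim simp
  ultimately show ?thesis
    by (subst (asm) filterlim_cong[OF refl refl]) auto
qed

lemma filterlim_threshold: "filterlim (threshold \<alpha> r n p) at_top at_top"
  unfolding threshold_def[abs_def] by (rule filterlim_compose[OF sqrt_at_top filterlim_threshold_sq])

lemma threshold_ratio: "((\<lambda>s. threshold \<alpha> r n p s / sqrt (ln s)) \<longlongrightarrow> sqrt (2 / real m)) at_top"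
  using tendsto_real_sqrt[OF threshold_sq_ratio[of p]] by (simp add: threshold_def real_sqrt_divide)

text \<open>
  With \<open>ln (ln t) - ln (ln s) \<le> (ln t - ln s) / ln s\<close> the iterated logarithm grows too slowly to
  compensate the growth of \<open>ln s\<close>, whatever the sign of its coefficient.
\<close>

lemma threshold_mono: obtains s0 where "s0 > 1" "\<And>s t. s0 \<le> s \<Longrightarrow> s \<le> t \<Longrightarrow> threshold \<alpha> r n p s \<le> threshold \<alpha> r n p t"
proof -
  define c where "c = (2 - real m * \<alpha>) / (2 * \<alpha>) + 1 - p"
  show thesis
  proof (rule that[of "exp (\<bar>c\<bar> + 1)"])
    fix s t :: real assume s: "exp (\<bar>c\<bar> + 1) \<le> s" and st: "s \<le> t"
    have s0: "s > 0" using s by (rule less_le_trans[rotated]) simp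
    have Ls: "ln s \<ge> \<bar>c\<bar> + 1" using s s0 by (simp add: ln_ge_iff)
    have Lst: "ln s \<le> ln t" using s0 st by simp
    have "ln (ln t) - ln (ln s) = ln (ln t / ln s)"
      using Ls Lst by (subst ln_div) auto
    also have "\<dots> \<le> ln t / ln s - 1"
      using Ls Lst by (intro ln_le_minus_one) auto
    also have "\<dots> = (ln t - ln s) / ln s" using Ls by (simp add: field_simps)
    finally have d: "ln (ln t) - ln (ln s) \<le> (ln t - ln s) / ln s" .
    have d0: "0 \<le> ln (ln t) - ln (ln s)" using Ls Lst by auto
    have "\<bar>c\<bar> * (ln (ln t) - ln (ln s)) \<le> ln s * ((ln t - ln s) / ln s)"
      using d d0 Ls by (intro mult_mono) auto
    also have "\<dots> = ln t - ln s" using Ls by simp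
    finally have "\<bar>c\<bar> * (ln (ln t) - ln (ln s)) \<le> ln t - ln s" .
    moreover have "- c * (ln (ln t) - ln (ln s)) \<le> \<bar>c\<bar> * (ln (ln t) - ln (ln s))"
      using d0 by (intro mult_right_mono) auto
    ultimately have "ln s + c * ln (ln s) \<le> ln t + c * ln (ln t)"
      by (simp add: algebra_simps)
    then show "threshold \<alpha> r n p s \<le> threshold \<alpha> r n p t"
      unfolding threshold_def threshold_sq_def m(2) c_def[symmetric]
      by (intro real_sqrt_le_mono mult_left_mono) auto
  qed simp
qed

lemma threshold_antimono_exponent:
  assumes "p \<ge> p'" "s \<ge> exp 1"
  shows "threshold \<alpha> r n p s \<le> threshold \<alpha> r n p' s"
proof -
  have "s > 0" using assms(2) by (rule less_le_trans[rotated]) simp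
  then have "ln s \<ge> 1" using assms(2) by (simp add: ln_ge_iff)
  then have "ln (ln s) \<ge> 0" by simp
  then show ?thesis
    unfolding threshold_def threshold_sq_def m(2) using assms(1)
    by (intro real_sqrt_le_mono mult_left_mono add_left_mono mult_right_mono) auto
qed

lemma threshold_sq_eq: "threshold_sq \<alpha> r n p s > 0 \<Longrightarrow> (threshold \<alpha> r n p s)\<^sup>2 = threshold_sq \<alpha> r n p s"
  by (simp add: threshold_def)

text \<open>
  The coefficient of the iterated logarithm in the threshold is chosen so that this identity leaves exactly the exponent \<open>p - 1\<close>:
  the part \<open>1 / \<alpha> - m / 2\<close> cancels the powers of \<open>u\<close> that come from the number of pieces and from the
  tails.
\<close>

lemma rate_eq:
  assumes s: "s > 1" and T: "threshold_sq \<alpha> r n p s > 0"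
  defines "u \<equiv> threshold \<alpha> r n p s"
  shows "u powr (2 / \<alpha>) * (exp (- u\<^sup>2 / 2) / u) ^ m =
    (threshold_sq \<alpha> r n p s / ln s) powr (1 / \<alpha> - real m / 2) * (1 / s * ln s powr (p - 1))"
proof -
  define T where "T = threshold_sq \<alpha> r n p s"
  define c where "c = (2 - real m * \<alpha>) / (2 * \<alpha>) + 1 - p"
  define L where "L = ln s"
  have L: "L > 0" using s by (simp add: L_def)
  have T0: "T > 0" using T by (simp add: T_def)
  have u: "u = T powr (1 / 2)" "u\<^sup>2 = T" "u > 0"
    using T0 by (simp_all add: u_def threshold_def T_def powr_half_sqrt)
  have mT: "real m * T / 2 = L + c * ln L"
    using m by (simp add: T_def threshold_sq_def m(2) c_def L_def field_simps)
  have "u powr (2 / \<alpha>) = T powr (1 / \<alpha>)"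
    by (simp add: u(1) powr_powr)
  moreover have "u ^ m = T powr (real m / 2)"
    using u(3) by (subst powr_realpow[symmetric]) (simp_all add: u(1) powr_powr)
  moreover have "exp (- u\<^sup>2 / 2) ^ m = exp (- (real m * T / 2))"
    by (simp add: u(2) exp_of_nat_mult[symmetric])
  moreover have "exp (- (real m * T / 2)) = 1 / s * L powr (- c)"
    unfolding mT using s L by (simp add: exp_minus exp_add exp_diff L_def powr_def field_simps)
  ultimately have "u powr (2 / \<alpha>) * (exp (- u\<^sup>2 / 2) / u) ^ m =
      T powr (1 / \<alpha> - real m / 2) * (1 / s * L powr (- c))"
    by (simp add: power_divide powr_diff)
  also have "T powr (1 / \<alpha> - real m / 2) = (T / L) powr (1 / \<alpha> - real m / 2) * L powr (1 / \<alpha> - real m / 2)"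
    using T0 L by (simp add: powr_mult[symmetric])
  finally have "u powr (2 / \<alpha>) * (exp (- u\<^sup>2 / 2) / u) ^ m =
      (T / L) powr (1 / \<alpha> - real m / 2) * (1 / s * (L powr (1 / \<alpha> - real m / 2) * L powr (- c)))"
    by (simp only: mult_ac)
  also have "L powr (1 / \<alpha> - real m / 2) * L powr (- c) = L powr (1 / \<alpha> - real m / 2 + - c)"
    by (rule powr_add[symmetric])
  also have "1 / \<alpha> - real m / 2 + - c = p - 1"
    using \<alpha> by (simp add: c_def field_simps)
  finally show ?thesis
    by (simp only: T_def L_def)
qed

lemma rate_comparison:
  obtains c s0 where "c > 0" 
   "\<And>s. s \<ge> s0 \<Longrightarrow> threshold \<alpha> r n p s > 0 \<and>
      threshold \<alpha> r n p s powr (2 / \<alpha>) * (exp (- (threshold \<alpha> r n p s)\<^sup>2 / 2) / threshold \<alpha> r n p s) ^ m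
        \<in> {c * (1 / s * ln s powr (p - 1)) .. 4 * c * (1 / s * ln s powr (p - 1))}"
proof -
  let ?e = "1 / \<alpha> - real m / 2"
  define c where "c = (2 / real m) powr ?e / 2"
  have c: "c > 0" using m by (simp add: c_def)
  have "((\<lambda>s. (threshold_sq \<alpha> r n p s / ln s) powr ?e) \<longlongrightarrow> (2 / real m) powr ?e) at_top"
    by (rule tendsto_powr[OF threshold_sq_ratio tendsto_const]) (use m in simp)
  then have "\<forall>\<^sub>F s in at_top. (threshold_sq \<alpha> r n p s / ln s) powr ?e > c"
     "\<forall>\<^sub>F s in at_top. (threshold_sq \<alpha> r n p s / ln s) powr ?e < 4 * c"
    by (rule order_tendstoD; use c in \<open>simp add: c_def\<close>)+
  moreover have "\<forall>\<^sub>F s in at_top. threshold_sq \<alpha> r n p s > 0"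
    using filterlim_threshold_sq unfolding filterlim_at_top_dense by blast
  moreover have "\<forall>\<^sub>F s::real in at_top. s > 1" by (rule eventually_gt_at_top)
  ultimately have "\<forall>\<^sub>F s in at_top. threshold \<alpha> r n p s > 0 \<and>
      threshold \<alpha> r n p s powr (2 / \<alpha>) * (exp (- (threshold \<alpha> r n p s)\<^sup>2 / 2) / threshold \<alpha> r n p s) ^ m
        \<in> {c * (1 / s * ln s powr (p - 1)) .. 4 * c * (1 / s * ln s powr (p - 1))}"
  proof eventually_elim
    case (elim s)
    show ?case unfolding rate_eq[OF elim(4,3)] atLeastAtMost_iff
      using elim by (intro conjI mult_right_mono) (auto simp: threshold_def)
  qed
  then show thesis unfolding eventually_at_top_linorder using that c by blast
qed

lemma summable_rate:
  assumes p: "p < 0"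
  defines "u \<equiv> \<lambda>k. threshold \<alpha> r n p (real k)"
  shows "summable (\<lambda>k. u k powr (2 / \<alpha>) * (exp (- (u k)\<^sup>2 / 2) / u k) ^ m)"
proof -
  obtain c s0 where c: "c > 0" and s0: "\<And>s. s \<ge> s0 \<Longrightarrow> threshold \<alpha> r n p s > 0 \<and>
      threshold \<alpha> r n p s powr (2 / \<alpha>) * (exp (- (threshold \<alpha> r n p s)\<^sup>2 / 2) / threshold \<alpha> r n p s) ^ m
        \<in> {c * (1 / s * ln s powr (p - 1)) .. 4 * c * (1 / s * ln s powr (p - 1))}"
    using rate_comparison[of p] by blast
  have "summable (\<lambda>k. 4 * c * (1 / real k * ln (real k) powr (- (1 - p))))"
    by (intro summable_mult) (use p in \<open>subst summable_bertrand_iff; simp\<close>)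
  then show ?thesis
  proof (rule summable_comparison_test'[where N = "nat \<lceil>s0\<rceil>"])
    fix k assume "nat \<lceil>s0\<rceil> \<le> k"
    then have "s0 \<le> real k" by (simp add: nat_ceiling_le_eq)
    from s0[OF this] show "norm (u k powr (2 / \<alpha>) * (exp (- (u k)\<^sup>2 / 2) / u k) ^ m) \<le>
        4 * c * (1 / real k * ln (real k) powr (- (1 - p)))"
      by (simp add: u_def)
  qed
qed

lemma not_summable_rate:
  defines "u \<equiv> \<lambda>k. threshold \<alpha> r n 0 (real (Suc k))"
  shows "\<not> summable (\<lambda>k. u k powr (2 / \<alpha>) * normal_tail (u k) ^ m)"
proof
  assume "summable (\<lambda>k. u k powr (2 / \<alpha>) * normal_tail (u k) ^ m)"
  obtain c s0 where c: "c > 0" and s0: "\<And>s. s \<ge> s0 \<Longrightarrow> threshold \<alpha> r n 0 s > 0 \<and>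
      threshold \<alpha> r n 0 s powr (2 / \<alpha>) * (exp (- (threshold \<alpha> r n 0 s)\<^sup>2 / 2) / threshold \<alpha> r n 0 s) ^ m
        \<in> {c * (1 / s * ln s powr (0 - 1)) .. 4 * c * (1 / s * ln s powr (0 - 1))}"
    using rate_comparison[of 0] by blast
  have "\<forall>\<^sub>F s in at_top. threshold \<alpha> r n 0 s \<ge> 1"
    using filterlim_threshold unfolding filterlim_at_top by blast
  then obtain s1 where s1: "\<And>s. s \<ge> s1 \<Longrightarrow> threshold \<alpha> r n 0 s \<ge> 1"
    unfolding eventually_at_top_linorder by blast
  have "summable (\<lambda>k. (u k powr (2 / \<alpha>) * normal_tail (u k) ^ m) * (1 / (c * tail_const ^ m)))"
    by (rule summable_mult2) fact
  then have "summable (\<lambda>k. 1 / real (Suc k) * ln (real (Suc k)) powr (- 1))"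
  proof (rule summable_comparison_test'[where N = "nat \<lceil>max s0 s1\<rceil>"])
    fix k assume "nat \<lceil>max s0 s1\<rceil> \<le> k"
    then have "max s0 s1 \<le> real (Suc k)" by (simp add: nat_ceiling_le_eq)
    then have k: "s0 \<le> real (Suc k)" "s1 \<le> real (Suc k)" by auto
    have u1: "u k \<ge> 1" using s1[OF k(2)] by (simp add: u_def)
    have "(tail_const * (exp (- (u k)\<^sup>2 / 2) / u k)) ^ m \<le> normal_tail (u k) ^ m"
      using normal_tail_lower[OF u1] tail_const_pos u1 by (intro power_mono) auto
    then have "tail_const ^ m * (u k powr (2 / \<alpha>) * (exp (- (u k)\<^sup>2 / 2) / u k) ^ m) \<le> u k powr (2 / \<alpha>) * normal_tail (u k) ^ m"
      unfolding power_mult_distrib by (metis mult.left_commute mult_left_mono powr_ge_zero)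
    moreover have "tail_const ^ m * (c * (1 / real (Suc k) * ln (real (Suc k)) powr (- 1))) \<le>
        tail_const ^ m * (u k powr (2 / \<alpha>) * (exp (- (u k)\<^sup>2 / 2) / u k) ^ m)"
      using s0[OF k(1)] tail_const_pos by (intro mult_left_mono) (auto simp: u_def)
    ultimately have "tail_const ^ m * (c * (1 / real (Suc k) * ln (real (Suc k)) powr (- 1))) \<le> u k powr (2 / \<alpha>) * normal_tail (u k) ^ m"
      by linarith
    then show "norm (1 / real (Suc k) * ln (real (Suc k)) powr (- 1)) \<le>
        (u k powr (2 / \<alpha>) * normal_tail (u k) ^ m) * (1 / (c * tail_const ^ m))"
      using c tail_const_pos by (simp add: field_simps)
  qed
  then have "summable (\<lambda>k. 1 / real k * ln (real k) powr (- 1))"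
    by (subst (asm) summable_Suc_iff)
  then show False by (subst (asm) summable_bertrand_iff) simp_all
qed

end

section \<open>Almost sure behaviour of the order statistics\<close>

lemma frequently_at_top_real: "(\<exists>\<^sub>F t::real in at_top. P t) \<longleftrightarrow> (\<forall>B. \<exists>t\<ge>B. P t)"
  unfolding frequently_def eventually_at_top_linorder by auto

lemma (in prob_space) completion_event_of_AE:
  assumes "AE \<omega> in M. P \<omega>"
  shows "{\<omega> \<in> space M. P \<omega>} \<in> sets (completion M)" "measure (completion M) {\<omega> \<in> space M. P \<omega>} = 1"
proof -
  interpret C: prob_space "completion M" by (rule prob_space_completion)
  have "AE \<omega> in completion M. P \<omega>" using assms by (rule AE_completion)
  moreover have "AE \<omega> in M. \<not> \<not> P \<omega>" using assms by simp
  then have "Measurable.pred (completion M) (\<lambda>\<omega>. \<not> P \<omega>)" by (rule sets_completion_AE)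
  then have "space (completion M) - {\<omega> \<in> space M. \<not> P \<omega>} \<in> sets (completion M)"
    by (intro sets.compl_sets) (simp add: pred_def)
  then show ev: "{\<omega> \<in> space M. P \<omega>} \<in> sets (completion M)"
    by (rule back_subst[of "\<lambda>A. A \<in> sets (completion M)"]) auto
  ultimately show "measure (completion M) {\<omega> \<in> space M. P \<omega>} = 1"
    using C.prob_Collect_eq_1[of P] by simp
qed

lemma (in prob_space) completion_event_of_AE_not:
  assumes "AE \<omega> in M. \<not> P \<omega>"
  shows "{\<omega> \<in> space M. P \<omega>} \<in> sets (completion M)" "measure (completion M) {\<omega> \<in> space M. P \<omega>} = 0"
proof -
  interpret C: prob_space "completion M" by (rule prob_space_completion)
  have "AE \<omega> in completion M. \<not> P \<omega>" using assms by (rule AE_completion)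
  moreover have "Measurable.pred (completion M) P" using assms by (rule sets_completion_AE)
  then show ev: "{\<omega> \<in> space M. P \<omega>} \<in> sets (completion M)" by (simp add: pred_def)
  ultimately show "measure (completion M) {\<omega> \<in> space M. P \<omega>} = 0"
    using C.prob_Collect_eq_0[of P] by simp
qed

context gaussian_copies
begin

lemma AE_eventually_below_threshold:
  assumes \<alpha>: "\<alpha> > 0" and "K > 0" "\<delta> > 0"
    and "\<And>\<tau>. 0 < \<tau> \<Longrightarrow> \<tau> \<le> \<delta> \<Longrightarrow> 1 - R \<tau> \<le> K * \<tau> powr \<alpha>"
    and p: "p < 0"
  shows "AE \<omega> in M. \<forall>\<^sub>F t in at_top. order_stat_process r n Xs t \<omega> \<le> threshold \<alpha> r n p t"
proof -
  define u where "u k = threshold \<alpha> r n p (real k)" for k :: nat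
  have lim: "filterlim u at_top sequentially"
    unfolding u_def[abs_def] by (rule filterlim_compose[OF filterlim_threshold[OF \<alpha> rhat(1,3)] filterlim_real_sequentially])
  have "AE \<omega> in M. \<forall>\<^sub>F k in sequentially. \<forall>t\<in>{real k..real k + 1}. order_stat_process r n Xs t \<omega> \<le> u k"
    by (rule eventually_no_exceedance[OF assms(1-4) lim])
       (use summable_rate[OF \<alpha> rhat(1,3) p] in \<open>simp_all add: u_def\<close>)
  then show ?thesis
  proof eventually_elim
    case (elim \<omega>)
    then obtain k0 where k0: "\<And>k t. k \<ge> k0 \<Longrightarrow> t \<in> {real k..real k + 1} \<Longrightarrow> order_stat_process r n Xs t \<omega> \<le> u k"
      unfolding eventually_sequentially by blast
    obtain s0 where s0: "s0 > 1" "\<And>s t. s0 \<le> s \<Longrightarrow> s \<le> t \<Longrightarrow> threshold \<alpha> r n p s \<le> threshold \<alpha> r n p t"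
      using threshold_mono[OF \<alpha> rhat(1,3), of p] by blast
    show ?case unfolding eventually_at_top_linorder
    proof (intro exI[of _ "max (real k0) s0 + 1"] allI impI)
      fix t assume t: "max (real k0) s0 + 1 \<le> t"
      define k where "k = nat \<lfloor>t\<rfloor>"
      have "t \<ge> 0" using t by linarith
      then have k: "real k \<le> t" "t \<le> real k + 1" unfolding k_def by linarith+
      have "k0 \<le> k" "s0 \<le> real k" using k t by linarith+
      then show "order_stat_process r n Xs t \<omega> \<le> threshold \<alpha> r n p t"
        using k0[of k t] s0(2)[of "real k" t] k by (auto simp: u_def)
    qed
  qed
qed

text \<open>
  The level on block \<open>k\<close> is the threshold at \<open>k + 1\<close>, which dominates the threshold on the whole
  block once \<open>k\<close> is large. Late thresholds decrease in \<open>p\<close>, so the critical case \<open>p = 0\<close> suffices.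
\<close>

lemma AE_frequently_above_threshold:
  assumes \<alpha>: "\<alpha> > 0" and "c > 0" "\<And>\<tau>. 0 < \<tau> \<Longrightarrow> \<tau> \<le> 1 / 2 \<Longrightarrow> c * \<tau> powr \<alpha> \<le> 1 - R \<tau>"
    and "\<kappa> > 0" "\<And>\<tau>. 1 / 2 \<le> \<tau> \<Longrightarrow> R \<tau> \<le> 1 - \<kappa>"
    and "lam > 0" "D > 0" "\<And>\<tau>. T0 \<le> \<tau> \<Longrightarrow> \<bar>R \<tau>\<bar> \<le> D * \<tau> powr (- 2 * lam)"
    and p: "p \<ge> 0"
  shows "AE \<omega> in M. \<exists>\<^sub>F t in at_top. order_stat_process r n Xs t \<omega> > threshold \<alpha> r n p t"
proof -
  define u where "u k = threshold \<alpha> r n 0 (real (Suc k))" for k :: nat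
  have lim: "filterlim u at_top sequentially"
    unfolding u_def[abs_def]
    by (intro filterlim_compose[OF filterlim_threshold[OF \<alpha> rhat(1,3)]] filterlim_compose[OF filterlim_real_sequentially] filterlim_Suc)
  obtain s0 where s0: "s0 > 1" "\<And>s t. s0 \<le> s \<Longrightarrow> s \<le> t \<Longrightarrow> threshold \<alpha> r n 0 s \<le> threshold \<alpha> r n 0 t"
    using threshold_mono[OF \<alpha> rhat(1,3), of 0] by blast
  have r1: "((\<lambda>k. threshold_sq \<alpha> r n 0 (real (Suc k)) / ln (real (Suc k))) \<longlongrightarrow> 2 / real rhat) sequentially"
    by (intro filterlim_compose[OF threshold_sq_ratio[OF \<alpha> rhat(1,3)]] filterlim_compose[OF filterlim_real_sequentially] filterlim_Suc)
  have r2: "((\<lambda>k. ln (real (Suc k)) / ln (real k)) \<longlongrightarrow> 1) sequentially"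
    by real_asymp
  have "((\<lambda>k. (threshold_sq \<alpha> r n 0 (real (Suc k)) / ln (real (Suc k))) * (ln (real (Suc k)) / ln (real k))) \<longlongrightarrow> 2 / real rhat * 1) sequentially"
    by (intro tendsto_mult r1 r2)
  then have "((\<lambda>k. threshold_sq \<alpha> r n 0 (real (Suc k)) / ln (real k)) \<longlongrightarrow> 2 / real rhat * 1) sequentially"
    by (rule Lim_transform_eventually) (use eventually_gt_at_top[of 1] in eventually_elim, simp)
  then have "\<forall>\<^sub>F k in sequentially. threshold_sq \<alpha> r n 0 (real (Suc k)) / ln (real k) > 1 / real rhat"
    "\<forall>\<^sub>F k in sequentially. threshold_sq \<alpha> r n 0 (real (Suc k)) / ln (real k) < 3 / real rhat"
    by (rule order_tendstoD; use rhat in \<open>simp add: divide_strict_right_mono\<close>)+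
  moreover have "\<forall>\<^sub>F k in sequentially. real k \<ge> max 2 s0"
    using filterlim_real_sequentially unfolding filterlim_at_top by blast
  ultimately have "\<forall>\<^sub>F k in sequentially. real k \<ge> max 2 s0 \<and> 1 / real rhat * ln (real k) \<le> (u k)\<^sup>2 \<and> (u k)\<^sup>2 \<le> 3 / real rhat * ln (real k)"
  proof eventually_elim
    case (elim k)
    then have L: "ln (real k) > 0" by simp
    have "threshold_sq \<alpha> r n 0 (real (Suc k)) > 0"
      using elim(1) L rhat by (smt (verit) divide_nonneg_nonneg divide_nonpos_pos of_nat_0_le_iff)
    then have "(u k)\<^sup>2 = threshold_sq \<alpha> r n 0 (real (Suc k))"
      unfolding u_def by (rule threshold_sq_eq[OF \<alpha> rhat(1,3)])
    then show ?case using elim L by (simp add: field_simps)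
  qed
  then obtain k1 where k1: "\<And>k. k \<ge> k1 \<Longrightarrow> real k \<ge> max 2 s0 \<and> 1 / real rhat * ln (real k) \<le> (u k)\<^sup>2 \<and> (u k)\<^sup>2 \<le> 3 / real rhat * ln (real k)"
    unfolding eventually_sequentially by blast
  have "AE \<omega> in M. \<exists>\<^sub>F k in sequentially. \<exists>t\<in>{real k..real k + 1 / 2}. order_stat_process r n Xs t \<omega> > u k"
  proof (rule infinitely_often_exceedance[OF assms(1-8) lim, where ?k1.0 = k1 and a = "1 / real rhat" and b = "3 / real rhat"])
    show "u k \<le> u l" if "k1 \<le> k" "k \<le> l" for k l
      unfolding u_def using k1[OF that(1)] that by (intro s0(2)) auto
    show "\<not> summable (\<lambda>k. u k powr (2 / \<alpha>) * normal_tail (u k) ^ rhat)"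
      unfolding u_def by (rule not_summable_rate[OF \<alpha> rhat(1,3)])
  qed (use k1 rhat in auto)
  then show ?thesis
  proof eventually_elim
    case (elim \<omega>)
    show ?case unfolding frequently_at_top_real
    proof
      fix B :: real
      define k0 where "k0 = max (nat \<lceil>max B (exp 1)\<rceil>) k1"
      obtain k t where k: "k \<ge> k0" and t: "t \<in> {real k..real k + 1 / 2}" "order_stat_process r n Xs t \<omega> > u k"
        using elim unfolding frequently_sequentially by blast
      have kB: "real k \<ge> max B (exp 1)" "k \<ge> k1" using k by (auto simp: k0_def nat_ceiling_le_eq)
      have "threshold \<alpha> r n p t \<le> threshold \<alpha> r n 0 t"
        by (rule threshold_antimono_exponent[OF \<alpha> rhat(1,3) p]) (use t kB in auto)
      also have "\<dots> \<le> u k"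
        unfolding u_def by (rule s0(2)) (use t k1[OF kB(2)] in auto)
      finally show "\<exists>t\<ge>B. order_stat_process r n Xs t \<omega> > threshold \<alpha> r n p t"
        using t kB by (intro exI[of _ t]) auto
    qed
  qed
qed

lemma exceeds_io_iff_frequently:
  assumes \<alpha>: "\<alpha> > 0"
  shows "exceeds_io M \<alpha> r n p Xs =
    {\<omega> \<in> space M. \<exists>\<^sub>F t in at_top. order_stat_process r n Xs t \<omega> > threshold \<alpha> r n p t}"
proof -
  have "\<forall>\<^sub>F t in at_top. t \<in> threshold_dom \<alpha> r n p"
  proof -
    have "\<forall>\<^sub>F t in at_top. threshold_sq \<alpha> r n p t > 0"
      using filterlim_threshold_sq[OF \<alpha> rhat(1,3)] unfolding filterlim_at_top_dense by blast
    then show ?thesis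
      using eventually_gt_at_top[of "1 :: real"] by eventually_elim (simp add: threshold_dom_def)
  qed
  then obtain s0 where s0: "\<And>t. t \<ge> s0 \<Longrightarrow> t \<in> threshold_dom \<alpha> r n p"
    unfolding eventually_at_top_linorder by blast
  have "\<not> bdd_above {t \<in> threshold_dom \<alpha> r n p. P t} \<longleftrightarrow> (\<exists>\<^sub>F t in at_top. P t)" for P
  proof
    assume unb: "\<not> bdd_above {t \<in> threshold_dom \<alpha> r n p. P t}"
    show "\<exists>\<^sub>F t in at_top. P t"
      unfolding frequently_at_top_real
    proof
      fix B
      from unb obtain t where "t \<in> threshold_dom \<alpha> r n p" "P t" "\<not> t \<le> B"
        unfolding bdd_above_def by blast
      then show "\<exists>t\<ge>B. P t" by (intro exI[of _ t]) auto
    qed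
  next
    assume fr: "\<exists>\<^sub>F t in at_top. P t"
    show "\<not> bdd_above {t \<in> threshold_dom \<alpha> r n p. P t}"
    proof
      assume "bdd_above {t \<in> threshold_dom \<alpha> r n p. P t}"
      then obtain B where B: "\<And>t. t \<in> threshold_dom \<alpha> r n p \<Longrightarrow> P t \<Longrightarrow> t \<le> B"
        unfolding bdd_above_def by blast
      from fr obtain t where "t \<ge> max s0 (B + 1)" "P t"
        unfolding frequently_at_top_real by blast
      with B[OF s0[of t]] show False by simp
    qed
  qed
  then show ?thesis by (simp add: exceeds_io_def)
qed

lemma Limsup_order_stat:
  assumes \<alpha>: "\<alpha> > 0"
    and below: "\<forall>\<^sub>F t in at_top. order_stat_process r n Xs t \<omega> \<le> threshold \<alpha> r n p t"
    and above: "\<exists>\<^sub>F t in at_top. order_stat_process r n Xs t \<omega> > threshold \<alpha> r n p' t"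
  shows "Limsup at_top (\<lambda>t. ereal (order_stat_process r n Xs t \<omega> / sqrt (ln t))) = ereal (sqrt (2 / r_hat r n))"
proof (rule antisym)
  let ?X = "\<lambda>t. order_stat_process r n Xs t \<omega> / sqrt (ln t)" and ?L = "sqrt (2 / real rhat)"
  note lim = threshold_ratio[OF \<alpha> rhat(1,3)]
  have gt1: "\<forall>\<^sub>F t::real in at_top. t > 1" by (rule eventually_gt_at_top)
  have "Limsup at_top (\<lambda>t. ereal (?X t)) \<le> Limsup at_top (\<lambda>t. ereal (threshold \<alpha> r n p t / sqrt (ln t)))"
  proof (rule Limsup_mono)
    show "\<forall>\<^sub>F t in at_top. ereal (?X t) \<le> ereal (threshold \<alpha> r n p t / sqrt (ln t))"
      using below gt1 by eventually_elim (simp add: divide_right_mono)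
  qed
  also have "\<dots> = ereal ?L"
    by (rule lim_imp_Limsup) (use lim in \<open>auto intro: tendsto_ereal\<close>)
  finally show "Limsup at_top (\<lambda>t. ereal (?X t)) \<le> ereal (sqrt (2 / r_hat r n))" by (simp add: rhat(3))
  show "ereal (sqrt (2 / r_hat r n)) \<le> Limsup at_top (\<lambda>t. ereal (?X t))"
  proof (rule ccontr)
    assume "\<not> ?thesis"
    then obtain y where y: "Limsup at_top (\<lambda>t. ereal (?X t)) < y" "y < ereal (sqrt (2 / r_hat r n))"
      using dense[of "Limsup at_top (\<lambda>t. ereal (?X t))"] by (auto simp: not_le)
    have "((\<lambda>t. ereal (threshold \<alpha> r n p' t / sqrt (ln t))) \<longlongrightarrow> ereal ?L) at_top"
      using lim by (rule tendsto_ereal)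
    then have "\<forall>\<^sub>F t in at_top. y < ereal (threshold \<alpha> r n p' t / sqrt (ln t))"
      by (rule order_tendstoD) (use y in \<open>simp add: rhat(3)\<close>)
    then have "\<forall>\<^sub>F t in at_top. order_stat_process r n Xs t \<omega> > threshold \<alpha> r n p' t \<longrightarrow> y < ereal (?X t)"
      using gt1
    proof eventually_elim
      case (elim t)
      show ?case
      proof
        assume "order_stat_process r n Xs t \<omega> > threshold \<alpha> r n p' t"
        then have "threshold \<alpha> r n p' t / sqrt (ln t) \<le> ?X t"
          using elim(2) by (intro divide_right_mono) auto
        with elim(1) show "y < ereal (?X t)" by (meson ereal_less_eq(3) less_le_trans)
      qed
    qed
    with above have "\<exists>\<^sub>F t in at_top. y < ereal (?X t)"
      by (rule frequently_rev_mp)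
    moreover have "\<forall>\<^sub>F t in at_top. ereal (?X t) < y"
      by (rule Limsup_lessD[OF y(1)])
    ultimately show False
      by (auto simp: frequently_def elim!: notE eventually_mono)
  qed
qed

end

theorem mainTheorem3:
  fixes N :: "'b measure" and X :: "real \<Rightarrow> 'b \<Rightarrow> real"
    and M :: "'a measure" and Xs :: "nat \<Rightarrow> real \<Rightarrow> 'a \<Rightarrow> real"
    and \<alpha> C lam :: real and r n :: nat
  assumes "prob_space N"
    and "gaussian_process N X"
    and "stationary_process N X"
    and "continuous_paths N X"
    and "\<And>t. t \<ge> 0 \<Longrightarrow> (\<integral>\<omega>. X t \<omega> \<partial>N) = 0"
    and "\<And>t. t \<ge> 0 \<Longrightarrow> (\<integral>\<omega>. (X t \<omega>)\<^sup>2 \<partial>N) = 1"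
    and "0 < \<alpha>" and "\<alpha> \<le> 2" and "C > 0"
    and "(\<lambda>t. correlation N X t - (1 - C * \<bar>t\<bar> powr \<alpha>)) \<in> o[at_right 0](\<lambda>t. \<bar>t\<bar> powr \<alpha>)"
    and "\<And>s. s > 0 \<Longrightarrow> (SUP t\<in>{s..}. \<bar>correlation N X t\<bar>) < 1"
    and "lam > 0"
    and "correlation N X \<in> O[at_top](\<lambda>t. t powr (- 2 * lam))"
    and "prob_space M"
    and "n \<ge> 1" and "1 \<le> r" and "r \<le> n"
    and "independent_processes M Xs {1..n}"
    and "\<And>j. j \<in> {1..n} \<Longrightarrow> process_law M (Xs j) = process_law N X"
    and "\<And>j. j \<in> {1..n} \<Longrightarrow> continuous_paths M (Xs j)"
  shows "(\<forall>p. exceeds_io M \<alpha> r n p Xs \<in> sets (completion M) \<and>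
            measure (completion M) (exceeds_io M \<alpha> r n p Xs) = (if p \<ge> 0 then 1 else 0)) \<and>
         (AE \<omega> in M. Limsup at_top (\<lambda>t. ereal (order_stat_process r n Xs t \<omega> / sqrt (ln t)))
            = ereal (sqrt (2 / r_hat r n)))"
proof -
  interpret N: prob_space N by fact
  interpret M: prob_space M by fact
  define R where "R = correlation N X"
  have pairN: "gauss_pair N (X s) (X t) (R \<bar>t - s\<bar>)" if "s \<ge> 0" "t \<ge> 0" for s t
    unfolding R_def using that by (intro gauss_pair_process assms(1-6)) auto
  have spN: "sample_path X \<in> N \<rightarrow>\<^sub>M path_space"
    by (rule measurable_sample_path) (rule gaussian_process_measurable[OF assms(2)])
  have spM: "sample_path (Xs j) \<in> M \<rightarrow>\<^sub>M path_space" if "j \<in> {1..n}" for j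
    using assms(18) that unfolding independent_processes_def M.indep_vars_def by blast
  interpret gaussian_copies M Xs R r n
  proof
    show "gauss_pair M (Xs j s) (Xs j t) (R \<bar>t - s\<bar>)" if "j \<in> {1..n}" "s \<ge> 0" "t \<ge> 0" for j s t
      using pairN[OF that(2,3)] that
      unfolding gauss_pair_process_law[OF spN that(2,3)] gauss_pair_process_law[OF spM[OF that(1)] that(2,3)]
      by (simp add: assms(19))
  qed (use assms in auto)
  note \<alpha> = \<open>0 < \<alpha>\<close>
  have R_le: "\<bar>R \<tau>\<bar> \<le> 1" if "\<tau> \<ge> 0" for \<tau>
    using N.gauss_pair_abs_corr_le_1[OF pairN[of 0 \<tau>]] that by simp
  have R_sup: "\<bar>R \<tau>\<bar> \<le> (SUP t\<in>{s..}. \<bar>R t\<bar>)" if "s > 0" "s \<le> \<tau>" for s \<tau>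
    by (rule cSUP_upper) (use that R_le in \<open>auto intro!: bdd_aboveI[of _ 1]\<close>)
  have "\<forall>\<^sub>F \<tau> in at_right 0. norm (R \<tau> - (1 - C * \<bar>\<tau>\<bar> powr \<alpha>)) \<le> C / 2 * norm (\<bar>\<tau>\<bar> powr \<alpha>)"
    unfolding R_def by (rule landau_o.smallD[OF assms(10)]) (use \<open>C > 0\<close> in simp)
  then obtain \<delta>0 where \<delta>0: "\<delta>0 > 0" "\<And>\<tau>. 0 < \<tau> \<Longrightarrow> \<tau> < \<delta>0 \<Longrightarrow> \<bar>R \<tau> - (1 - C * \<tau> powr \<alpha>)\<bar> \<le> C / 2 * \<tau> powr \<alpha>"
    unfolding eventually_at_right_field by (auto simp: abs_of_pos)
  define \<delta> where "\<delta> = \<delta>0 / 2"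
  have \<delta>: "\<delta> > 0" using \<delta>0 by (simp add: \<delta>_def)
  have local: "C / 2 * \<tau> powr \<alpha> \<le> 1 - R \<tau>" "1 - R \<tau> \<le> 2 * C * \<tau> powr \<alpha>" if "0 < \<tau>" "\<tau> \<le> \<delta>" for \<tau>
  proof -
    have "\<bar>R \<tau> - (1 - C * \<tau> powr \<alpha>)\<bar> \<le> C / 2 * \<tau> powr \<alpha>" using \<delta>0 that by (simp add: \<delta>_def)
    moreover have "0 \<le> C * \<tau> powr \<alpha>" using \<open>C > 0\<close> by simp
    ultimately show "C / 2 * \<tau> powr \<alpha> \<le> 1 - R \<tau>" "1 - R \<tau> \<le> 2 * C * \<tau> powr \<alpha>"
      unfolding abs_le_iff by (simp_all add: algebra_simps)
  qed
  define \<sigma> where "\<sigma> s = (SUP t\<in>{s..}. \<bar>R t\<bar>)" for s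
  have \<sigma>: "\<sigma> s < 1" if "s > 0" for s using assms(11)[OF that] by (simp add: \<sigma>_def R_def)
  define c where "c = min (C / 2) (1 - \<sigma> \<delta>)"
  have c: "c > 0" using \<open>C > 0\<close> \<sigma>[OF \<delta>] by (simp add: c_def)
  have low: "c * \<tau> powr \<alpha> \<le> 1 - R \<tau>" if \<tau>: "0 < \<tau>" "\<tau> \<le> 1 / 2" for \<tau>
  proof (cases "\<tau> \<le> \<delta>")
    case True
    have "c * \<tau> powr \<alpha> \<le> C / 2 * \<tau> powr \<alpha>" unfolding c_def by (intro mult_right_mono min.cobounded1) simp
    then show ?thesis using local(1)[OF \<tau>(1) True] by linarith
  next
    case False
    have "\<tau> powr \<alpha> \<le> 1 powr \<alpha>" using \<tau> \<alpha> by (intro powr_mono2) auto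
    then have "c * \<tau> powr \<alpha> \<le> c * 1" using c by (intro mult_left_mono) auto
    also have "\<dots> \<le> 1 - \<sigma> \<delta>" by (simp add: c_def)
    also have "\<dots> \<le> 1 - R \<tau>" using R_sup[OF \<delta>, of \<tau>] False by (simp add: \<sigma>_def)
    finally show ?thesis .
  qed
  define \<kappa> where "\<kappa> = 1 - \<sigma> (1 / 2)"
  have \<kappa>: "\<kappa> > 0" using \<sigma>[of "1 / 2"] by (simp add: \<kappa>_def)
  have sup: "R \<tau> \<le> 1 - \<kappa>" if "1 / 2 \<le> \<tau>" for \<tau>
    using R_sup[of "1 / 2" \<tau>] that by (simp add: \<kappa>_def \<sigma>_def)
  obtain D where D: "D > 0" "\<forall>\<^sub>F \<tau> in at_top. norm (R \<tau>) \<le> D * norm (\<tau> powr (- 2 * lam))"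
    using landau_o.bigE[OF assms(13)] unfolding R_def by blast
  then obtain T0 where T0: "\<And>\<tau>. T0 \<le> \<tau> \<Longrightarrow> \<bar>R \<tau>\<bar> \<le> D * \<tau> powr (- 2 * lam)"
    unfolding eventually_at_top_linorder by auto
  have K: "2 * C > 0" using \<open>C > 0\<close> by simp
  have below: "AE \<omega> in M. \<forall>\<^sub>F t in at_top. order_stat_process r n Xs t \<omega> \<le> threshold \<alpha> r n p t" if "p < 0" for p
    by (rule AE_eventually_below_threshold[OF \<alpha> K \<delta> local(2) that])
  have above: "AE \<omega> in M. \<exists>\<^sub>F t in at_top. order_stat_process r n Xs t \<omega> > threshold \<alpha> r n p t" if "p \<ge> 0" for p
    by (rule AE_frequently_above_threshold[OF \<alpha> c low \<kappa> sup \<open>lam > 0\<close> D(1) T0 that])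
  have "exceeds_io M \<alpha> r n p Xs \<in> sets (completion M) \<and>
      measure (completion M) (exceeds_io M \<alpha> r n p Xs) = (if p \<ge> 0 then 1 else 0)" for p
  proof (cases "p \<ge> 0")
    case True
    then show ?thesis unfolding exceeds_io_iff_frequently[OF \<alpha>]
      using M.completion_event_of_AE[OF above[OF True]] by simp
  next
    case False
    then have "AE \<omega> in M. \<not> (\<exists>\<^sub>F t in at_top. order_stat_process r n Xs t \<omega> > threshold \<alpha> r n p t)"
      using below[of p] by (simp add: not_frequently not_less)
    then show ?thesis unfolding exceeds_io_iff_frequently[OF \<alpha>]
      using M.completion_event_of_AE_not False by simp
  qed
  moreover have "AE \<omega> in M. Limsup at_top (\<lambda>t. ereal (order_stat_process r n Xs t \<omega> / sqrt (ln t)))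
            = ereal (sqrt (2 / r_hat r n))"
  proof -
    have "AE \<omega> in M. \<forall>\<^sub>F t in at_top. order_stat_process r n Xs t \<omega> \<le> threshold \<alpha> r n (- 1) t"
      by (rule below) simp
    moreover have "AE \<omega> in M. \<exists>\<^sub>F t in at_top. order_stat_process r n Xs t \<omega> > threshold \<alpha> r n 0 t"
      by (rule above) simp
    ultimately show ?thesis
      by eventually_elim (rule Limsup_order_stat[OF \<alpha>])
  qed
  ultimately show ?thesis by blast
qed

end
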